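(* Let $(X,\Sigma,\mathfrak m)$ be a $\sigma$-finite measure space, let $\mathbb B$ be a separable Banach space and let $\mathbf E$ be a Banach $\mathbb B$-bundle over $X$. Then, for every $p\in(1,\infty)$, $$\delta_{\mathbf E(x)}(\varepsilon)=\delta^{\rm pw}_{\Gamma_p(\mathbf E)}(\varepsilon)(x),\quad\text{for every }\varepsilon\in(0,2]\text{ and }\mathfrak m\text{-a.e. }x\in X.$$ Moreover, the following two conditions are equivalent: (i) $\mathbf E$ is a uniformly convex bundle (i.e. $\mathbf E(x)$ is uniformly convex for $\mathfrak m$-a.e. $x\in X$) and $\operatorname{ess\,inf}_{x\in X}\delta_{\mathbf E(x)}(\varepsilon)>0$ for every $\varepsilon\in(0,2]$. (ii) $\Gamma_p(\mathbf E)$ is uniformly convex (as a Banach space) for every (or, equivalently, for some) exponent $p\in(1,\infty)$. More precisely, for every $p\in(1,\infty)$ let $\varphi_p:(0,2]\times(0,1]\to(0,1]$ be a function, depending only on $p$, that is continuous and non-decreasing in each variable and such that $$\varphi_p\big(\varepsilon,\operatorname{ess\,inf}\delta^{\rm pw}_{\mathscr M}(\varepsilon/5)\big)\le\delta_{\mathscr M}(\varepsilon)$$ for every $L^p$-Banach $L^\infty$-module $\mathscr M$ over any $\sigma$-finite measure space and every $\varepsilon\in(0,2]$. Then $$\operatorname{ess\,inf}_{x\in X}\varphi_p\big(\varepsilon,\delta_{\mathbf E(x)}(\varepsilon/5)\big)\le\delta_{\Gamma_p(\mathbf E)}(\varepsilon)\le\operatorname{ess\,inf}_{x\in X}\delta_{\mathbf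 E(x)}(\varepsilon),\quad\text{for every }\varepsilon\in(0,2]\text{ and }p\in(1,\infty).$$ Here, in both displays involving $\varphi_p$, the expression $\varphi_p(\varepsilon,0)$ is read as $0$.
   Context: All Banach spaces are real. Modulus of convexity: for a Banach space $\mathbb B$ with unit sphere $\mathbb S_{\mathbb B}$, $\delta_{\mathbb B}:(0,2]\to[0,1]$ is $\delta_{\mathbb B}(\varepsilon)=\inf\{1-\|\tfrac{v+w}{2}\|_{\mathbb B}: v,w\in\mathbb S_{\mathbb B},\ \|v-w\|_{\mathbb B}\ge\varepsilon\}$, where the infimum is taken in $[0,1]$ (so it equals $1$ if the set is empty). $\mathbb B$ is uniformly convex if $\delta_{\mathbb B}(\varepsilon)>0$ for every $\varepsilon\in(0,2]$. Banach bundles: a Banach $\mathbb B$-bundle over $X$ is a multivalued map $\mathbf E$ from $X$ to $\mathbb B$ such that $\{x\in X:\mathbf E(x)\cap U\neq\varnothing\}\in\Sigma$ for every open $U\subseteq\mathbb B$ and $\mathbf E(x)$ is a closed linear subspace of $\mathbb B$ for every $x\in X$ (with the norm of $\mathbb B$). A map $v:X\to\mathbb B$ is strongly measurable if $x\mapsto\langle\omega,v(x)\rangle$ is measurable for every $\omega\in\mathbb B'$ (the dual of $\mathbb B$) and $v(X\setminus N)$ is separable for some $\mathfrak m$-null $N\in\Sigma$. A section of $\mathbf E$ is a strongly measurable $v:X\to\mathbb B$ with $v(x)\in\mathbf E(x)$ for all $x$. For $p\in(1,\infty)$, $\Gamma_p(\mathbf E)$ is the space of $\mathfrak m$-a.e.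 equivalence classes of sections $v$ with $\|v(\cdot)\|_{\mathbb B}\in L^p(\mathfrak m)$, a Banach space with norm $\|v\|_{\Gamma_p(\mathbf E)}=\big\|\|v(\cdot)\|_{\mathbb B}\big\|_{L^p(\mathfrak m)}$. Normed modules: an $L^p(\mathfrak m)$-normed $L^\infty(\mathfrak m)$-module is a module $\mathscr M$ over the ring $L^\infty(\mathfrak m)$ with a map $|\cdot|:\mathscr M\to L^p(\mathfrak m)$ (pointwise norm) such that, $\mathfrak m$-a.e., $|v|\ge0$ with equality iff $v=0$, $|v+w|\le|v|+|w|$, and $|f\cdot v|=|f||v|$, for all $v,w\in\mathscr M$, $f\in L^\infty(\mathfrak m)$. It is an $L^p(\mathfrak m)$-Banach $L^\infty(\mathfrak m)$-module if the norm $\|v\|_{\mathscr M}=\||v|\|_{L^p(\mathfrak m)}$ is complete. $\Gamma_p(\mathbf E)$ is such a module, with pointwise multiplication and $|v|=\|v(\cdot)\|_{\mathbb B}$. $\delta_{\mathscr M}$ denotes the modulus of convexity of $(\mathscr M,\|\cdot\|_{\mathscr M})$ as a Banach space. Pointwise modulus of convexity: for $\varepsilon\in(0,2]$, $$\delta^{\rm pw}_{\mathscr M}(\varepsilon)=\bigwedge\Big\{1-\mathbf 1_E\big|\tfrac{v+w}{2}\big| : v,w\in\mathscr M,\ E\in\Sigma,\ |v|=|w|=1\text{ and }|v-w|>\varepsilon\ \mathfrak m\text{-a.e. on }E\Big\}\in L^\infty(\mathfrak m),$$ where $\bigwedge$ denotes the essential infimum of a (possibly uncountable) family of functions, i.e.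 the $\mathfrak m$-a.e. greatest measurable function that is $\mathfrak m$-a.e. below each member. For a single function $f$, $\operatorname{ess\,inf}f=\sup\{\lambda\in\mathbb R\cup\{\pm\infty\}: f\ge\lambda\ \mathfrak m\text{-a.e. on }X\}$. A function $\varphi_p$ with the properties required in the claim exists for every $p\in(1,\infty)$.
   Formalization: At ε=2 the identity of moduli is claimed only for a.e. x with E(x) strictly convex: it fails otherwise, since |v-w|>2 is impossible (e.g. R² with the sup norm). The lower bound with φ_p assumes m(X)≠0, since for m(X)=0 the essential infimum is +∞. *)

theory Defs
  imports "HOL-Analysis.Analysis" "HOL-Algebra.Module"
begin

section \<open>Moduli of convexity\<close>

text \<open>
  The spaces at hand are subspaces of a Banach space, whose carrier varies with a point, and spaces
  of equivalence classes.  Neither is a type, so a real normed space is given by explicit data.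
\<close>

record 'v normed_space =
  vecs :: "'v set"
  vadd :: "'v \<Rightarrow> 'v \<Rightarrow> 'v"
  vscale :: "real \<Rightarrow> 'v \<Rightarrow> 'v"
  vnorm :: "'v \<Rightarrow> real"

text \<open>Inserting \<open>1\<close> makes this the infimum in \<open>[0,1]\<close>: it is \<open>1\<close> if no pair is admissible.\<close>

definition modulus :: "('v, 'z) normed_space_scheme \<Rightarrow> real \<Rightarrow> real" where
  "modulus B \<epsilon> = Inf (insert 1
     {1 - vnorm B (vscale B (1/2) (vadd B v w)) | v w.
        v \<in> vecs B \<and> w \<in> vecs B \<and> vnorm B v = 1 \<and> vnorm B w = 1 \<and>
        vnorm B (vadd B v (vscale B (-1) w)) \<ge> \<epsilon>})"

definition uniformly_convex :: "('v, 'z) normed_space_scheme \<Rightarrow> bool" where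
  "uniformly_convex B \<longleftrightarrow> (\<forall>\<epsilon>\<in>{0<..2}. modulus B \<epsilon> > 0)"

definition strictly_convex :: "('v, 'z) normed_space_scheme \<Rightarrow> bool" where
  "strictly_convex B \<longleftrightarrow>
     (\<forall>v\<in>vecs B. \<forall>w\<in>vecs B. vnorm B v = 1 \<and> vnorm B w = 1 \<and> v \<noteq> w \<longrightarrow>
        vnorm B (vscale B (1/2) (vadd B v w)) < 1)"

definition subspace_of :: "'b::real_normed_vector set \<Rightarrow> 'b normed_space" where
  "subspace_of V = \<lparr>vecs = V, vadd = (+), vscale = (*\<^sub>R), vnorm = norm\<rparr>"


section \<open>Essential infima\<close>

text \<open>
  The supremum of the essential lower bounds is used in place of the library's \<open>esssup\<close>, which is
  only meaningful for measurable functions: \<open>x \<mapsto> modulus (subspace_of (E x)) 2\<close> need only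
  be measurable with respect to the completion.  On a null space the value is \<open>\<infinity>\<close>.
\<close>

definition ess_inf :: "'x measure \<Rightarrow> ('x \<Rightarrow> ereal) \<Rightarrow> ereal" where
  "ess_inf M f = Sup {c. AE x in M. c \<le> f x}"

definition is_ess_Inf :: "'x measure \<Rightarrow> ('x \<Rightarrow> real) set \<Rightarrow> ('x \<Rightarrow> real) \<Rightarrow> bool" where
  "is_ess_Inf M F g \<longleftrightarrow>
     g \<in> borel_measurable M \<and> (\<forall>f\<in>F. AE x in M. g x \<le> f x) \<and>
     (\<forall>h\<in>borel_measurable M. (\<forall>f\<in>F. AE x in M. h x \<le> f x) \<longrightarrow> (AE x in M. h x \<le> g x))"

text \<open>
  A representative of the essential infimum of a family.  Any two of them agree almost everywhere;
  over a sigma-finite measure one exists for every nonempty family that is bounded below.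
\<close>

definition ess_Inf :: "'x measure \<Rightarrow> ('x \<Rightarrow> real) set \<Rightarrow> 'x \<Rightarrow> real" where
  "ess_Inf M F = (SOME g. is_ess_Inf M F g)"


section \<open>Normed modules\<close>

definition ae_rel :: "'x measure \<Rightarrow> ('x \<Rightarrow> 'b) set \<Rightarrow> (('x \<Rightarrow> 'b) \<times> ('x \<Rightarrow> 'b)) set" where
  "ae_rel M S = {(f, g). f \<in> S \<and> g \<in> S \<and> (AE x in M. f x = g x)}"

definition Lp_fun :: "'x measure \<Rightarrow> real \<Rightarrow> ('x \<Rightarrow> real) set" where
  "Lp_fun M p = {f \<in> borel_measurable M. integrable M (\<lambda>x. \<bar>f x\<bar> powr p)}"

definition Lp_norm :: "'x measure \<Rightarrow> real \<Rightarrow> ('x \<Rightarrow> real) \<Rightarrow> real" where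
  "Lp_norm M p f = (\<integral>x. \<bar>f x\<bar> powr p \<partial>M) powr (1 / p)"

definition Linf_fun :: "'x measure \<Rightarrow> ('x \<Rightarrow> real) set" where
  "Linf_fun M = {f \<in> borel_measurable M. \<exists>C. AE x in M. \<bar>f x\<bar> \<le> C}"

abbreviation Linf_class :: "'x measure \<Rightarrow> ('x \<Rightarrow> real) \<Rightarrow> ('x \<Rightarrow> real) set" where
  "Linf_class M f \<equiv> ae_rel M (Linf_fun M) `` {f}"

definition Linf :: "'x measure \<Rightarrow> ('x \<Rightarrow> real) set ring" where
  "Linf M =
     \<lparr>carrier = Linf_fun M // ae_rel M (Linf_fun M),
      mult = (\<lambda>F G. \<Union>f\<in>F. \<Union>g\<in>G. Linf_class M (\<lambda>x. f x * g x)),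
      one = Linf_class M (\<lambda>_. 1),
      zero = Linf_class M (\<lambda>_. 0),
      add = (\<lambda>F G. \<Union>f\<in>F. \<Union>g\<in>G. Linf_class M (\<lambda>x. f x + g x))\<rparr>"

text \<open>The pointwise norm of an element is given by a representative of its class in \<open>L\<^sup>p\<close>.\<close>

record ('x, 'v) normed_module = "(('x \<Rightarrow> real) set, 'v) module" +
  pnorm :: "'v \<Rightarrow> 'x \<Rightarrow> real"

definition Lp_normed_module ::
    "'x measure \<Rightarrow> real \<Rightarrow> ('x, 'v, 'z) normed_module_scheme \<Rightarrow> bool" where
  "Lp_normed_module M p \<M> \<longleftrightarrow>
     Module.module (Linf M) \<M> \<and>
     (\<forall>v\<in>carrier \<M>. pnorm \<M> v \<in> Lp_fun M p) \<and>
     (\<forall>v\<in>carrier \<M>. AE x in M. 0 \<le> pnorm \<M> v x) \<and>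
     (\<forall>v\<in>carrier \<M>. (AE x in M. pnorm \<M> v x = 0) \<longleftrightarrow> v = \<zero>\<^bsub>\<M>\<^esub>) \<and>
     (\<forall>v\<in>carrier \<M>. \<forall>w\<in>carrier \<M>. AE x in M.
        pnorm \<M> (v \<oplus>\<^bsub>\<M>\<^esub> w) x \<le> pnorm \<M> v x + pnorm \<M> w x) \<and>
     (\<forall>F\<in>carrier (Linf M). \<forall>f\<in>F. \<forall>v\<in>carrier \<M>. AE x in M.
        pnorm \<M> (F \<odot>\<^bsub>\<M>\<^esub> v) x = \<bar>f x\<bar> * pnorm \<M> v x)"

definition module_norm ::
    "'x measure \<Rightarrow> real \<Rightarrow> ('x, 'v, 'z) normed_module_scheme \<Rightarrow> 'v \<Rightarrow> real" where
  "module_norm M p \<M> v = Lp_norm M p (pnorm \<M> v)"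

definition Lp_Banach_module ::
    "'x measure \<Rightarrow> real \<Rightarrow> ('x, 'v, 'z) normed_module_scheme \<Rightarrow> bool" where
  "Lp_Banach_module M p \<M> \<longleftrightarrow>
     Lp_normed_module M p \<M> \<and>
     (\<forall>\<sigma>::nat \<Rightarrow> 'v. (\<forall>n. \<sigma> n \<in> carrier \<M>) \<and>
        (\<forall>e>0. \<exists>N. \<forall>m\<ge>N. \<forall>n\<ge>N. module_norm M p \<M> (\<sigma> m \<ominus>\<^bsub>\<M>\<^esub> \<sigma> n) < e) \<longrightarrow>
        (\<exists>l\<in>carrier \<M>. (\<lambda>n. module_norm M p \<M> (\<sigma> n \<ominus>\<^bsub>\<M>\<^esub> l)) \<longlonglongrightarrow> 0))"

definition module_scale ::
    "'x measure \<Rightarrow> ('x, 'v, 'z) normed_module_scheme \<Rightarrow> real \<Rightarrow> 'v \<Rightarrow> 'v" where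
  "module_scale M \<M> c v = Linf_class M (\<lambda>_. c) \<odot>\<^bsub>\<M>\<^esub> v"

definition module_space ::
    "'x measure \<Rightarrow> real \<Rightarrow> ('x, 'v, 'z) normed_module_scheme \<Rightarrow> 'v normed_space" where
  "module_space M p \<M> =
     \<lparr>vecs = carrier \<M>, vadd = add \<M>, vscale = module_scale M \<M>, vnorm = module_norm M p \<M>\<rparr>"

text \<open>
  Since \<open>|v - w| > \<epsilon>\<close> is strict here while the modulus of a normed space uses \<open>\<ge>\<close>, only null
  sets \<open>A\<close> are admissible for \<open>\<epsilon> = 2\<close>, so that the pointwise modulus at \<open>2\<close> is always \<open>1\<close>.
  The modulus of a normed space at \<open>2\<close> is \<open>1\<close> exactly if the space is strictly convex.
\<close>

definition pointwise_modulus ::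
    "'x measure \<Rightarrow> ('x, 'v, 'z) normed_module_scheme \<Rightarrow> real \<Rightarrow> 'x \<Rightarrow> real" where
  "pointwise_modulus M \<M> \<epsilon> = ess_Inf M
     {\<lambda>x. 1 - indicator A x * pnorm \<M> (module_scale M \<M> (1/2) (v \<oplus>\<^bsub>\<M>\<^esub> w)) x | v w A.
        v \<in> carrier \<M> \<and> w \<in> carrier \<M> \<and> A \<in> sets M \<and>
        (AE x in M. x \<in> A \<longrightarrow>
           pnorm \<M> v x = 1 \<and> pnorm \<M> w x = 1 \<and> pnorm \<M> (v \<ominus>\<^bsub>\<M>\<^esub> w) x > \<epsilon>)}"


section \<open>Banach bundles and their sections\<close>

definition Banach_bundle :: "'x measure \<Rightarrow> ('x \<Rightarrow> 'b::banach set) \<Rightarrow> bool" where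
  "Banach_bundle M E \<longleftrightarrow>
     (\<forall>U. open U \<longrightarrow> {x \<in> space M. E x \<inter> U \<noteq> {}} \<in> sets M) \<and>
     (\<forall>x\<in>space M. closed (E x) \<and> subspace (E x))"

definition uniformly_convex_bundle :: "'x measure \<Rightarrow> ('x \<Rightarrow> 'b::banach set) \<Rightarrow> bool" where
  "uniformly_convex_bundle M E \<longleftrightarrow> (AE x in M. uniformly_convex (subspace_of (E x)))"

definition strongly_measurable :: "'x measure \<Rightarrow> ('x \<Rightarrow> 'b::banach) \<Rightarrow> bool" where
  "strongly_measurable M v \<longleftrightarrow>
     (\<forall>\<omega> :: 'b \<Rightarrow>\<^sub>L real. (\<lambda>x. blinfun_apply \<omega> (v x)) \<in> borel_measurable M) \<and>
     (\<exists>N\<in>null_sets M. separable_space (top_of_set (v ` (space M - N))))"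

definition sections :: "'x measure \<Rightarrow> ('x \<Rightarrow> 'b::banach set) \<Rightarrow> ('x \<Rightarrow> 'b) set" where
  "sections M E = {v. strongly_measurable M v \<and> (\<forall>x\<in>space M. v x \<in> E x)}"

definition Lp_sections :: "'x measure \<Rightarrow> ('x \<Rightarrow> 'b::banach set) \<Rightarrow> real \<Rightarrow> ('x \<Rightarrow> 'b) set" where
  "Lp_sections M E p = {v \<in> sections M E. (\<lambda>x. norm (v x)) \<in> Lp_fun M p}"

abbreviation Gamma_class ::
    "'x measure \<Rightarrow> ('x \<Rightarrow> 'b::banach set) \<Rightarrow> real \<Rightarrow> ('x \<Rightarrow> 'b) \<Rightarrow> ('x \<Rightarrow> 'b) set" where
  "Gamma_class M E p v \<equiv> ae_rel M (Lp_sections M E p) `` {v}"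

text \<open>The fields \<open>mult\<close> and \<open>one\<close> of a module record are never used.\<close>

definition Gamma_module ::
    "'x measure \<Rightarrow> ('x \<Rightarrow> 'b::banach set) \<Rightarrow> real \<Rightarrow> ('x, ('x \<Rightarrow> 'b) set) normed_module" where
  "Gamma_module M E p =
     \<lparr>carrier = Lp_sections M E p // ae_rel M (Lp_sections M E p),
      mult = undefined,
      one = undefined,
      zero = Gamma_class M E p (\<lambda>_. 0),
      add = (\<lambda>V W. \<Union>v\<in>V. \<Union>w\<in>W. Gamma_class M E p (\<lambda>x. v x + w x)),
      smult = (\<lambda>F V. \<Union>f\<in>F. \<Union>v\<in>V. Gamma_class M E p (\<lambda>x. f x *\<^sub>R v x)),
      pnorm = (\<lambda>V x. norm ((SOME v. v \<in> V) x))\<rparr>"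


section \<open>The functions relating pointwise and global moduli\<close>

definition convexity_gauge :: "(real \<Rightarrow> real \<Rightarrow> real) \<Rightarrow> bool" where
  "convexity_gauge \<phi> \<longleftrightarrow>
     (\<forall>\<epsilon>\<in>{0<..2}. \<forall>t\<in>{0<..1}. \<phi> \<epsilon> t \<in> {0<..1}) \<and>
     continuous_on ({0<..2} \<times> {0<..1}) (\<lambda>(\<epsilon>, t). \<phi> \<epsilon> t) \<and>
     (\<forall>t\<in>{0<..1}. mono_on {0<..2} (\<lambda>\<epsilon>. \<phi> \<epsilon> t)) \<and>
     (\<forall>\<epsilon>\<in>{0<..2}. mono_on {0<..1} (\<phi> \<epsilon>))"

definition zero_ext :: "(real \<Rightarrow> real \<Rightarrow> real) \<Rightarrow> real \<Rightarrow> real \<Rightarrow> real" where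
  "zero_ext \<phi> \<epsilon> t = (if t = 0 then 0 else \<phi> \<epsilon> t)"

end

theory Submission
  imports Defs
begin

text \<open>
  The comparison of the fibres with the space of sections rests on having enough measurable
  sections. In a separable space, weak and Borel measurability agree (Pettis, by way of
  Hahn-Banach), and the selection theorem of Kuratowski and Ryll-Nardzewski yields countably
  many sections that are dense in every fibre.

  Pointwise modulus. A pair of unit vectors at distance \<open>\<epsilon> < 2\<close> can be moved slightly so that
  the distance exceeds \<open>\<epsilon>\<close> (\<open>perturb_pair\<close>). Therefore the fibre modulus is an infimum over
  pairs that satisfy a strict inequality, and it can be computed from the dense sections
  alone; this shows at once that it is measurable and that it is the essential infimum in the
  definition of the pointwise modulus. At \<open>\<epsilon> = 2\<close> both sides equal 1 for strictly convex
  fibres.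

  Upper bound. Vectors in the fibres that violate the bound on the modulus of the space of
  sections are selected measurably, cut off and normalised; as sections they violate the bound
  themselves. For \<open>\<epsilon> = 2\<close> the distance has to be exactly 2, a closed condition on a fibre that
  need not be locally compact, and the set of base points where such vectors exist is obtained
  by a Suslin operation. It contains a measurable set of positive measure, with a measurable
  selection, unless it is null (\<open>suslin_selection\<close>).

  Uniform convexity. The upper bound gives one direction. The other one is Day's theorem: a
  uniform lower bound on the fibre moduli implies a pointwise inequality between the \<open>p\<close>-th
  powers of the norms of two vectors, their difference and their midpoint
  (\<open>midpoint_powr_defect\<close>), which is integrated.

  Gauge. The sections form a Banach module, so the hypothesis on \<open>\<phi>\<close> applies to them. Since
  \<open>\<phi>\<close> need not tend to 0 when its second argument does, it is applied over the sets where the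
  fibre modulus is bounded away from 0, and the resulting bound passes to the limit
  (\<open>modulus_\<Gamma>_exhaustion\<close>).
\<close>

section \<open>Moving a unit pair apart\<close>

text \<open>
  The function \<open>q\<close> is the norm on a plane, with \<open>q s t = \<parallel>s a + t b\<parallel>\<close> for the midpoint \<open>a\<close> and
  the half difference \<open>b\<close> of two unit vectors \<open>a + b\<close> and \<open>a - b\<close>. Being stated for
  coordinates, the lemma serves the fibres as well as the space of sections.

  If \<open>a\<close> is shrunk a little, both ends of the segment fall strictly inside the ball, because
  \<open>\<parallel>b\<parallel> < 1\<close>; prolonging the segment in the direction of \<open>b\<close> up to the sphere makes it longer.
  The new ends are near the old ones unless the sphere contains a segment from an old end in
  the direction of \<open>b\<close>, and in that case this end can be moved along the sphere. For \<open>\<parallel>b\<parallel> = 1\<close>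
  the conclusion fails, which is why the value 2 of the distance is exceptional.
\<close>

lemma perturb_pair:
  fixes q :: "real \<Rightarrow> real \<Rightarrow> real"
  assumes tri: "\<And>s t s' t'. q (s + s') (t + t') \<le> q s t + q s' t'"
    and hom: "\<And>c s t. q (c * s) (c * t) = \<bar>c\<bar> * q s t"
    and one: "q 1 1 = 1" "q 1 (-1) = 1"
    and gap: "0 < q 0 2" "q 0 2 < 2" and "0 < \<eta>"
  obtains s1 t1 s2 t2 where "q s1 t1 = 1" "q s2 t2 = 1" "q 0 2 < q (s1 - s2) (t1 - t2)"
    "q 1 0 - \<eta> \<le> q ((s1 + s2) / 2) ((t1 + t2) / 2)"
proof -
  note found = that
  have h1: "q s 0 = \<bar>s\<bar> * q 1 0" "q 0 s = \<bar>s\<bar> * q 0 1" for s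
    using hom[of s 1 0] hom[of s 0 1] by auto
  have nn: "0 \<le> q s t" for s t
    using tri[of s "-s" t "-t"] hom[of "-1" s t] hom[of 0 s t] by simp
  have minus: "q (-s) (-t) = q s t" for s t using hom[of "-1" s t] by simp
  have lip: "\<bar>q s t - q s' t'\<bar> \<le> \<bar>s - s'\<bar> * q 1 0 + \<bar>t - t'\<bar> * q 0 1" for s t s' t'
  proof -
    have "q s t \<le> q s' t' + (\<bar>s - s'\<bar> * q 1 0 + \<bar>t - t'\<bar> * q 0 1)" for s t s' t'
      using tri[of s' "s - s'" t' "t - t'"] tri[of "s - s'" 0 0 "t - t'"] h1[of "s-s'"] h1[of "t-t'"]
      by simp
    from this[of s t s' t'] this[of s' t' s t] show ?thesis by (simp add: abs_minus_commute)
  qed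
  have b1: "q 0 1 < 1" "0 < q 0 1" using h1[of 2] gap by auto
  have a1: "q 1 0 \<le> 1"
    using tri[of 1 1 1 "-1"] one h1[of 2] by simp
  \<comment> \<open>Beyond either end of a chord of the ball one is outside the open ball.\<close>
  have outer: "1 \<le> q 1 \<tau>" if "1 < \<bar>\<tau>\<bar>" for \<tau>
  proof -
    define l where "l = 2 / (1 + \<bar>\<tau>\<bar>)"
    have l: "0 < l" "l < 1" using that by (auto simp: l_def)
    have "1 + \<bar>\<tau>\<bar> \<noteq> 0" using that by linarith
    then have "l * (1 + \<bar>\<tau>\<bar>) = 2" unfolding l_def
      by (metis nonzero_eq_divide_eq)
    then have e: "l * \<bar>\<tau>\<bar> + (1 - l) * (-1) = 1" by (simp add: algebra_simps)
    have "q 1 (sgn \<tau>) \<le> q (l * 1) (l * \<tau>) + q ((1 - l) * 1) ((1 - l) * (- sgn \<tau>))"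
    proof -
      have "l * \<tau> + (1 - l) * (- sgn \<tau>) = sgn \<tau>"
      proof -
        have "\<tau> = sgn \<tau> * \<bar>\<tau>\<bar>" by (simp add: sgn_mult_abs)
        then have "l * \<tau> + (1 - l) * (- sgn \<tau>) = sgn \<tau> * (l * \<bar>\<tau>\<bar> + (1 - l) * (-1))"
          by (metis (no_types, opaque_lifting) distrib_left mult.left_commute mult_minus1_right mult_minus_right)
        then show ?thesis using e by simp
      qed
      then show ?thesis using tri[of "l * 1" "(1 - l) * 1" "l * \<tau>" "(1 - l) * (- sgn \<tau>)"] by simp
    qed
    then have "q 1 (sgn \<tau>) \<le> l * q 1 \<tau> + (1 - l) * q 1 (- sgn \<tau>)"
      using l unfolding hom by simp
    moreover have "q 1 (sgn \<tau>) = 1" "q 1 (- sgn \<tau>) = 1" using one that by (auto simp: sgn_if)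
    ultimately have "l * 1 \<le> l * q 1 \<tau>" by simp
    then show ?thesis using l by (simp add: mult_le_cancel_left_pos)
  qed
  define h where "h = \<eta> / 2"
  have h: "0 < h" using assms by (simp add: h_def)
  define \<tau> where "\<tau> = 1 + h"
  have \<tau>: "1 < \<tau>" using h by (simp add: \<tau>_def)
  have d: "q 0 2 < q 0 (t + t')" if "1 \<le> t" "1 < t'" for t t'
  proof -
    have "2 * q 0 1 < (t + t') * q 0 1" using b1 that by (intro mult_strict_right_mono) auto
    then show ?thesis using h1(2)[of "t+t'"] h1(2)[of 2] that by simp
  qed
  \<comment> \<open>The sphere is flat at the end \<open>(1, \<sigma>)\<close>; the other end stays in place.\<close>
  have flat: thesis if \<open>\<bar>\<sigma>\<bar> = 1\<close> "q 1 (\<sigma> * \<tau>) = 1" for \<sigma>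
  proof -
    have a: "q 1 (- \<sigma>) = 1" using one that by (auto simp: abs_if split: if_splits)
    have "q 0 (\<sigma> * \<tau> + \<sigma>) = q 0 (\<tau> + 1)"
      using h1(2)[of "\<sigma> * \<tau> + \<sigma>"] h1(2)[of "\<tau> + 1"] that \<tau>
      by (auto simp: abs_if split: if_splits)
    then have c: "q 0 2 < q 0 (\<sigma> * \<tau> + \<sigma>)" using d[of 1 \<tau>] \<tau> by (simp add: add.commute)
    have "\<bar>q 1 0 - q 1 ((\<sigma> * \<tau> - \<sigma>) / 2)\<bar> \<le> \<bar>(\<sigma> * \<tau> - \<sigma>) / 2\<bar> * q 0 1" using lip[of 1 0 1 "(\<sigma> * \<tau> - \<sigma>) / 2"] by simp
    also have "\<bar>(\<sigma> * \<tau> - \<sigma>) / 2\<bar> = h / 2" using that h by (auto simp: \<tau>_def abs_if algebra_simps split: if_splits)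
    also have "h / 2 * q 0 1 \<le> h / 2 * 1" using b1 h by (intro mult_left_mono) auto
    finally have "q 1 0 - \<eta> \<le> q 1 ((\<sigma> * \<tau> - \<sigma>) / 2)"
      using \<open>0 < \<eta>\<close> unfolding h_def by linarith
    then show thesis using that(2) a c by (intro found[of 1 "\<sigma> * \<tau>" 1 "- \<sigma>"]) auto
  qed
  show thesis
  proof (cases "q 1 \<tau> = 1 \<or> q 1 (- \<tau>) = 1")
    case True
    then show thesis using flat[of 1] flat[of "-1"] by auto
  next
    case False
    then have big: "1 < q 1 \<tau>" "1 < q 1 (- \<tau>)" using outer[of \<tau>] outer[of "- \<tau>"] \<tau> by auto
    \<comment> \<open>Shrinking \<open>a\<close> by the factor \<open>1 - r\<close> keeps the points with parameter \<open>\<tau>\<close> outside the ball.\<close>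
    define r where "r = min (min h 1) (min ((q 1 \<tau> - 1) / 2) ((q 1 (- \<tau>) - 1) / 2))"
    have r: "0 < r" "r \<le> h" "r \<le> 1" "r < q 1 \<tau> - 1" "r < q 1 (- \<tau>) - 1"
    proof -
      have "r \<le> (q 1 \<tau> - 1) / 2" "r \<le> (q 1 (- \<tau>) - 1) / 2" unfolding r_def by linarith+
      then show "r < q 1 \<tau> - 1" "r < q 1 (- \<tau>) - 1" using big by auto
    qed (use h big in \<open>auto simp: r_def\<close>)
    have ra: "r * q 1 0 \<le> r" using a1 r by (simp add: mult_le_cancel_left2)
    have ex: "\<exists>t>1. t \<le> \<tau> \<and> q (1 - r) (\<sigma> * t) = 1" if \<sigma>: "\<bar>\<sigma>\<bar> = 1" for \<sigma>
    proof -
      have "q (1 - r) (\<sigma> * 1) \<le> (1 - r) * q 1 \<sigma> + r * q 0 1"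
        using tri[of "1-r" 0 "(1-r) * \<sigma>" "r * \<sigma>"] hom[of "1-r" 1 \<sigma>] h1(2)[of "r * \<sigma>"] r \<sigma>
        by (simp add: algebra_simps abs_mult)
      moreover have "q 1 \<sigma> = 1" using one \<sigma> by (auto simp: abs_if split: if_splits)
      moreover have "r * q 0 1 < r * 1" using b1 r by (intro mult_strict_left_mono) auto
      ultimately have lt: "q (1 - r) (\<sigma> * 1) < 1" by simp
      have "\<bar>q 1 (\<sigma> * \<tau>) - q (1 - r) (\<sigma> * \<tau>)\<bar> \<le> r"
        using lip[of 1 "\<sigma> * \<tau>" "1 - r" "\<sigma> * \<tau>"] ra r
        by (auto intro: order_trans)
      moreover have "r < q 1 (\<sigma> * \<tau>) - 1" using \<sigma> r by (auto simp: abs_if split: if_splits)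
      ultimately have gt: "1 \<le> q (1 - r) (\<sigma> * \<tau>)" by linarith
      have "continuous_on {1..\<tau>} (\<lambda>t. q (1 - r) (\<sigma> * t))"
      proof (rule continuous_onI)
        fix x e :: real assume "e > 0"
        have "dist (q (1 - r) (\<sigma> * x')) (q (1 - r) (\<sigma> * x)) \<le> e" if "dist x' x < e" for x'
        proof -
          have "\<bar>\<sigma> * x' - \<sigma> * x\<bar> * q 0 1 \<le> \<bar>x' - x\<bar> * 1"
            using \<sigma> b1 by (intro mult_mono) (auto simp: abs_mult simp flip: right_diff_distrib)
          then show ?thesis
            using lip[of "1-r" "\<sigma> * x'" "1-r" "\<sigma> * x"] that by (simp add: dist_real_def)
        qed
        then show "\<exists>d>0. \<forall>x'\<in>{1..\<tau>}. dist x' x < d \<longrightarrow> dist (q (1 - r) (\<sigma> * x')) (q (1 - r) (\<sigma> * x)) \<le> e"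
          using \<open>e > 0\<close> by blast
      qed
      then obtain t where t: "1 \<le> t" "t \<le> \<tau>" "q (1 - r) (\<sigma> * t) = 1"
        using IVT'[of "\<lambda>t. q (1 - r) (\<sigma> * t)" 1 1 \<tau>] lt gt \<tau> by auto
      moreover have "t \<noteq> 1" using t lt by auto
      ultimately show ?thesis by (intro exI[of _ t]) auto
    qed
    obtain t where t: "1 < t" "t \<le> \<tau>" "q (1 - r) t = 1" using ex[of 1] by auto
    obtain t' where t': "1 < t'" "t' \<le> \<tau>" "q (1 - r) (- t') = 1" using ex[of "-1"] by auto
    have mid: "\<bar>(t - t') / 2\<bar> \<le> \<eta> / 2"
      using t(1,2) t'(1,2) unfolding \<tau>_def h_def abs_le_iff by (simp add: field_simps)
    have "\<bar>q 1 0 - q (1 - r) ((t - t') / 2)\<bar> \<le> r * q 1 0 + \<bar>(t - t') / 2\<bar> * q 0 1"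
      using lip[of 1 0 "1 - r" "(t - t')/2"] r by simp
    also have "\<dots> \<le> r + \<bar>(t - t') / 2\<bar> * 1"
      using ra b1 by (intro add_mono mult_left_mono) auto
    also have "\<dots> \<le> \<eta>" using mid r(2) unfolding h_def by linarith
    finally have "q 1 0 - \<eta> \<le> q (1 - r) ((t - t') / 2)" by simp
    then show thesis using t t' d[of t t'] by (intro that[of "1-r" t "1-r" "-t'"]) (simp_all add: diff_divide_distrib)
  qed
qed

section \<open>Convexity of powers\<close>

text \<open>
  At the endpoint 0 the claim reduces to \<open>l powr p \<le> l\<close>.
\<close>

lemma powr_convex_combination:
  fixes a b l p :: real
  assumes "1 \<le> p" "0 \<le> a" "0 \<le> b" "0 \<le> l" "l \<le> 1"
  shows "(l * a + (1 - l) * b) powr p \<le> l * a powr p + (1 - l) * b powr p"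
proof -
  have zero: "(l * a) powr p \<le> l * a powr p" if "0 \<le> a" "0 \<le> l" "l \<le> 1" for a l :: real
  proof -
    have "l powr p \<le> l" using powr_mono'[of 1 p l] that assms by simp
    then show ?thesis using that by (simp add: powr_mult mult_right_mono)
  qed
  show ?thesis
  proof (cases "0 < a \<and> 0 < b")
    case True
    then show ?thesis using convex_onD[OF powr_convex[OF assms(1)], of "1 - l" a b] assms by simp
  next
    case False
    then show ?thesis using zero[of a l] zero[of b "1 - l"] assms by auto
  qed
qed

lemma powr_midpoint_le:
  fixes a b p :: real
  assumes "1 \<le> p" "0 \<le> a" "0 \<le> b"
  shows "((a + b) / 2) powr p \<le> (a powr p + b powr p) / 2"
  using powr_convex_combination[of p a b "1/2"] assms by (simp add: field_simps)

lemma powr_midpoint_less: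
  fixes t p :: real
  assumes "1 < p" "0 \<le> t" "t < 1"
  shows "((1 + t) / 2) powr p < (1 + t powr p) / 2"
proof -
  define f where "f x = (1 + x powr p) / 2 - ((1 + x) / 2) powr p" for x :: real
  have "f 1 < f t"
  proof (rule DERIV_neg_imp_decreasing_open[OF assms(3)])
    fix x :: real assume x: "t < x" "x < 1"
    then have "0 < x" using assms by simp
    have "(f has_real_derivative (p * x powr (p - 1)) / 2 - p * ((1 + x) / 2) powr (p - 1) * (1/2)) (at x)"
      unfolding f_def using \<open>0 < x\<close>
      by (auto intro!: derivative_eq_intros simp: powr_diff divide_simps) (simp add: algebra_simps)?
    moreover have "x powr (p - 1) < ((1 + x) / 2) powr (p - 1)"
      using x \<open>0 < x\<close> assms by (intro powr_less_mono2) auto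
    ultimately show "\<exists>y. (f has_real_derivative y) (at x) \<and> y < 0"
      using assms by (intro exI conjI) (assumption, simp)
  next
    show "continuous_on {t..1} f" unfolding f_def using assms
      by (intro continuous_on_diff continuous_on_divide continuous_on_add continuous_on_powr'
          continuous_on_const continuous_on_id) auto
  qed
  then show ?thesis by (simp add: f_def)
qed

lemma powr_midpoint_eq:
  fixes a b p :: real
  assumes "1 < p" "0 \<le> a" "0 \<le> b" "((a + b) / 2) powr p = (a powr p + b powr p) / 2"
  shows "a = b"
proof -
  have "\<not> b < a" if "0 \<le> b" "((a + b) / 2) powr p = (a powr p + b powr p) / 2" for a b :: real
  proof
    assume "b < a"
    then have a: "0 < a" using that by simp
    have "((1 + b / a) / 2) powr p < (1 + (b / a) powr p) / 2"
      using a that \<open>b < a\<close> assms by (intro powr_midpoint_less) auto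
    then have "a powr p * ((1 + b / a) / 2) powr p < a powr p * ((1 + (b / a) powr p) / 2)"
      using a by simp
    moreover have "a powr p * ((1 + b / a) / 2) powr p = ((a + b) / 2) powr p"
    proof -
      have "(a + b) / 2 = a * ((1 + b / a) / 2)" using a by (simp add: field_simps)
      then show ?thesis using a that by (simp add: powr_mult del: times_divide_eq_right)
    qed
    moreover have "a powr p * ((1 + (b / a) powr p) / 2) = (a powr p + b powr p) / 2"
      using a that by (simp add: powr_divide field_simps)
    ultimately show False using that by simp
  qed
  from this[of b a] this[of a b] assms show ?thesis by (simp add: add.commute)
qed

text \<open>
  On the compact interval \<open>[0, 1 - \<sigma>]\<close> the strict convexity of the power is uniform.
\<close>

lemma powr_midpoint_gap:
  fixes p \<sigma> :: real
  assumes "1 < p" "0 < \<sigma>" "\<sigma> \<le> 1"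
  obtains \<theta> where "0 < \<theta>" "\<And>t. \<lbrakk>0 \<le> t; t \<le> 1 - \<sigma>\<rbrakk> \<Longrightarrow> ((1 + t) / 2) powr p \<le> (1 - \<theta>) * ((1 + t powr p) / 2)"
proof -
  define f where "f t = 1 - ((1 + t) / 2) powr p / ((1 + t powr p) / 2)" for t :: real
  have pos: "0 < 1 + t powr p" for t :: real by (simp add: add_pos_nonneg)
  have "continuous_on {0..1-\<sigma>} f" unfolding f_def using assms pos
    by (intro continuous_on_diff continuous_on_divide continuous_on_add continuous_on_powr'
          continuous_on_const continuous_on_id) (auto simp: add_nonneg_eq_0_iff)
  then obtain s where s: "s \<in> {0..1-\<sigma>}" "\<And>t. t \<in> {0..1-\<sigma>} \<Longrightarrow> f s \<le> f t"
    using continuous_attains_inf[of "{0..1-\<sigma>}" f] assms by auto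
  have "0 < f s" unfolding f_def using powr_midpoint_less[of p s] s assms pos[of s]
    by (simp add: field_simps)
  moreover have "((1 + t) / 2) powr p \<le> (1 - f s) * ((1 + t powr p) / 2)" if "0 \<le> t" "t \<le> 1 - \<sigma>" for t
  proof -
    have "1 - f s \<ge> ((1 + t) / 2) powr p / ((1 + t powr p) / 2)" using s(2)[of t] that by (simp add: f_def)
    then show ?thesis using pos[of t] by (simp add: field_simps)
  qed
  ultimately show thesis by (rule that)
qed

section \<open>The Hahn-Banach theorem\<close>

text \<open>
  The Hahn-Banach theorem is needed in one form only: every vector is normed by a functional
  of norm at most one. Linear functionals are found as minimal sublinear ones, which avoids
  extending partially defined functionals.
\<close>

definition sublinear :: "('a::real_vector \<Rightarrow> real) \<Rightarrow> bool" where
  "sublinear p \<longleftrightarrow> (\<forall>x y. p (x + y) \<le> p x + p y) \<and> (\<forall>c x. 0 \<le> c \<longrightarrow> p (c *\<^sub>R x) = c * p x)"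

lemma sublinearD:
  assumes "sublinear p"
  shows "p (x + y) \<le> p x + p y" "0 \<le> c \<Longrightarrow> p (c *\<^sub>R x) = c * p x" "p 0 = 0" "- p (- x) \<le> p x"
proof -
  show a: "p (x + y) \<le> p x + p y" for x y using assms by (simp add: sublinear_def)
  show b: "0 \<le> c \<Longrightarrow> p (c *\<^sub>R x) = c * p x" for c x using assms by (simp add: sublinear_def)
  show "p 0 = 0" using b[of 0 0] by simp
  then show "- p (- x) \<le> p x" using a[of x "- x"] by simp
qed

text \<open>
  Lowering a sublinear \<open>p\<close> in the direction \<open>y\<close>: the result \<open>P y\<close> is at most \<open>p\<close> (take
  \<open>t = 0\<close>) and at most \<open>- p y\<close> at \<open>- y\<close> (take \<open>t = 1\<close>), as a linear function below \<open>p\<close> with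
  the value \<open>p y\<close> at \<open>y\<close> has to be.
\<close>

lemma sublinear_tilt:
  fixes p :: "'a::real_vector \<Rightarrow> real"
  assumes "sublinear p"
  defines "P \<equiv> \<lambda>y x. INF t\<in>{0..}. p (x + t *\<^sub>R y) - t * p y"
  shows "sublinear (P y)" "\<And>t. 0 \<le> t \<Longrightarrow> P y x \<le> p (x + t *\<^sub>R y) - t * p y"
proof -
  note p = sublinearD[OF assms(1)]
  have low: "- p (- x) \<le> p (x + t *\<^sub>R y) - t * p y" if "0 \<le> t" for t x
    using p(1)[of "x + t *\<^sub>R y" "- x"] p(2)[of t y] that by simp
  then have bdd: "bdd_below ((\<lambda>t. p (x + t *\<^sub>R y) - t * p y) ` {0..})" for x
    by (intro bdd_belowI2[of _ "- p (- x)"]) auto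
  show le: "P y x \<le> p (x + t *\<^sub>R y) - t * p y" if "0 \<le> t" for t x
    unfolding P_def using bdd that by (intro cINF_lower) auto
  have ge: "c \<le> P y x" if "\<And>t. 0 \<le> t \<Longrightarrow> c \<le> p (x + t *\<^sub>R y) - t * p y" for c x
    unfolding P_def using that by (intro cINF_greatest) auto
  have half: "c * P y x \<le> P y (c *\<^sub>R x)" if "0 < c" for c x
  proof (rule ge)
    fix t :: real assume "0 \<le> t"
    then have "c * P y x \<le> c * (p (x + (t / c) *\<^sub>R y) - t / c * p y)" using le[of "t / c" x] that by simp
    also have "\<dots> = p (c *\<^sub>R (x + (t / c) *\<^sub>R y)) - t * p y"
      using that p(2)[of c "x + (t / c) *\<^sub>R y"] by (simp add: right_diff_distrib)
    also have "c *\<^sub>R (x + (t / c) *\<^sub>R y) = c *\<^sub>R x + t *\<^sub>R y" using that by (simp add: scaleR_right_distrib)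
    finally show "c * P y x \<le> p (c *\<^sub>R x + t *\<^sub>R y) - t * p y" .
  qed
  have "P y (c *\<^sub>R x) = c * P y x" if "0 \<le> c" for c x
  proof (cases "c = 0")
    case True
    have "P y 0 = 0" using le[of 0 0] ge[of 0 0] p(2)[of _ y] p(3) by force
    then show ?thesis using True by simp
  next
    case False
    then have c: "0 < c" using that by simp
    have "inverse c * P y (c *\<^sub>R x) \<le> P y x" using half[of "inverse c" "c *\<^sub>R x"] c by simp
    then have "P y (c *\<^sub>R x) \<le> c * P y x" using c by (simp add: field_simps)
    then show ?thesis using half[OF c, of x] by simp
  qed
  moreover have "P y (x + z) \<le> P y x + P y z" for x z
  proof -
    have "P y (x + z) - P y z \<le> P y x"
    proof (rule ge)
      fix t :: real assume t: "0 \<le> t"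
      have "P y (x + z) - (p (x + t *\<^sub>R y) - t * p y) \<le> P y z"
      proof (rule ge)
        fix s :: real assume s: "0 \<le> s"
        have "P y (x + z) \<le> p (x + z + (t + s) *\<^sub>R y) - (t + s) * p y" using le s t by simp
        also have "x + z + (t + s) *\<^sub>R y = (x + t *\<^sub>R y) + (z + s *\<^sub>R y)" by (simp add: algebra_simps)
        also have "p \<dots> \<le> p (x + t *\<^sub>R y) + p (z + s *\<^sub>R y)" by (rule p(1))
        finally show "P y (x + z) - (p (x + t *\<^sub>R y) - t * p y) \<le> p (z + s *\<^sub>R y) - s * p y"
          by (simp add: algebra_simps)
      qed
      then show "P y (x + z) - P y z \<le> p (x + t *\<^sub>R y) - t * p y" by simp
    qed
    then show ?thesis by simp
  qed
  ultimately show "sublinear (P y)" by (simp add: sublinear_def)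
qed

text \<open>
  A minimal \<open>p\<close> is not changed by lowering it in any direction \<open>y\<close>, and this says that
  \<open>p x \<le> p (x + y) - p y\<close>, the missing half of additivity.
\<close>

lemma minimal_sublinear_is_linear:
  fixes p :: "'a::real_vector \<Rightarrow> real"
  assumes "sublinear p" and min: "\<And>q. \<lbrakk>sublinear q; q \<le> p\<rbrakk> \<Longrightarrow> q = p"
  shows "linear p"
proof -
  have super: "p x + p y \<le> p (x + y)" for x y
  proof -
    define q where "q = (\<lambda>x. INF t\<in>{0..}. p (x + t *\<^sub>R y) - t * p y)"
    have "sublinear q" and tilt: "\<And>t x. 0 \<le> t \<Longrightarrow> q x \<le> p (x + t *\<^sub>R y) - t * p y"
      using sublinear_tilt[OF assms(1)] by (auto simp: q_def)
    moreover from tilt[of 0] have "q \<le> p" by (simp add: le_fun_def)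
    ultimately have "q = p" using min by blast
    then have "p x \<le> p (x + 1 *\<^sub>R y) - 1 * p y" using tilt[of 1 x] by simp
    then show ?thesis by simp
  qed
  have add: "p (x + y) = p x + p y" for x y using super[of x y] sublinearD(1)[OF assms(1), of x y] by simp
  have "p (- x) = - p x" for x using add[of x "- x"] sublinearD(3)[OF assms(1)] by simp
  then have "p (c *\<^sub>R x) = c *\<^sub>R p x" for c x
    using sublinearD(2)[OF assms(1), of c x] sublinearD(2)[OF assms(1), of "- c" x] by (cases "0 \<le> c") auto
  then show ?thesis using add by (intro linearI) auto
qed

text \<open>
  Zorn's lemma: the pointwise infimum of a chain of sublinear functions below \<open>p\<close> is finite,
  as it is at least \<open>- p (- x)\<close>, and it is subadditive because any two members of the chain
  have a common lower bound in it.
\<close>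

lemma linear_below_sublinear:
  fixes p :: "'a::real_vector \<Rightarrow> real"
  assumes "sublinear p"
  obtains f where "linear f" "f \<le> p"
proof -
  define A where "A = {q. sublinear q \<and> q \<le> p}"
  have "\<exists>m\<in>A. \<forall>a\<in>A. m \<ge> a \<longrightarrow> a = m"
  proof (rule predicate_Zorn)
    show "partial_order_on A (relation_of (\<lambda>m a. m \<ge> a) A)"
      by (intro partial_order_on_relation_ofI) auto
    fix C assume C: "C \<in> Chains (relation_of (\<lambda>m a. m \<ge> a) A)"
    have CA: "C \<subseteq> A" using C by (auto simp: Chains_def relation_of_def)
    have tot: "a \<le> b \<or> b \<le> a" if "a \<in> C" "b \<in> C" for a b
      using C that by (auto simp: Chains_def relation_of_def)
    show "\<exists>u\<in>A. \<forall>a\<in>C. a \<ge> u"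
    proof (cases "C = {}")
      case True
      then show ?thesis using assms by (auto simp: A_def)
    next
      case False
      define u where "u = (\<lambda>x. INF q\<in>C. q x)"
      have low: "- p (- x) \<le> q x" if "q \<in> C" for q x
      proof -
        have q: "sublinear q" "q (- x) \<le> p (- x)" using that CA by (auto simp: A_def le_fun_def)
        show ?thesis using sublinearD(4)[OF q(1), of x] q(2) by simp
      qed
      have le: "u x \<le> q x" if "q \<in> C" for q x
        unfolding u_def using that low by (intro cINF_lower bdd_belowI2) auto
      have ge: "c \<le> u x" if "\<And>q. q \<in> C \<Longrightarrow> c \<le> q x" for c x
        unfolding u_def using that False by (intro cINF_greatest) auto
      have "u (x + y) \<le> u x + u y" for x y
      proof -
        have "u (x + y) - u y \<le> u x"
        proof (rule ge)
          fix q assume q: "q \<in> C"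
          have "u (x + y) - q x \<le> u y"
          proof (rule ge)
            fix r assume r: "r \<in> C"
            obtain s where s: "s \<in> C" "s \<le> q" "s \<le> r" using tot[OF q r] q r by blast
            have "u (x + y) \<le> s (x + y)" using le s by simp
            also have "\<dots> \<le> s x + s y" using s CA by (intro sublinearD(1)) (auto simp: A_def)
            also have "\<dots> \<le> q x + r y" using s by (intro add_mono) (auto simp: le_fun_def)
            finally show "u (x + y) - q x \<le> r y" by simp
          qed
          then show "u (x + y) - u y \<le> q x" by simp
        qed
        then show ?thesis by simp
      qed
      moreover have "u (c *\<^sub>R x) = c * u x" if "0 \<le> c" for c x
      proof -
        have "u (c *\<^sub>R x) = (INF q\<in>C. c * q x)"
          unfolding u_def using CA that by (intro INF_cong refl sublinearD(2)) (auto simp: A_def)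
        also have "\<dots> = c * u x"
        proof -
          have "c * (INF q\<in>C. q x) = (INF z\<in>(\<lambda>q. q x) ` C. c * z)"
            using that low False
            by (intro continuous_at_Inf_mono monoI bdd_belowI2[of _ "- p (- x)"])
               (auto intro!: mult_left_mono continuous_intros)
          then show ?thesis by (simp add: u_def image_image)
        qed
        finally show ?thesis .
      qed
      ultimately have "sublinear u" by (simp add: sublinear_def)
      moreover obtain q where "q \<in> C" using False by blast
      then have "u \<le> q" "q \<le> p" using le CA by (auto simp: le_fun_def A_def)
      then have "u \<le> p" by (rule order_trans)
      ultimately show ?thesis using le by (auto simp: A_def le_fun_def)
    qed
  qed
  then obtain m where m: "m \<in> A" "\<And>a. \<lbrakk>a \<in> A; a \<le> m\<rbrakk> \<Longrightarrow> a = m" by auto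
  have "linear m" using m by (intro minimal_sublinear_is_linear) (auto simp: A_def)
  then show thesis using m that by (auto simp: A_def)
qed

lemma norming_functional:
  fixes b :: "'a::real_normed_vector"
  obtains \<omega> :: "'a \<Rightarrow>\<^sub>L real" where "\<And>x. \<bar>blinfun_apply \<omega> x\<bar> \<le> norm x" "blinfun_apply \<omega> b = norm b"
proof -
  have sub: "sublinear (norm :: 'a \<Rightarrow> real)" by (auto simp: sublinear_def norm_triangle_ineq)
  define q where "q = (\<lambda>x. INF t\<in>{0..}. norm (x + t *\<^sub>R b) - t * norm b)"
  have q: "sublinear q" "\<And>t x. 0 \<le> t \<Longrightarrow> q x \<le> norm (x + t *\<^sub>R b) - t * norm b"
    using sublinear_tilt[OF sub] by (auto simp: q_def)
  obtain f where f: "linear f" "f \<le> q" using linear_below_sublinear[OF q(1)] by blast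
  have le: "f x \<le> norm x" for x using le_funD[OF f(2), of x] q(2)[of 0 x] by simp
  have neg: "f (- x) = - f x" for x using linear_neg[OF f(1)] by simp
  have abs: "\<bar>f x\<bar> \<le> norm x" for x using le[of x] le[of "- x"] neg by simp
  have "bounded_linear f"
    using f(1) abs by (intro bounded_linear_intro[of f 1]) (auto simp: linear_add linear_scale)
  then have ap: "blinfun_apply (Blinfun f) = f" by (rule bounded_linear_Blinfun_apply)
  have "f (- b) \<le> - norm b" using le_funD[OF f(2), of "- b"] q(2)[of 1 "- b"] by simp
  then have "f b = norm b" using neg le[of b] by simp
  then show thesis using abs ap by (intro that[of "Blinfun f"]) auto
qed

section \<open>Pettis' measurability theorem\<close>

lemma dense_sequence:
  obtains d :: "nat \<Rightarrow> 'a::second_countable_topology"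
  where "\<And>X. \<lbrakk>open X; X \<noteq> {}\<rbrakk> \<Longrightarrow> \<exists>n. d n \<in> X"
proof -
  obtain D :: "'a set" where D: "countable D" "\<And>X. open X \<Longrightarrow> X \<noteq> {} \<Longrightarrow> \<exists>d\<in>D. d \<in> X"
    using countable_dense_setE by metis
  then have "D \<noteq> {}" by (metis UNIV_not_empty empty_iff open_UNIV)
  show thesis
    by (rule that[of "from_nat_into D"]) (metis D from_nat_into_surj)
qed

text \<open>
  Functionals that norm the points of a dense sequence already determine the norm everywhere.
\<close>

lemma obtain_norming_sequence:
  obtains \<omega> :: "nat \<Rightarrow> 'b::{real_normed_vector, second_countable_topology} \<Rightarrow>\<^sub>L real"
  where "\<And>b r. norm b \<le> r \<longleftrightarrow> (\<forall>n. blinfun_apply (\<omega> n) b \<le> r)"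
proof -
  obtain d :: "nat \<Rightarrow> 'b" where d: "\<And>X. \<lbrakk>open X; X \<noteq> {}\<rbrakk> \<Longrightarrow> \<exists>n. d n \<in> X"
    using dense_sequence by blast
  have "\<exists>\<omega> :: 'b \<Rightarrow>\<^sub>L real. (\<forall>x. \<bar>blinfun_apply \<omega> x\<bar> \<le> norm x) \<and> blinfun_apply \<omega> (d n) = norm (d n)" for n
    using norming_functional[of "d n"] by metis
  then obtain \<omega> :: "nat \<Rightarrow> 'b \<Rightarrow>\<^sub>L real"
    where \<omega>: "\<And>n x. \<bar>blinfun_apply (\<omega> n) x\<bar> \<le> norm x" "\<And>n. blinfun_apply (\<omega> n) (d n) = norm (d n)"
    by metis
  have "norm b \<le> r" if r: "\<And>n. blinfun_apply (\<omega> n) b \<le> r" for b r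
  proof (rule field_le_epsilon)
    fix e :: real assume "0 < e"
    then obtain n where "d n \<in> ball b (e / 2)" using d[of "ball b (e/2)"] by auto
    then have n: "norm (d n - b) < e / 2" by (simp add: dist_norm norm_minus_commute)
    have "norm b \<le> norm (d n) + norm (d n - b)" by (metis norm_minus_commute norm_triangle_sub)
    also have "norm (d n) = blinfun_apply (\<omega> n) (d n - b) + blinfun_apply (\<omega> n) b"
      using \<omega>(2)[of n] by (simp add: blinfun.diff_right)
    also have "\<dots> \<le> norm (d n - b) + r" using \<omega>(1)[of n "d n - b"] r[of n] by (intro add_mono) auto
    finally show "norm b \<le> r + e" using n by simp
  qed
  moreover have "blinfun_apply (\<omega> n) b \<le> r" if "norm b \<le> r" for n b r using \<omega>(1)[of n b] that by simp
  ultimately show thesis by (intro that[of \<omega>]) blast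
qed

text \<open>
  Pettis' theorem in a separable space: the preimage of a closed ball is cut out by countably
  many functionals, and open sets are countable unions of balls. It turns sections into Borel
  maps, so that sums and norms of sections are measurable.
\<close>

lemma borel_measurable_if_weakly_measurable:
  fixes v :: "'x \<Rightarrow> 'b::{real_normed_vector, second_countable_topology}"
  assumes w: "\<And>\<omega> :: 'b \<Rightarrow>\<^sub>L real. (\<lambda>x. blinfun_apply \<omega> (v x)) \<in> borel_measurable M"
  shows "v \<in> borel_measurable M"
proof -
  obtain \<omega> :: "nat \<Rightarrow> 'b \<Rightarrow>\<^sub>L real"
    where \<omega>: "\<And>b r. norm b \<le> r \<longleftrightarrow> (\<forall>n. blinfun_apply (\<omega> n) b \<le> r)"
    using obtain_norming_sequence by blast
  have cball: "v -` cball b r \<inter> space M \<in> sets M" for b r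
  proof -
    have "v -` cball b r \<inter> space M
        = {x \<in> space M. \<forall>n. blinfun_apply (\<omega> n) (v x) - blinfun_apply (\<omega> n) b \<le> r}"
      using \<omega>[of "v _ - b" r] by (auto simp: dist_norm norm_minus_commute blinfun.diff_right)
    also have "\<dots> \<in> sets M" using w by measurable
    finally show ?thesis .
  qed
  show ?thesis
  proof (rule borel_measurableI)
    fix S :: "'b set" assume S: "open S"
    have "\<Union>((\<lambda>b. ball b (SOME r. r > 0 \<and> cball b r \<subseteq> S)) ` S) = S"
    proof -
      have "ball b (SOME r. r > 0 \<and> cball b r \<subseteq> S) \<subseteq> S \<and> b \<in> ball b (SOME r. r > 0 \<and> cball b r \<subseteq> S)" if "b \<in> S" for b
      proof -
        have "\<exists>r. r > 0 \<and> cball b r \<subseteq> S" using S that open_contains_cball by blast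
        from someI_ex[OF this] show ?thesis using ball_subset_cball by auto
      qed
      then show ?thesis by blast
    qed
    moreover obtain T where T: "T \<subseteq> (\<lambda>b. ball b (SOME r. r > 0 \<and> cball b r \<subseteq> S)) ` S" "countable T"
      "\<Union>T = \<Union>((\<lambda>b. ball b (SOME r. r > 0 \<and> cball b r \<subseteq> S)) ` S)"
      by (rule Lindelof[of "(\<lambda>b. ball b (SOME r. r > 0 \<and> cball b r \<subseteq> S)) ` S"]) auto
    ultimately have "v -` S \<inter> space M = (\<Union>B\<in>T. v -` B \<inter> space M)" by auto
    also have "\<dots> \<in> sets M"
    proof (rule sets.countable_UN'[OF T(2)], safe)
      fix B assume "B \<in> T"
      then obtain b r where B: "B = ball b r" using T(1) by auto
      have "ball b r = (\<Union>n::nat. cball b (r - 1 / real (Suc n)))"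
      proof safe
        fix x assume "x \<in> ball b r"
        then have "0 < r - dist b x" by simp
        then obtain n where "1 / real (Suc n) < r - dist b x" using nat_approx_posE by blast
        then show "x \<in> (\<Union>n::nat. cball b (r - 1 / real (Suc n)))"
          by (intro UN_I[of n]) auto
      next
        fix x and n :: nat assume "x \<in> cball b (r - 1 / real (Suc n))"
        then have "dist b x \<le> r - 1 / real (Suc n)" by simp
        then show "x \<in> ball b r" by (smt (verit) mem_ball of_nat_0_less_iff zero_less_Suc zero_less_divide_1_iff)
      qed
      then have "v -` B \<inter> space M = (\<Union>n::nat. v -` cball b (r - 1 / real (Suc n)) \<inter> space M)"
        using B by auto
      also have "\<dots> \<in> sets M" using cball by (intro sets.countable_UN) auto
      finally show "v -` B \<inter> space M \<in> sets M" .
    qed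
    finally show "v -` S \<inter> space M \<in> sets M" .
  qed
qed

lemma strongly_measurable_iff:
  fixes v :: "'x \<Rightarrow> 'b::{banach, second_countable_topology}"
  shows "strongly_measurable M v \<longleftrightarrow> v \<in> borel_measurable M"
proof
  assume "strongly_measurable M v"
  then have "\<forall>\<omega> :: 'b \<Rightarrow>\<^sub>L real. (\<lambda>x. blinfun_apply \<omega> (v x)) \<in> borel_measurable M"
    unfolding strongly_measurable_def by (rule conjunct1)
  then show "v \<in> borel_measurable M" using borel_measurable_if_weakly_measurable[of v M] by blast
next
  assume v: "v \<in> borel_measurable M"
  have "separable_space (top_of_set S)" for S :: "'b set"
  proof -
    obtain T where "countable T" "T \<subseteq> S" "S \<subseteq> closure T" using separable by blast
    then show ?thesis unfolding separable_space_def
    proof (intro exI conjI)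
      show "top_of_set S closure_of T = topspace (top_of_set S)"
        using \<open>T \<subseteq> S\<close> \<open>S \<subseteq> closure T\<close> by (auto simp: closure_of_subtopology Int_absorb1 Int_absorb2)
    qed (use \<open>countable T\<close> \<open>T \<subseteq> S\<close> in simp_all)
  qed
  moreover have "(\<lambda>x. blinfun_apply \<omega> (v x)) \<in> borel_measurable M" for \<omega> :: "'b \<Rightarrow>\<^sub>L real"
    by (rule borel_measurable_continuous_on[OF _ v]) (intro linear_continuous_on blinfun.bounded_linear_right)
  ultimately show "strongly_measurable M v"
    unfolding strongly_measurable_def using null_sets.empty_sets
    by (intro conjI allI bexI[of _ "{}"])
qed

lemma sections_eq:
  fixes E :: "'x \<Rightarrow> 'b::{banach, second_countable_topology} set"
  shows "sections M E = {v \<in> borel_measurable M. \<forall>x\<in>space M. v x \<in> E x}"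
  by (auto simp: sections_def strongly_measurable_iff)

section \<open>Measurable sections of a bundle\<close>

text \<open>
  This is the selection theorem of Kuratowski and Ryll-Nardzewski. Simple maps with values in
  a dense sequence are improved step by step, keeping the distance to the fibre below
  \<open>r / 2 ^ k\<close>; they converge uniformly to a section. The least index of a suitable point of
  the sequence is a measurable choice, because a bundle meets a ball in a measurable set. The
  sum of the steps is at most \<open>2 r\<close>.
\<close>

lemma bundle_sections:
  fixes E :: "'x \<Rightarrow> 'b::{banach, second_countable_topology} set"
  assumes "Banach_bundle M E" "0 < r"
  obtains v where "v \<in> sections M E"
    "\<And>x. \<lbrakk>x \<in> space M; E x \<inter> ball b r \<noteq> {}\<rbrakk> \<Longrightarrow> norm (v x - b) \<le> 2 * r"
proof -
  have hit: "{x \<in> space M. E x \<inter> ball c s \<noteq> {}} \<in> sets M" for c s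
    using assms(1) by (simp add: Banach_bundle_def)
  have E: "closed (E x)" "0 \<in> E x" if "x \<in> space M" for x
    using assms(1) that by (auto simp: Banach_bundle_def subspace_0)
  obtain d :: "nat \<Rightarrow> 'b" where d: "\<And>X. \<lbrakk>open X; X \<noteq> {}\<rbrakk> \<Longrightarrow> \<exists>n. d n \<in> X"
    using dense_sequence by blast
  \<comment> \<open>Where the fibre misses the ball, start from 0, which lies in every fibre.\<close>
  define f0 where "f0 = (\<lambda>x. if E x \<inter> ball b r \<noteq> {} then b else 0)"
  define good where "good k f \<longleftrightarrow> f \<in> borel_measurable M \<and>
      (\<forall>x\<in>space M. E x \<inter> ball (f x) (r / 2 ^ k) \<noteq> {}) \<and> (k = 0 \<longrightarrow> f = f0)" for k :: nat and f
  have "\<exists>f. \<forall>k. good k (f k) \<and> (\<forall>x\<in>space M. dist (f k x) (f (Suc k) x) < r / 2 ^ k)"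
  proof (rule dependent_nat_choice)
    have "f0 \<in> borel_measurable M"
      unfolding f0_def using hit[of b r] by (intro measurable_If) auto
    moreover have "E x \<inter> ball 0 r \<noteq> {}" if "x \<in> space M" for x
      using E(2)[OF that] \<open>0 < r\<close> centre_in_ball by blast
    ultimately have "good 0 f0" by (simp add: good_def f0_def)
    then show "\<exists>f. good 0 f" by blast
  next
    fix f k assume f: "good k f"
    define P where "P n x \<longleftrightarrow> dist (f x) (d n) < r / 2 ^ k \<and> E x \<inter> ball (d n) (r / 2 ^ Suc k) \<noteq> {}" for n x
    have ex: "\<exists>n. P n x" if "x \<in> space M" for x
    proof -
      have "E x \<inter> ball (f x) (r / 2 ^ k) \<noteq> {}" using f that by (simp add: good_def)
      then obtain e where e: "e \<in> E x" "dist (f x) e < r / 2 ^ k" by auto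
      define s where "s = min (r / 2 ^ Suc k) (r / 2 ^ k - dist (f x) e)"
      have "0 < s" using e \<open>0 < r\<close> by (simp add: s_def)
      then obtain n where n: "dist e (d n) < s" using d[of "ball e s"] by auto
      have "dist (f x) (d n) < r / 2 ^ k"
        using dist_triangle[of "f x" "d n" e] n by (simp add: s_def)
      moreover have "e \<in> E x \<inter> ball (d n) (r / 2 ^ Suc k)" using e n by (simp add: s_def dist_commute)
      ultimately show ?thesis unfolding P_def by blast
    qed
    have fm [measurable]: "f \<in> borel_measurable M" using f by (simp add: good_def)
    have [measurable]: "Measurable.pred M (P n)" for n
    proof -
      have "Measurable.pred M (\<lambda>x. E x \<inter> ball (d n) (r / 2 ^ Suc k) \<noteq> {})"
        unfolding pred_def by (rule hit)
      moreover have "Measurable.pred M (\<lambda>x. dist (f x) (d n) < r / 2 ^ k)" by measurable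
      ultimately show ?thesis unfolding P_def by simp
    qed
    define g where "g = (\<lambda>x. d (LEAST n. P n x))"
    have g: "P (LEAST n. P n x) x" if "x \<in> space M" for x using ex[OF that] by (rule LeastI_ex)
    have "g \<in> borel_measurable M" unfolding g_def by measurable
    then have "good (Suc k) g" using g by (auto simp: good_def g_def P_def)
    moreover have "\<forall>x\<in>space M. dist (f x) (g x) < r / 2 ^ k" using g by (auto simp: g_def P_def)
    ultimately show "\<exists>g. good (Suc k) g \<and> (\<forall>x\<in>space M. dist (f x) (g x) < r / 2 ^ k)" by blast
  qed
  then obtain f where f: "\<And>k. good k (f k)"
    "\<And>k x. x \<in> space M \<Longrightarrow> dist (f k x) (f (Suc k) x) < r / 2 ^ k" by blast
  have f_meas [measurable]: "f k \<in> borel_measurable M" for k using f(1) by (simp add: good_def)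
  have near: "dist (f k x) (f (k + j) x) \<le> 2 * r / 2 ^ k - 2 * r / 2 ^ (k + j)" if "x \<in> space M" for k j x
  proof (induction j)
    case (Suc j)
    have "dist (f k x) (f (k + Suc j) x) \<le> dist (f k x) (f (k + j) x) + dist (f (k + j) x) (f (Suc (k + j)) x)"
      using dist_triangle by simp
    also have "\<dots> \<le> (2 * r / 2 ^ k - 2 * r / 2 ^ (k + j)) + r / 2 ^ (k + j)"
      using Suc f(2)[OF that, of "k + j"] by simp
    also have "\<dots> = 2 * r / 2 ^ k - 2 * r / 2 ^ (k + Suc j)" by (simp add: field_simps)
    finally show ?case .
  qed simp
  have near': "dist (f k x) (f (k + j) x) \<le> 2 * r / 2 ^ k" if "x \<in> space M" for k j x
    by (rule order_trans[OF near[OF that]]) (use \<open>0 < r\<close> in simp)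
  have small: "\<exists>k. 2 * r / 2 ^ k < e" if "0 < e" for e :: real
  proof -
    have "0 < e / (2 * r)" using that \<open>0 < r\<close> by simp
    then obtain k where "(1 / 2) ^ k < e / (2 * r)" using real_arch_pow_inv[of "e / (2 * r)" "1/2"] by auto
    then show ?thesis using \<open>0 < r\<close> by (intro exI[of _ k]) (simp add: field_simps power_divide)
  qed
  have conv: "convergent (\<lambda>k. f k x)" if "x \<in> space M" for x
  proof -
    have "Cauchy (\<lambda>k. f k x)"
    proof (rule metric_CauchyI)
      fix e :: real assume "0 < e"
      then obtain k where k: "2 * r / 2 ^ k < e / 2" using small[of "e / 2"] by auto
      have "dist (f m x) (f n x) < e" if "k \<le> m" "k \<le> n" for m n
        using near'[OF \<open>x \<in> space M\<close>, of k "m - k"] near'[OF \<open>x \<in> space M\<close>, of k "n - k"] k that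
          dist_triangle2[of "f m x" "f n x" "f k x"] by (simp add: dist_commute)
      then show "\<exists>k. \<forall>m\<ge>k. \<forall>n\<ge>k. dist (f m x) (f n x) < e" by blast
    qed
    then show ?thesis by (rule Cauchy_convergent)
  qed
  define v where "v = (\<lambda>x. lim (\<lambda>k. f k x))"
  have lim: "(\<lambda>k. f k x) \<longlonglongrightarrow> v x" if "x \<in> space M" for x
    using conv[OF that] by (simp add: v_def convergent_LIMSEQ_iff)
  have "v \<in> borel_measurable M" unfolding v_def by measurable
  moreover have "v x \<in> E x" if x: "x \<in> space M" for x
  proof -
    have "\<exists>e. e \<in> E x \<and> dist (f k x) e < r / 2 ^ k" for k using f(1)[of k] x by (auto simp: good_def)
    then obtain e where e: "\<And>k. e k \<in> E x" "\<And>k. dist (f k x) (e k) < r / 2 ^ k" by metis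
    have "(\<lambda>k. r / 2 ^ k) \<longlonglongrightarrow> 0" by (rule LIMSEQ_divide_realpow_zero) simp
    then have "(\<lambda>k. f k x - e k) \<longlonglongrightarrow> 0"
    proof (rule Lim_null_comparison[rotated])
      show "\<forall>\<^sub>F k in sequentially. norm (f k x - e k) \<le> r / 2 ^ k"
        using e(2) by (simp add: dist_norm less_imp_le)
    qed
    from tendsto_diff[OF lim[OF x] this] have "e \<longlonglongrightarrow> v x" by simp
    then show ?thesis using closed_sequentially[OF E(1)[OF x]] e(1) by blast
  qed
  ultimately have "v \<in> sections M E" by (simp add: sections_eq)
  moreover have "norm (v x - b) \<le> 2 * r" if "x \<in> space M" "E x \<inter> ball b r \<noteq> {}" for x
  proof -
    have "f 0 x = b" using f(1)[of 0] that by (simp add: good_def f0_def)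
    then have "dist b (f k x) \<le> 2 * r" for k using near'[OF that(1), of 0 k] by simp
    then have "dist b (v x) \<le> 2 * r"
      using tendsto_dist[OF tendsto_const lim[OF that(1)], of b] by (intro LIMSEQ_le_const2) auto
    then show ?thesis by (simp add: dist_norm norm_minus_commute)
  qed
  ultimately show thesis by (rule that)
qed

text \<open>
  A Castaing representation: sections that start near the points of a dense sequence, on all
  scales, are dense in every fibre.
\<close>

lemma dense_sections:
  fixes E :: "'x \<Rightarrow> 'b::{banach, second_countable_topology} set"
  assumes "Banach_bundle M E"
  obtains v :: "nat \<Rightarrow> 'x \<Rightarrow> 'b" where "\<And>n. v n \<in> sections M E"
    "\<And>x e \<eta>. \<lbrakk>x \<in> space M; e \<in> E x; 0 < \<eta>\<rbrakk> \<Longrightarrow> \<exists>n. norm (v n x - e) < \<eta>"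
proof -
  obtain d :: "nat \<Rightarrow> 'b" where d: "\<And>X. \<lbrakk>open X; X \<noteq> {}\<rbrakk> \<Longrightarrow> \<exists>n. d n \<in> X"
    using dense_sequence by blast
  have "\<exists>v. v \<in> sections M E \<and>
    (\<forall>x\<in>space M. E x \<inter> ball (d i) (1 / real (Suc k)) \<noteq> {} \<longrightarrow> norm (v x - d i) \<le> 2 * (1 / real (Suc k)))" for i k
  proof -
    have "0 < 1 / real (Suc k)" by simp
    from bundle_sections[OF assms this, of "d i"] show ?thesis by metis
  qed
  then obtain V where V: "\<And>i k. V i k \<in> sections M E"
    "\<And>i k x. \<lbrakk>x \<in> space M; E x \<inter> ball (d i) (1 / real (Suc k)) \<noteq> {}\<rbrakk> \<Longrightarrow>
       norm (V i k x - d i) \<le> 2 * (1 / real (Suc k))"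
    by metis
  define v where "v n = case_prod V (prod_decode n)" for n
  show thesis
  proof (rule that)
    show "v n \<in> sections M E" for n using V(1) by (simp add: v_def split: prod.split)
    fix x e and \<eta> :: real assume x: "x \<in> space M" "e \<in> E x" "0 < \<eta>"
    obtain k where k: "1 / real (Suc k) < \<eta> / 3" using nat_approx_posE[of "\<eta> / 3"] x by auto
    obtain i where i: "d i \<in> ball e (1 / real (Suc k))" using d[of "ball e (1 / real (Suc k))"] by auto
    then have "E x \<inter> ball (d i) (1 / real (Suc k)) \<noteq> {}" using x by (auto simp: dist_commute)
    from V(2)[OF x(1) this] have "norm (V i k x - d i) \<le> 2 * (1 / real (Suc k))" .
    moreover have "norm (d i - e) < 1 / real (Suc k)" using i by (simp add: dist_norm norm_minus_commute)
    ultimately have "norm (V i k x - e) < \<eta>"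
      using norm_triangle_ineq[of "V i k x - d i" "d i - e"] k by simp
    then show "\<exists>n. norm (v n x - e) < \<eta>" by (intro exI[of _ "prod_encode (i, k)"]) (simp add: v_def)
  qed
qed

section \<open>The modulus of convexity of a fibre\<close>

lemma unit_sum_le: "\<lbrakk>norm v = 1; norm w = 1\<rbrakk> \<Longrightarrow> norm (v + w) \<le> 2"
  using norm_triangle_ineq[of v w] by simp

lemma modulus_greatest:
  assumes "c \<le> 1"
    "\<And>v w. \<lbrakk>v \<in> vecs B; w \<in> vecs B; vnorm B v = 1; vnorm B w = 1;
        vnorm B (vadd B v (vscale B (-1) w)) \<ge> \<epsilon>\<rbrakk> \<Longrightarrow> c \<le> 1 - vnorm B (vscale B (1/2) (vadd B v w))"
  shows "c \<le> modulus B \<epsilon>"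
  unfolding modulus_def using assms by (intro cInf_greatest) auto

lemma modulus_subspace:
  fixes V :: "'b::real_normed_vector set"
  shows "\<lbrakk>v \<in> V; w \<in> V; norm v = 1; norm w = 1; \<epsilon> \<le> norm (v - w)\<rbrakk> \<Longrightarrow>
           modulus (subspace_of V) \<epsilon> \<le> 1 - norm (v + w) / 2" (is "PROP ?a")
    and "0 \<le> modulus (subspace_of V) \<epsilon>" (is ?b) and "modulus (subspace_of V) \<epsilon> \<le> 1" (is ?c)
proof -
  define S where "S = {1 - norm ((1/2) *\<^sub>R (v + w)) | v w. v \<in> V \<and> w \<in> V \<and> norm v = 1 \<and> norm w = 1 \<and> \<epsilon> \<le> norm (v - w)}"
  have m: "modulus (subspace_of V) \<epsilon> = Inf (insert 1 S)" by (simp add: modulus_def subspace_of_def S_def)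
  have low: "0 \<le> z" if "z \<in> insert 1 S" for z
    using that by (auto simp: S_def unit_sum_le)
  then have "bdd_below (insert 1 S)" by (rule bdd_belowI)
  then have le: "modulus (subspace_of V) \<epsilon> \<le> z" if "z \<in> insert 1 S" for z
    unfolding m using that by (intro cInf_lower) auto
  show ?c using le by simp
  show ?b unfolding m using low by (intro cInf_greatest) auto
  show "PROP ?a"
  proof -
    assume "v \<in> V" "w \<in> V" "norm v = 1" "norm w = 1" "\<epsilon> \<le> norm (v - w)"
    then have "1 - norm ((1/2) *\<^sub>R (v + w)) \<in> S" unfolding S_def by blast
    then show "modulus (subspace_of V) \<epsilon> \<le> 1 - norm (v + w) / 2" using le by fastforce
  qed
qed

lemma modulus_subspace_greatest:
  fixes V :: "'b::real_normed_vector set"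
  assumes "c \<le> 1" "\<And>v w. \<lbrakk>v \<in> V; w \<in> V; norm v = 1; norm w = 1; \<epsilon> \<le> norm (v - w)\<rbrakk> \<Longrightarrow> c \<le> 1 - norm (v + w) / 2"
  shows "c \<le> modulus (subspace_of V) \<epsilon>"
  using assms by (intro modulus_greatest) (auto simp: subspace_of_def)

lemma modulus_subspace_mono:
  fixes V :: "'b::real_normed_vector set"
  assumes "\<epsilon> \<le> \<epsilon>'"
  shows "modulus (subspace_of V) \<epsilon> \<le> modulus (subspace_of V) \<epsilon>'"
  using assms by (intro modulus_subspace_greatest modulus_subspace) auto

text \<open>
  The modulus of a fibre admits pairs at distance at least \<open>\<epsilon>\<close>, the pointwise modulus only
  those at distance greater than \<open>\<epsilon>\<close>. Below 2 this makes no difference to the infimum.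
\<close>

lemma widen_unit_pair:
  fixes V :: "'b::real_normed_vector set"
  assumes V: "subspace V" "v \<in> V" "w \<in> V" and unit: "norm v = 1" "norm w = 1"
    and gap: "\<epsilon> \<le> norm (v - w)" "0 < \<epsilon>" "\<epsilon> < 2" and "0 < \<eta>"
  obtains v' w' where "v' \<in> V" "w' \<in> V" "norm v' = 1" "norm w' = 1" "\<epsilon> < norm (v' - w')"
    "norm (v + w) / 2 - \<eta> \<le> norm (v' + w') / 2"
proof (cases "\<epsilon> < norm (v - w)")
  case True
  then show thesis using assms by (intro that[of v w]) auto
next
  case False
  then have eq: "norm (v - w) = \<epsilon>" using gap by simp
  define a where "a = (1/2) *\<^sub>R (v + w)"
  define b where "b = (1/2) *\<^sub>R (v - w)"
  have ab: "v = a + b" "w = a - b" "a \<in> V" "b \<in> V"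
    using V by (auto simp: a_def b_def subspace_add subspace_diff subspace_scale simp flip: scaleR_add_right scaleR_diff_right)
  define q where "q s t = norm (s *\<^sub>R a + t *\<^sub>R b)" for s t
  obtain s1 t1 s2 t2 where st: "q s1 t1 = 1" "q s2 t2 = 1" "q 0 2 < q (s1 - s2) (t1 - t2)"
    "q 1 0 - \<eta> \<le> q ((s1 + s2) / 2) ((t1 + t2) / 2)"
  proof (rule perturb_pair[of q \<eta>])
    show "q (s + s') (t + t') \<le> q s t + q s' t'" for s t s' t'
      unfolding q_def by (rule order_trans[OF _ norm_triangle_ineq]) (simp add: algebra_simps)
    show "q (c * s) (c * t) = \<bar>c\<bar> * q s t" for c s t
    proof -
      have "(c * s) *\<^sub>R a + (c * t) *\<^sub>R b = c *\<^sub>R (s *\<^sub>R a + t *\<^sub>R b)" by (simp add: scaleR_add_right)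
      then show ?thesis unfolding q_def by (simp only: norm_scaleR)
    qed
    have "2 *\<^sub>R b = v - w" by (simp add: b_def)
    then have "q 0 2 = \<epsilon>" unfolding q_def by (simp add: eq)
    then show "0 < q 0 2" "q 0 2 < 2" using gap by auto
    show "q 1 1 = 1" "q 1 (-1) = 1" using unit ab by (auto simp: q_def)
  qed (use assms in auto)
  have 2: "2 *\<^sub>R b = v - w" by (simp add: b_def)
  show thesis
  proof (rule that[of "s1 *\<^sub>R a + t1 *\<^sub>R b" "s2 *\<^sub>R a + t2 *\<^sub>R b"])
    show "norm (v + w) / 2 - \<eta> \<le> norm (s1 *\<^sub>R a + t1 *\<^sub>R b + (s2 *\<^sub>R a + t2 *\<^sub>R b)) / 2"
    proof -
      have "norm (s1 *\<^sub>R a + t1 *\<^sub>R b + (s2 *\<^sub>R a + t2 *\<^sub>R b)) / 2 = norm ((1/2) *\<^sub>R (s1 *\<^sub>R a + t1 *\<^sub>R b + (s2 *\<^sub>R a + t2 *\<^sub>R b)))"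
        by simp
      also have "(1/2) *\<^sub>R (s1 *\<^sub>R a + t1 *\<^sub>R b + (s2 *\<^sub>R a + t2 *\<^sub>R b)) = ((s1 + s2) / 2) *\<^sub>R a + ((t1 + t2) / 2) *\<^sub>R b"
        by (simp add: algebra_simps add_divide_distrib)
      moreover have "q 1 0 = norm (v + w) / 2" by (simp add: q_def a_def)
      ultimately show ?thesis using st(4) by (simp add: q_def)
    qed
    have "s1 *\<^sub>R a + t1 *\<^sub>R b - (s2 *\<^sub>R a + t2 *\<^sub>R b) = (s1 - s2) *\<^sub>R a + (t1 - t2) *\<^sub>R b" by (simp add: algebra_simps)
    then show "\<epsilon> < norm (s1 *\<^sub>R a + t1 *\<^sub>R b - (s2 *\<^sub>R a + t2 *\<^sub>R b))"
      using st(3) 2 eq by (simp add: q_def)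
  qed (use st ab V in \<open>auto simp: q_def subspace_add subspace_scale\<close>)
qed

text \<open>
  With a strict inequality the admissible pairs form an open condition, so a countable dense
  family suffices for the infimum; hence the modulus of the fibres is measurable in the base
  point.
\<close>

lemma modulus_subspace_eq_INF:
  fixes V :: "'b::real_normed_vector set"
  assumes V: "subspace V" and u: "\<And>n::nat. u n \<in> V"
    and dense: "\<And>e \<eta>. \<lbrakk>e \<in> V; norm e = 1; 0 < \<eta>\<rbrakk> \<Longrightarrow> \<exists>n. norm (u n) = 1 \<and> norm (u n - e) < \<eta>"
    and \<epsilon>: "0 < \<epsilon>" "\<epsilon> < 2"
  shows "modulus (subspace_of V) \<epsilon> = (INF (i, j). if norm (u i) = 1 \<and> norm (u j) = 1 \<and> \<epsilon> < norm (u i - u j)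
      then 1 - norm (u i + u j) / 2 else 1)" (is "_ = (INF ij. ?f ij)")
proof (rule antisym)
  show "modulus (subspace_of V) \<epsilon> \<le> (INF ij. ?f ij)"
    using u by (intro cINF_greatest) (auto intro!: modulus_subspace split: prod.splits)
  have nn: "0 \<le> ?f ij" for ij by (auto simp: unit_sum_le split: prod.splits)
  then have bdd: "bdd_below (range ?f)" by (intro bdd_belowI2) auto
  have le1: "(INF ij. ?f ij) \<le> ?f ij" for ij using bdd by (intro cINF_lower) auto
  show "(INF ij. ?f ij) \<le> modulus (subspace_of V) \<epsilon>"
  proof (rule modulus_subspace_greatest)
    show "(INF ij. ?f ij) \<le> 1"
    proof -
      have "?f ij \<le> 1" for ij by (auto split: prod.splits)
      then show ?thesis using le1 order_trans by blast
    qed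
    fix v w assume vw: "v \<in> V" "w \<in> V" "norm v = 1" "norm w = 1" "\<epsilon> \<le> norm (v - w)"
    show "(INF ij. ?f ij) \<le> 1 - norm (v + w) / 2"
    proof (rule field_le_epsilon)
      fix e :: real assume "0 < e"
      then have e: "0 < e / 2" by simp
      obtain v' w' where v': "v' \<in> V" "w' \<in> V" "norm v' = 1" "norm w' = 1" "\<epsilon> < norm (v' - w')"
        "norm (v + w) / 2 - e / 2 \<le> norm (v' + w') / 2"
        using widen_unit_pair[OF V vw(1-5) \<epsilon> e] by blast
      define \<eta> where "\<eta> = min (e / 2) ((norm (v' - w') - \<epsilon>) / 2)"
      have \<eta>: "0 < \<eta>" "\<eta> \<le> e / 2" using v' e by (auto simp: \<eta>_def)
      have "\<eta> \<le> (norm (v' - w') - \<epsilon>) / 2" unfolding \<eta>_def by (rule min.cobounded2)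
      then have \<eta>2: "2 * \<eta> \<le> norm (v' - w') - \<epsilon>" by simp
      obtain i where i: "norm (u i) = 1" "norm (u i - v') < \<eta>" using dense v' \<eta> by blast
      obtain j where j: "norm (u j) = 1" "norm (u j - w') < \<eta>" using dense v' \<eta> by blast
      have "norm ((u i - u j) - (v' - w')) < 2 * \<eta>"
        using norm_triangle_ineq4[of "u i - v'" "u j - w'"] i j by (simp add: algebra_simps)
      then have gap: "\<epsilon> < norm (u i - u j)"
        using norm_triangle_ineq3[of "u i - u j" "v' - w'"] \<eta>2 by linarith
      have "norm ((u i + u j) - (v' + w')) < 2 * \<eta>"
        using norm_triangle_ineq[of "u i - v'" "u j - w'"] i j by (simp add: algebra_simps)
      then have "norm (v' + w') / 2 \<le> norm (u i + u j) / 2 + \<eta>"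
        using norm_triangle_ineq3[of "u i + u j" "v' + w'"] by linarith
      moreover have "?f (i, j) = 1 - norm (u i + u j) / 2" using gap i j by simp
      ultimately show "(INF ij. ?f ij) \<le> 1 - norm (v + w) / 2 + e"
        using le1[of "(i, j)"] v'(6) \<eta>(2) by linarith
    qed
  qed
qed

lemma dense_units:
  fixes E :: "'x \<Rightarrow> 'b::{banach, second_countable_topology} set"
  assumes "Banach_bundle M E"
  obtains u :: "nat \<Rightarrow> 'x \<Rightarrow> 'b" where "\<And>n. u n \<in> sections M E" "\<And>n x. norm (u n x) \<le> 1"
    "\<And>x e \<eta>. \<lbrakk>x \<in> space M; e \<in> E x; norm e = 1; 0 < \<eta>\<rbrakk> \<Longrightarrow> \<exists>n. norm (u n x) = 1 \<and> norm (u n x - e) < \<eta>"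
proof -
  obtain v :: "nat \<Rightarrow> 'x \<Rightarrow> 'b" where v: "\<And>n. v n \<in> sections M E"
    "\<And>x e \<eta>. \<lbrakk>x \<in> space M; e \<in> E x; 0 < \<eta>\<rbrakk> \<Longrightarrow> \<exists>n. norm (v n x - e) < \<eta>"
    using dense_sections[OF assms] by blast
  define u where "u n x = sgn (v n x)" for n x
  show thesis
  proof (rule that)
    show "u n \<in> sections M E" for n
    proof -
      have [measurable]: "v n \<in> borel_measurable M" using v(1) by (simp add: sections_eq)
      have "u n \<in> borel_measurable M" unfolding u_def sgn_div_norm by measurable
      then show ?thesis using v(1)[of n] assms
        by (auto simp: sections_eq u_def sgn_div_norm Banach_bundle_def subspace_scale)
    qed
    show "norm (u n x) \<le> 1" for n x by (simp add: u_def norm_sgn)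
    fix x e and \<eta> :: real assume e: "x \<in> space M" "e \<in> E x" "norm e = 1" "0 < \<eta>"
    define \<eta>' where "\<eta>' = min (\<eta> / 2) 1"
    obtain n where n: "norm (v n x - e) < \<eta>'" using v(2)[OF e(1,2), of \<eta>'] e by (auto simp: \<eta>'_def)
    have b: "\<bar>norm (v n x) - 1\<bar> < \<eta>'" using norm_triangle_ineq3[of "v n x" e] n e by simp
    then have "v n x \<noteq> 0" by (auto simp: \<eta>'_def)
    moreover have "norm (sgn (v n x) - v n x) = \<bar>norm (v n x) - 1\<bar>"
    proof -
      have "sgn (v n x) - v n x = (1 - norm (v n x)) *\<^sub>R sgn (v n x)"
        using \<open>v n x \<noteq> 0\<close> by (simp add: algebra_simps sgn_div_norm)
      then show ?thesis using \<open>v n x \<noteq> 0\<close> by (simp add: norm_sgn)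
    qed
    ultimately have "norm (u n x) = 1" "norm (u n x - e) < 2 * \<eta>'"
      using b n norm_triangle_ineq[of "sgn (v n x) - v n x" "v n x - e"] by (auto simp: u_def norm_sgn)
    then show "\<exists>n. norm (u n x) = 1 \<and> norm (u n x - e) < \<eta>" by (intro exI[of _ n]) (simp add: \<eta>'_def)
  qed
qed

lemma borel_measurable_modulus:
  fixes E :: "'x \<Rightarrow> 'b::{banach, second_countable_topology} set"
  assumes "Banach_bundle M E" "0 < \<epsilon>" "\<epsilon> < 2"
  shows "(\<lambda>x. modulus (subspace_of (E x)) \<epsilon>) \<in> borel_measurable M"
proof -
  obtain u :: "nat \<Rightarrow> 'x \<Rightarrow> 'b" where u: "\<And>n. u n \<in> sections M E"
    "\<And>x e \<eta>. \<lbrakk>x \<in> space M; e \<in> E x; norm e = 1; 0 < \<eta>\<rbrakk> \<Longrightarrow> \<exists>n. norm (u n x) = 1 \<and> norm (u n x - e) < \<eta>"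
    using dense_units[OF assms(1)] by metis
  have [measurable]: "u n \<in> borel_measurable M" for n using u(1) by (simp add: sections_eq)
  define f where "f x ij = (case ij of (i, j) \<Rightarrow> if norm (u i x) = 1 \<and> norm (u j x) = 1 \<and> \<epsilon> < norm (u i x - u j x)
      then 1 - norm (u i x + u j x) / 2 else 1)" for x ij
  have "modulus (subspace_of (E x)) \<epsilon> = (INF ij. f x ij)" if "x \<in> space M" for x
    unfolding f_def using that assms u
    by (intro modulus_subspace_eq_INF) (auto simp: Banach_bundle_def sections_eq)
  moreover have "(\<lambda>x. INF ij. f x ij) \<in> borel_measurable M"
  proof (rule borel_measurable_cINF)
    show "(\<lambda>x. f x ij) \<in> borel_measurable M" for ij
      unfolding f_def by (cases ij) (simp, measurable)
    have "0 \<le> f x ij" for x ij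
      by (auto simp: f_def unit_sum_le split: prod.splits)
    then show "bdd_below ((\<lambda>ij. f x ij) ` UNIV)" for x by (intro bdd_belowI2) auto
  qed auto
  ultimately show ?thesis by (simp cong: measurable_cong)
qed

section \<open>Lebesgue spaces of vector-valued maps\<close>

definition Lp_maps :: "'x measure \<Rightarrow> real \<Rightarrow> ('x \<Rightarrow> 'b::{banach, second_countable_topology}) set" where
  "Lp_maps M p = {v \<in> borel_measurable M. integrable M (\<lambda>x. norm (v x) powr p)}"

definition Lp_map_norm :: "'x measure \<Rightarrow> real \<Rightarrow> ('x \<Rightarrow> 'b::real_normed_vector) \<Rightarrow> real" where
  "Lp_map_norm M p v = Lp_norm M p (\<lambda>x. norm (v x))"

lemma Lp_mapsD:
  assumes "v \<in> Lp_maps M p"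
  shows "v \<in> borel_measurable M" "integrable M (\<lambda>x. norm (v x) powr p)"
  using assms by (auto simp: Lp_maps_def)

lemma Lp_sections_eq:
  fixes E :: "'x \<Rightarrow> 'b::{banach, second_countable_topology} set"
  shows "Lp_sections M E p = {v \<in> Lp_maps M p. \<forall>x\<in>space M. v x \<in> E x}"
  by (auto simp: Lp_sections_def sections_eq Lp_maps_def Lp_fun_def)

lemma Lp_map_norm_eq: "Lp_map_norm M p v = (\<integral>x. norm (v x) powr p \<partial>M) powr (1 / p)"
  by (simp add: Lp_map_norm_def Lp_norm_def)

lemma Lp_map_norm_nonneg: "0 \<le> Lp_map_norm M p v"
  by (simp add: Lp_map_norm_eq)

lemma Lp_map_norm_powr:
  assumes "0 < p"
  shows "Lp_map_norm M p v powr p = (\<integral>x. norm (v x) powr p \<partial>M)"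
  using assms by (simp add: Lp_map_norm_eq powr_powr)

lemma Lp_map_norm_le_iff:
  assumes "0 < p" "0 \<le> c"
  shows "Lp_map_norm M p v \<le> c \<longleftrightarrow> (\<integral>x. norm (v x) powr p \<partial>M) \<le> c powr p"
  using assms powr_mono2[of p "Lp_map_norm M p v" c] powr_less_mono2[of p c "Lp_map_norm M p v"]
  by (auto simp: Lp_map_norm_nonneg simp flip: Lp_map_norm_powr[OF assms(1)]) (meson not_less)

lemma Lp_map_norm_cong_AE:
  assumes "v \<in> borel_measurable M" "w \<in> borel_measurable M" "AE x in M. norm (v x) = norm (w x)"
  shows "Lp_map_norm M p v = Lp_map_norm M p w"
proof -
  have "(\<integral>x. norm (v x) powr p \<partial>M) = (\<integral>x. norm (w x) powr p \<partial>M)"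
    using assms by (intro integral_cong_AE) (auto elim: eventually_mono)
  then show ?thesis by (simp add: Lp_map_norm_eq)
qed

lemma Lp_map_norm_eq_0_iff:
  assumes "v \<in> Lp_maps M p" "0 < p"
  shows "Lp_map_norm M p v = 0 \<longleftrightarrow> (AE x in M. v x = 0)"
proof -
  have "Lp_map_norm M p v = 0 \<longleftrightarrow> (\<integral>x. norm (v x) powr p \<partial>M) = 0"
    using assms by (simp add: Lp_map_norm_eq)
  also have "\<dots> \<longleftrightarrow> (AE x in M. norm (v x) powr p = 0)"
    using Lp_mapsD[OF assms(1)] by (intro integral_nonneg_eq_0_iff_AE) auto
  finally show ?thesis by simp
qed

lemma Lp_map_norm_scaleR:
  assumes "0 < p"
  shows "Lp_map_norm M p (\<lambda>x. c *\<^sub>R v x) = \<bar>c\<bar> * Lp_map_norm M p v"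
  using assms by (simp add: Lp_map_norm_eq powr_mult powr_powr)

lemma Lp_maps_dominated:
  assumes "v \<in> borel_measurable M" "w \<in> Lp_maps M p" "0 \<le> C" "0 < p"
    and "AE x in M. norm (v x) \<le> C * norm (w x)"
  shows "v \<in> Lp_maps M p"
proof -
  have "integrable M (\<lambda>x. norm (v x) powr p)"
  proof (rule Bochner_Integration.integrable_bound)
    show "integrable M (\<lambda>x. C powr p * norm (w x) powr p)" using Lp_mapsD[OF assms(2)] by simp
    show "(\<lambda>x. norm (v x) powr p) \<in> borel_measurable M" using assms(1) by measurable
    show "AE x in M. norm (norm (v x) powr p) \<le> norm (C powr p * norm (w x) powr p)"
      using assms(5)
    proof eventually_elim
      case (elim x)
      then have "norm (v x) powr p \<le> (C * norm (w x)) powr p" using assms by (intro powr_mono2) auto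
      then show ?case using assms by (simp add: powr_mult)
    qed
  qed
  then show ?thesis using assms by (simp add: Lp_maps_def)
qed

lemma Lp_maps_zero: "(\<lambda>_. 0) \<in> Lp_maps M p"
  by (simp add: Lp_maps_def)

lemma Lp_maps_scaleR:
  fixes v :: "'x \<Rightarrow> 'b::{banach, second_countable_topology}"
  assumes "f \<in> borel_measurable M" "AE x in M. \<bar>f x\<bar> \<le> C" "v \<in> Lp_maps M p" "0 < p"
  shows "(\<lambda>x. f x *\<^sub>R v x) \<in> Lp_maps M p"
proof (rule Lp_maps_dominated[OF _ assms(3), where C = "\<bar>C\<bar>"])
  show "(\<lambda>x. f x *\<^sub>R v x) \<in> borel_measurable M"
    using assms Lp_mapsD(1)[OF assms(3)] by measurable
  show "AE x in M. norm (f x *\<^sub>R v x) \<le> \<bar>C\<bar> * norm (v x)"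
    using assms(2) by eventually_elim (auto intro: mult_right_mono)
qed (use assms in auto)

lemma Lp_maps_add:
  fixes v w :: "'x \<Rightarrow> 'b::{banach, second_countable_topology}"
  assumes "v \<in> Lp_maps M p" "w \<in> Lp_maps M p" "1 \<le> p"
  shows "(\<lambda>x. v x + w x) \<in> Lp_maps M p"
proof -
  note v = Lp_mapsD[OF assms(1)] and w = Lp_mapsD[OF assms(2)]
  have "integrable M (\<lambda>x. norm (v x + w x) powr p)"
  proof (rule Bochner_Integration.integrable_bound)
    show "integrable M (\<lambda>x. 2 powr p * ((norm (v x) powr p + norm (w x) powr p) / 2))" using v w by simp
    show "(\<lambda>x. norm (v x + w x) powr p) \<in> borel_measurable M" using v(1) w(1) by measurable
    show "AE x in M. norm (norm (v x + w x) powr p) \<le> norm (2 powr p * ((norm (v x) powr p + norm (w x) powr p) / 2))"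
    proof (intro always_eventually allI)
      fix x
      have "norm (v x + w x) powr p \<le> (2 * ((norm (v x) + norm (w x)) / 2)) powr p"
        using assms norm_triangle_ineq[of "v x" "w x"] by (intro powr_mono2) auto
      also have "\<dots> = 2 powr p * ((norm (v x) + norm (w x)) / 2) powr p" by (rule powr_mult)
      also have "\<dots> \<le> 2 powr p * ((norm (v x) powr p + norm (w x) powr p) / 2)"
        using assms by (intro mult_left_mono powr_midpoint_le) auto
      finally show "norm (norm (v x + w x) powr p) \<le> norm (2 powr p * ((norm (v x) powr p + norm (w x) powr p) / 2))"
        by simp
    qed
  qed
  then show ?thesis using v(1) w(1) by (simp add: Lp_maps_def)
qed

lemma Lp_maps_scaleR_const:
  fixes v :: "'x \<Rightarrow> 'b::{banach, second_countable_topology}"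
  assumes "v \<in> Lp_maps M p" "0 < p"
  shows "(\<lambda>x. c *\<^sub>R v x) \<in> Lp_maps M p"
  using assms by (intro Lp_maps_scaleR[where C = "\<bar>c\<bar>"]) auto

lemma Lp_maps_diff:
  fixes v w :: "'x \<Rightarrow> 'b::{banach, second_countable_topology}"
  assumes "v \<in> Lp_maps M p" "w \<in> Lp_maps M p" "1 \<le> p"
  shows "(\<lambda>x. v x - w x) \<in> Lp_maps M p"
  using Lp_maps_add[OF assms(1) Lp_maps_scaleR_const[OF assms(2), of "-1"]] assms by simp

text \<open>
  The triangle inequality says that the unit ball is convex, and this is the convexity of the
  power after both maps are normalised.
\<close>

lemma Minkowski:
  fixes v w :: "'x \<Rightarrow> 'b::{banach, second_countable_topology}"
  assumes "v \<in> Lp_maps M p" "w \<in> Lp_maps M p" "1 \<le> p"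
  shows "Lp_map_norm M p (\<lambda>x. v x + w x) \<le> Lp_map_norm M p v + Lp_map_norm M p w"
proof -
  note v = Lp_mapsD[OF assms(1)] and w = Lp_mapsD[OF assms(2)]
  define a where "a = Lp_map_norm M p v"
  define b where "b = Lp_map_norm M p w"
  have ab: "0 \<le> a" "0 \<le> b" by (auto simp: a_def b_def Lp_map_norm_nonneg)
  show ?thesis
  proof (cases "a = 0 \<or> b = 0")
    case True
    have "Lp_map_norm M p (\<lambda>x. v x + w x) = b" if "a = 0"
      using Lp_map_norm_eq_0_iff[OF assms(1)] that assms v(1) w(1) unfolding a_def b_def
      by (intro Lp_map_norm_cong_AE) (auto elim: eventually_mono)
    moreover have "Lp_map_norm M p (\<lambda>x. v x + w x) = a" if "b = 0"
      using Lp_map_norm_eq_0_iff[OF assms(2)] that assms v(1) w(1) unfolding a_def b_def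
      by (intro Lp_map_norm_cong_AE) (auto elim: eventually_mono)
    ultimately show ?thesis using True ab unfolding a_def b_def by auto
  next
    case False
    then have ab: "0 < a" "0 < b" using ab by auto
    define l where "l = a / (a + b)"
    have l: "0 < l" "l < 1" "1 - l = b / (a + b)" using ab by (auto simp: l_def field_simps)
    have int: "(\<integral>x. norm (v x) powr p \<partial>M) = a powr p" "(\<integral>x. norm (w x) powr p \<partial>M) = b powr p"
      using assms by (auto simp: a_def b_def Lp_map_norm_powr)
    have pt: "norm (v x + w x) powr p \<le> (a + b) powr p * (l * (norm (v x) powr p / a powr p) + (1 - l) * (norm (w x) powr p / b powr p))" for x
    proof -
      have "norm (v x + w x) \<le> (a + b) * (l * (norm (v x) / a) + (1 - l) * (norm (w x) / b))"
      proof -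
        have "(a + b) * l = a" "(a + b) * (1 - l) = b" using ab unfolding l(3) by (auto simp: l_def)
        then have "(a + b) * (l * (norm (v x) / a) + (1 - l) * (norm (w x) / b)) = a * (norm (v x) / a) + b * (norm (w x) / b)"
          by (metis distrib_left mult.assoc)
        then show ?thesis using norm_triangle_ineq[of "v x" "w x"] ab by simp
      qed
      then have "norm (v x + w x) powr p \<le> ((a + b) * (l * (norm (v x) / a) + (1 - l) * (norm (w x) / b))) powr p"
        using assms by (intro powr_mono2) auto
      also have "\<dots> = (a + b) powr p * (l * (norm (v x) / a) + (1 - l) * (norm (w x) / b)) powr p"
        by (rule powr_mult)
      also have "\<dots> \<le> (a + b) powr p * (l * (norm (v x) / a) powr p + (1 - l) * (norm (w x) / b) powr p)"
        using assms ab l by (intro mult_left_mono powr_convex_combination) auto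
      finally show ?thesis using ab by (simp add: powr_divide)
    qed
    have "(\<integral>x. norm (v x + w x) powr p \<partial>M)
        \<le> (\<integral>x. (a + b) powr p * (l * (norm (v x) powr p / a powr p) + (1 - l) * (norm (w x) powr p / b powr p)) \<partial>M)"
      using v w Lp_mapsD(2)[OF Lp_maps_add[OF assms]] pt by (intro integral_mono) auto
    also have "\<dots> = (a + b) powr p"
      using v w int ab by (simp add: integral_add)
    finally show ?thesis using assms ab unfolding a_def[symmetric] b_def[symmetric]
      by (subst Lp_map_norm_le_iff) auto
  qed
qed

lemma Lp_map_norm_mono:
  fixes v w :: "'x \<Rightarrow> 'b::{banach, second_countable_topology}"
  assumes "v \<in> Lp_maps M p" "w \<in> Lp_maps M p" "0 < p" "AE x in M. norm (v x) \<le> norm (w x)"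
  shows "Lp_map_norm M p v \<le> Lp_map_norm M p w"
  using assms(3,4) Lp_mapsD[OF assms(1)] Lp_mapsD[OF assms(2)] Lp_map_norm_nonneg[of M p w]
  by (auto simp: Lp_map_norm_le_iff Lp_map_norm_powr intro!: integral_mono_AE elim!: eventually_mono intro: powr_mono2)

text \<open>
  Riesz and Fischer: a subsequence with steps below \<open>4 ^ (- k)\<close> converges almost everywhere,
  and Fatou's lemma makes the pointwise limit a limit in norm. The last conclusion, that every
  value of the limit is 0 or a limit of values of the sequence, keeps the limit in the closed
  fibres of a bundle.
\<close>

lemma Lp_complete:
  fixes \<sigma> :: "nat \<Rightarrow> 'x \<Rightarrow> 'b::{banach, second_countable_topology}"
  assumes \<sigma>: "\<And>n. \<sigma> n \<in> Lp_maps M p" and "1 \<le> p"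
    and cauchy: "\<And>e. 0 < e \<Longrightarrow> \<exists>N. \<forall>m\<ge>N. \<forall>n\<ge>N. Lp_map_norm M p (\<lambda>x. \<sigma> m x - \<sigma> n x) < e"
  obtains l where "l \<in> Lp_maps M p" "(\<lambda>n. Lp_map_norm M p (\<lambda>x. \<sigma> n x - l x)) \<longlonglongrightarrow> 0"
    "\<And>x. l x = 0 \<or> (\<exists>r. (\<lambda>k. \<sigma> (r k) x) \<longlonglongrightarrow> l x)"
proof -
  note m [measurable] = Lp_mapsD(1)[OF \<sigma>]
  have p: "0 < p" using assms by simp
  have "\<exists>N. \<forall>k::nat. \<forall>m\<ge>N k. \<forall>n\<ge>N k. Lp_map_norm M p (\<lambda>x. \<sigma> m x - \<sigma> n x) < (1/4) ^ k"
    using cauchy by (intro choice) auto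
  then obtain N where N: "\<And>k m n. \<lbrakk>N k \<le> m; N k \<le> n\<rbrakk> \<Longrightarrow> Lp_map_norm M p (\<lambda>x. \<sigma> m x - \<sigma> n x) < (1/4) ^ k" by blast
  \<comment> \<open>The partial sums of \<open>N\<close> make the subsequence monotone; the summand \<open>k\<close> makes it tend to infinity.\<close>
  define r where "r k = k + (\<Sum>i\<le>k. N i)" for k
  have rN: "N k \<le> r k" for k by (simp add: r_def atMost_Suc trans_le_add2 member_le_sum)
  have rmono: "mono r" by (rule incseq_SucI) (simp add: r_def)
  have rk: "k \<le> r k" for k by (simp add: r_def)
  define \<Delta> where "\<Delta> k x = \<sigma> (r (Suc k)) x - \<sigma> (r k) x" for k x
  have \<Delta>: "\<Delta> k \<in> Lp_maps M p" for k unfolding \<Delta>_def using \<sigma> assms by (intro Lp_maps_diff) auto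
  have \<Delta>_small: "(\<integral>x. (2 ^ k * norm (\<Delta> k x)) powr p \<partial>M) \<le> (1/2) ^ k" for k
  proof -
    have "N k \<le> r (Suc k)" using order_trans[OF rN] monoD[OF rmono, of k "Suc k"] by simp
    then have "Lp_map_norm M p (\<Delta> k) \<le> (1/4) ^ k" using N[OF _ rN, of k] unfolding \<Delta>_def by (simp add: less_imp_le)
    then have "Lp_map_norm M p (\<lambda>x. 2 ^ k *\<^sub>R \<Delta> k x) \<le> 2 ^ k * (1/4) ^ k" using p by (simp add: Lp_map_norm_scaleR)
    also have "2 ^ k * (1/4) ^ k = (1/2::real) ^ k" by (simp flip: power_mult_distrib)
    finally have "(\<integral>x. norm (2 ^ k *\<^sub>R \<Delta> k x) powr p \<partial>M) \<le> ((1/2) ^ k) powr p"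
      using p by (simp add: Lp_map_norm_le_iff)
    also have "((1/2::real) ^ k) powr p \<le> (1/2) ^ k"
      using powr_mono'[of 1 p "(1/2::real) ^ k"] assms by (simp add: power_le_one)
    finally show ?thesis by simp
  qed
  have "(\<integral>\<^sup>+x. (\<Sum>k. ennreal ((2 ^ k * norm (\<Delta> k x)) powr p)) \<partial>M) = (\<Sum>k. \<integral>\<^sup>+x. ennreal ((2 ^ k * norm (\<Delta> k x)) powr p) \<partial>M)"
    unfolding \<Delta>_def by (rule nn_integral_suminf) measurable
  also have "\<dots> = (\<Sum>k. ennreal (\<integral>x. (2 ^ k * norm (\<Delta> k x)) powr p \<partial>M))"
  proof (intro suminf_cong nn_integral_eq_integral)
    show "integrable M (\<lambda>x. (2 ^ k * norm (\<Delta> k x)) powr p)" for k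
      using Lp_mapsD(2)[OF \<Delta>[of k]] by (simp add: powr_mult)
  qed auto
  also have "\<dots> \<le> (\<Sum>k. ennreal ((1/2) ^ k))" using \<Delta>_small by (intro suminf_le ennreal_leI) auto
  also have "\<dots> = ennreal (\<Sum>k. (1/2) ^ k)" by (intro suminf_ennreal2) (auto intro: summable_geometric)
  also have "\<dots> < \<infinity>" by simp
  finally have "AE x in M. (\<Sum>k. ennreal ((2 ^ k * norm (\<Delta> k x)) powr p)) \<noteq> \<infinity>"
    by (intro nn_integral_PInf_AE) (simp_all add: \<Delta>_def)
  then have conv: "AE x in M. convergent (\<lambda>k. \<sigma> (r k) x)"
  proof eventually_elim
    case (elim x)
    then have "summable (\<lambda>k. (2 ^ k * norm (\<Delta> k x)) powr p)" by (intro summable_suminf_not_top) auto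
    then have "(\<lambda>k. (2 ^ k * norm (\<Delta> k x)) powr p) \<longlonglongrightarrow> 0" by (rule summable_LIMSEQ_zero)
    then have "\<forall>\<^sub>F k in sequentially. (2 ^ k * norm (\<Delta> k x)) powr p < 1" by (rule order_tendstoD) simp
    then have "\<forall>\<^sub>F k in sequentially. norm (norm (\<Delta> k x)) \<le> (1/2) ^ k"
    proof eventually_elim
      case (elim k)
      then have "2 ^ k * norm (\<Delta> k x) < 1" using p ge_one_powr_ge_zero[of "2 ^ k * norm (\<Delta> k x)" p] by (meson less_imp_le not_less)
      then show ?case by (simp add: power_one_over field_simps)
    qed
    then have "summable (\<lambda>k. norm (\<Delta> k x))" by (rule summable_comparison_test_ev) (auto intro: summable_geometric)
    then have "summable (\<lambda>k. \<Delta> k x)" by (rule summable_norm_cancel)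
    then have "convergent (\<lambda>n. \<Sum>k<n. \<Delta> k x)" by (simp add: summable_iff_convergent)
    then have "convergent (\<lambda>n. \<sigma> (r 0) x + (\<Sum>k<n. \<Delta> k x))" by (intro convergent_add convergent_const)
    moreover have "\<sigma> (r 0) x + (\<Sum>k<n. \<Delta> k x) = \<sigma> (r n) x" for n
      unfolding \<Delta>_def using sum_lessThan_telescope[of "\<lambda>k. \<sigma> (r k) x" n] by simp
    ultimately show ?case by simp
  qed
  define l where "l x = (if Cauchy (\<lambda>k. \<sigma> (r k) x) then lim (\<lambda>k. \<sigma> (r k) x) else 0)" for x
  have l_lim: "(\<lambda>k. \<sigma> (r k) x) \<longlonglongrightarrow> l x" if "convergent (\<lambda>k. \<sigma> (r k) x)" for x
    using that by (simp add: l_def Cauchy_convergent_iff convergent_LIMSEQ_iff)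
  have l_meas [measurable]: "l \<in> borel_measurable M" unfolding l_def by measurable
  \<comment> \<open>Fatou's lemma, applied along the subsequence.\<close>
  have fatou: "integrable M (\<lambda>x. norm (\<sigma> n x - l x) powr p) \<and> (\<integral>x. norm (\<sigma> n x - l x) powr p \<partial>M) \<le> e powr p"
    if n: "\<And>m n. \<lbrakk>N0 \<le> m; N0 \<le> n\<rbrakk> \<Longrightarrow> Lp_map_norm M p (\<lambda>x. \<sigma> m x - \<sigma> n x) < e" "N0 \<le> n" "0 < e" for n N0 e
  proof -
    have "(\<integral>\<^sup>+x. ennreal (norm (\<sigma> n x - l x) powr p) \<partial>M)
        \<le> (\<integral>\<^sup>+x. liminf (\<lambda>k. ennreal (norm (\<sigma> n x - \<sigma> (r k) x) powr p)) \<partial>M)"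
    proof (rule nn_integral_mono_AE)
      show "AE x in M. ennreal (norm (\<sigma> n x - l x) powr p) \<le> liminf (\<lambda>k. ennreal (norm (\<sigma> n x - \<sigma> (r k) x) powr p))"
        using conv
      proof eventually_elim
        case (elim x)
        have "(\<lambda>k. norm (\<sigma> n x - \<sigma> (r k) x) powr p) \<longlonglongrightarrow> norm (\<sigma> n x - l x) powr p"
          using p by (intro tendsto_powr' tendsto_intros l_lim[OF elim]) auto
        then have "(\<lambda>k. ennreal (norm (\<sigma> n x - \<sigma> (r k) x) powr p)) \<longlonglongrightarrow> ennreal (norm (\<sigma> n x - l x) powr p)"
          by (rule tendsto_ennrealI)
        from lim_imp_Liminf[OF _ this] show ?case by simp
      qed
    qed
    also have "\<dots> \<le> liminf (\<lambda>k. \<integral>\<^sup>+x. ennreal (norm (\<sigma> n x - \<sigma> (r k) x) powr p) \<partial>M)"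
      by (rule nn_integral_liminf) measurable
    also have "\<dots> \<le> limsup (\<lambda>k. \<integral>\<^sup>+x. ennreal (norm (\<sigma> n x - \<sigma> (r k) x) powr p) \<partial>M)"
      by (rule Liminf_le_Limsup) simp
    also have "\<dots> \<le> ennreal (e powr p)"
    proof (rule Limsup_bounded)
      show "\<forall>\<^sub>F k in sequentially. (\<integral>\<^sup>+x. ennreal (norm (\<sigma> n x - \<sigma> (r k) x) powr p) \<partial>M) \<le> ennreal (e powr p)"
        using eventually_ge_at_top[of N0]
      proof eventually_elim
        case (elim k)
        then have "Lp_map_norm M p (\<lambda>x. \<sigma> n x - \<sigma> (r k) x) \<le> e" using n rk[of k] by (simp add: less_imp_le)
        then have "(\<integral>x. norm (\<sigma> n x - \<sigma> (r k) x) powr p \<partial>M) \<le> e powr p" using p n by (simp add: Lp_map_norm_le_iff)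
        moreover have "(\<integral>\<^sup>+x. ennreal (norm (\<sigma> n x - \<sigma> (r k) x) powr p) \<partial>M) = ennreal (\<integral>x. norm (\<sigma> n x - \<sigma> (r k) x) powr p \<partial>M)"
          using Lp_mapsD(2)[OF Lp_maps_diff[OF \<sigma> \<sigma> \<open>1 \<le> p\<close>]] by (intro nn_integral_eq_integral) auto
        ultimately show ?case by (simp add: ennreal_leI)
      qed
    qed
    finally have le: "(\<integral>\<^sup>+x. ennreal (norm (\<sigma> n x - l x) powr p) \<partial>M) \<le> ennreal (e powr p)" .
    then have "(\<integral>\<^sup>+x. ennreal (norm (\<sigma> n x - l x) powr p) \<partial>M) < \<infinity>" using order_le_less_trans by fastforce
    then have int: "integrable M (\<lambda>x. norm (\<sigma> n x - l x) powr p)" by (intro integrableI_nonneg) auto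
    moreover have "ennreal (\<integral>x. norm (\<sigma> n x - l x) powr p \<partial>M) \<le> ennreal (e powr p)"
      using le nn_integral_eq_integral[OF int] by simp
    ultimately show ?thesis by (simp add: ennreal_le_iff)
  qed
  have tail: "\<exists>N0. \<forall>n\<ge>N0. (\<lambda>x. \<sigma> n x - l x) \<in> Lp_maps M p \<and> Lp_map_norm M p (\<lambda>x. \<sigma> n x - l x) \<le> e" if e: "0 < e" for e
  proof -
    obtain N0 where "\<And>m n. \<lbrakk>N0 \<le> m; N0 \<le> n\<rbrakk> \<Longrightarrow> Lp_map_norm M p (\<lambda>x. \<sigma> m x - \<sigma> n x) < e" using cauchy[OF e] by blast
    from fatou[OF this _ e] show ?thesis using p e
      by (intro exI[of _ N0]) (auto simp: Lp_map_norm_le_iff Lp_maps_def)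
  qed
  show thesis
  proof (rule that)
    obtain n where "(\<lambda>x. \<sigma> n x - l x) \<in> Lp_maps M p" using tail[of 1] by auto
    from Lp_maps_diff[OF \<sigma>[of n] this \<open>1 \<le> p\<close>] show "l \<in> Lp_maps M p" by simp
    show "(\<lambda>n. Lp_map_norm M p (\<lambda>x. \<sigma> n x - l x)) \<longlonglongrightarrow> 0"
    proof (rule LIMSEQ_I)
      fix e :: real assume "0 < e"
      then obtain N0 where "\<forall>n\<ge>N0. Lp_map_norm M p (\<lambda>x. \<sigma> n x - l x) \<le> e / 2" using tail[of "e / 2"] by auto
      then show "\<exists>no. \<forall>n\<ge>no. norm (Lp_map_norm M p (\<lambda>x. \<sigma> n x - l x) - 0) < e"
        using \<open>0 < e\<close> by (intro exI[of _ N0]) (fastforce simp: Lp_map_norm_nonneg)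
    qed
    show "l x = 0 \<or> (\<exists>r. (\<lambda>k. \<sigma> (r k) x) \<longlonglongrightarrow> l x)" for x
      using l_lim[of x] by (cases "convergent (\<lambda>k. \<sigma> (r k) x)") (auto simp: l_def Cauchy_convergent_iff)
  qed
qed

section \<open>Quotients by almost everywhere equality\<close>

lemma equiv_ae_rel: "equiv S (ae_rel M S)"
proof (rule equivI)
  show "ae_rel M S \<subseteq> S \<times> S" by (auto simp: ae_rel_def)
  show "refl_on S (ae_rel M S)" by (auto simp: refl_on_def ae_rel_def)
  show "sym (ae_rel M S)" by (auto simp: sym_def ae_rel_def elim: eventually_mono)
  show "trans (ae_rel M S)" by (auto simp: trans_def ae_rel_def elim: eventually_elim2)
qed

lemma ae_class_eq_iff:
  assumes "f \<in> S" "g \<in> S"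
  shows "ae_rel M S `` {f} = ae_rel M S `` {g} \<longleftrightarrow> (AE x in M. f x = g x)"
  using eq_equiv_class_iff[OF equiv_ae_rel[of S M] assms] assms by (auto simp: ae_rel_def)

lemma ae_class_eqI:
  assumes "f \<in> S" "g \<in> S" "AE x in M. f x = g x"
  shows "ae_rel M S `` {f} = ae_rel M S `` {g}"
  using ae_class_eq_iff[OF assms(1,2)] assms(3) by blast

lemma ae_rel_iff: "(f, g) \<in> ae_rel M S \<longleftrightarrow> f \<in> S \<and> g \<in> S \<and> (AE x in M. f x = g x)"
  by (auto simp: ae_rel_def)

text \<open>
  All binary operations on classes are unions over representatives; this lemma computes them
  on classes of given representatives, for the ring, for the module and for the scalar action
  alike.
\<close>

lemma UN2_ae_class:
  assumes "f \<in> S" "g \<in> T" and h: "\<And>f' g'. \<lbrakk>f' \<in> S; g' \<in> T\<rbrakk> \<Longrightarrow> h f' g' \<in> R"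
    and cong: "\<And>f' g'. \<lbrakk>AE x in M. f x = f' x; AE x in M. g x = g' x\<rbrakk> \<Longrightarrow> AE x in M. h f g x = h f' g' x"
  shows "(\<Union>f'\<in>ae_rel M S `` {f}. \<Union>g'\<in>ae_rel M T `` {g}. ae_rel M R `` {h f' g'}) = ae_rel M R `` {h f g}"
proof -
  have "ae_rel M R `` {h f' g'} = ae_rel M R `` {h f g}" if "f' \<in> ae_rel M S `` {f}" "g' \<in> ae_rel M T `` {g}" for f' g'
  proof -
    have "f' \<in> S" "g' \<in> T" "AE x in M. f x = f' x" "AE x in M. g x = g' x"
      using that by (simp_all add: ae_rel_iff)
    then show ?thesis using assms(1,2) by (intro ae_class_eqI[THEN sym] h cong)
  qed
  moreover have "f \<in> ae_rel M S `` {f}" "g \<in> ae_rel M T `` {g}" using assms by (auto simp: ae_rel_iff)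
  ultimately show ?thesis by blast
qed

section \<open>The ring of essentially bounded functions\<close>

lemma Linf_fun_closed:
  assumes "f \<in> Linf_fun M" "g \<in> Linf_fun M"
  shows "(\<lambda>x. f x + g x) \<in> Linf_fun M" "(\<lambda>x. f x * g x) \<in> Linf_fun M"
proof -
  obtain C D where C: "AE x in M. \<bar>f x\<bar> \<le> C" and D: "AE x in M. \<bar>g x\<bar> \<le> D"
    using assms by (auto simp: Linf_fun_def)
  have [measurable]: "f \<in> borel_measurable M" "g \<in> borel_measurable M" using assms by (auto simp: Linf_fun_def)
  have "AE x in M. \<bar>f x + g x\<bar> \<le> C + D" using C D by eventually_elim simp
  moreover have "AE x in M. \<bar>f x * g x\<bar> \<le> \<bar>C\<bar> * \<bar>D\<bar>"
    using C D by eventually_elim (auto simp: abs_mult intro!: mult_mono)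
  ultimately show "(\<lambda>x. f x + g x) \<in> Linf_fun M" "(\<lambda>x. f x * g x) \<in> Linf_fun M"
    unfolding Linf_fun_def by (auto intro!: borel_measurable_add borel_measurable_times)
qed

lemma Linf_fun_const: "(\<lambda>_. c) \<in> Linf_fun M"
  by (auto simp: Linf_fun_def)

lemma carrier_LinfE:
  assumes "F \<in> carrier (Linf M)"
  obtains f where "f \<in> Linf_fun M" "F = Linf_class M f"
  using assms by (auto simp: Linf_def elim: quotientE)

lemma Linf_class_in_carrier: "f \<in> Linf_fun M \<Longrightarrow> Linf_class M f \<in> carrier (Linf M)"
  by (simp add: Linf_def quotientI)

lemma Linf_ops:
  "\<lbrakk>f \<in> Linf_fun M; g \<in> Linf_fun M\<rbrakk> \<Longrightarrow> Linf_class M f \<oplus>\<^bsub>Linf M\<^esub> Linf_class M g = Linf_class M (\<lambda>x. f x + g x)"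
  "\<lbrakk>f \<in> Linf_fun M; g \<in> Linf_fun M\<rbrakk> \<Longrightarrow> Linf_class M f \<otimes>\<^bsub>Linf M\<^esub> Linf_class M g = Linf_class M (\<lambda>x. f x * g x)"
  "\<zero>\<^bsub>Linf M\<^esub> = Linf_class M (\<lambda>_. 0)" "\<one>\<^bsub>Linf M\<^esub> = Linf_class M (\<lambda>_. 1)"
proof -
  show "Linf_class M f \<oplus>\<^bsub>Linf M\<^esub> Linf_class M g = Linf_class M (\<lambda>x. f x + g x)" if "f \<in> Linf_fun M" "g \<in> Linf_fun M"
    unfolding Linf_def ring.simps using that
    by (intro UN2_ae_class[where h = "\<lambda>f g x. f x + g x"] Linf_fun_closed) (auto elim: eventually_elim2)
  show "Linf_class M f \<otimes>\<^bsub>Linf M\<^esub> Linf_class M g = Linf_class M (\<lambda>x. f x * g x)" if "f \<in> Linf_fun M" "g \<in> Linf_fun M"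
    unfolding Linf_def monoid.simps using that
    by (intro UN2_ae_class[where h = "\<lambda>f g x. f x * g x"] Linf_fun_closed) (auto elim: eventually_elim2)
qed (simp_all add: Linf_def)

lemma cring_Linf: "cring (Linf M)"
proof (rule cringI)
  show "abelian_group (Linf M)"
  proof (rule abelian_groupI)
    fix F assume "F \<in> carrier (Linf M)"
    then obtain f where f: "f \<in> Linf_fun M" "F = Linf_class M f" by (rule carrier_LinfE)
    have "(\<lambda>x. - 1 * f x) \<in> Linf_fun M" using f by (intro Linf_fun_closed Linf_fun_const)
    then show "\<exists>G\<in>carrier (Linf M). G \<oplus>\<^bsub>Linf M\<^esub> F = \<zero>\<^bsub>Linf M\<^esub>"
      using f by (intro bexI[of _ "Linf_class M (\<lambda>x. - 1 * f x)"])
        (simp_all add: Linf_ops Linf_class_in_carrier)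
  qed (auto elim!: carrier_LinfE simp: Linf_ops Linf_class_in_carrier Linf_fun_closed Linf_fun_const add_ac)
  show "comm_monoid (Linf M)"
    by (rule comm_monoidI) (auto elim!: carrier_LinfE
      simp: Linf_ops Linf_class_in_carrier Linf_fun_closed Linf_fun_const mult_ac)
qed (auto elim!: carrier_LinfE simp: Linf_ops Linf_class_in_carrier Linf_fun_closed distrib_right)

section \<open>The module of sections\<close>

locale Lp_bundle =
  fixes M :: "'x measure" and E :: "'x \<Rightarrow> 'b::{banach, second_countable_topology} set" and p :: real
  assumes is_bundle: "Banach_bundle M E" and p: "1 < p"
begin

abbreviation "L \<equiv> Lp_sections M E p"
abbreviation "\<Gamma> \<equiv> Gamma_module M E p"
abbreviation "cls \<equiv> Gamma_class M E p"
abbreviation nrm :: "('x \<Rightarrow> 'b) \<Rightarrow> real" where "nrm \<equiv> Lp_map_norm M p"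

lemma subspace_E: "x \<in> space M \<Longrightarrow> subspace (E x)" and closed_E: "x \<in> space M \<Longrightarrow> closed (E x)"
  using is_bundle by (auto simp: Banach_bundle_def)

lemma LpD:
  assumes "v \<in> L"
  shows "v \<in> Lp_maps M p" "x \<in> space M \<Longrightarrow> v x \<in> E x" "v \<in> borel_measurable M"
  using assms by (auto simp: Lp_sections_eq Lp_maps_def)

lemma sections_closed:
  assumes "v \<in> L" "w \<in> L"
  shows "(\<lambda>x. v x + w x) \<in> L" "(\<lambda>x. v x - w x) \<in> L"
  using assms p subspace_E
  by (auto simp: Lp_sections_eq Lp_maps_add Lp_maps_diff subspace_add subspace_diff)

lemma sections_closed_scaleR: "v \<in> L \<Longrightarrow> (\<lambda>x. c *\<^sub>R v x) \<in> L"
  using p subspace_E by (auto simp: Lp_sections_eq Lp_maps_scaleR_const subspace_scale)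

lemma zero_in_L: "(\<lambda>_. 0) \<in> L"
  using subspace_E by (auto simp: Lp_sections_eq Lp_maps_zero subspace_0)

lemma sections_closed_Linf:
  assumes "f \<in> Linf_fun M" "v \<in> L"
  shows "(\<lambda>x. f x *\<^sub>R v x) \<in> L"
  using assms p subspace_E
  by (auto simp: Lp_sections_eq Linf_fun_def intro!: Lp_maps_scaleR subspace_scale)

lemma carrier_\<Gamma>E:
  assumes "V \<in> carrier \<Gamma>"
  obtains v where "v \<in> L" "V = cls v"
  using assms by (auto simp: Gamma_module_def elim: quotientE)

lemma cls_in_carrier: "v \<in> L \<Longrightarrow> cls v \<in> carrier \<Gamma>"
  by (simp add: Gamma_module_def quotientI)

lemma \<Gamma>_add: "\<lbrakk>v \<in> L; w \<in> L\<rbrakk> \<Longrightarrow> cls v \<oplus>\<^bsub>\<Gamma>\<^esub> cls w = cls (\<lambda>x. v x + w x)"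
  unfolding Gamma_module_def ring.simps
  by (rule UN2_ae_class[where h = "\<lambda>f g x. f x + g x"]) (auto simp: sections_closed elim: eventually_elim2)

lemma \<Gamma>_smult: "\<lbrakk>f \<in> Linf_fun M; v \<in> L\<rbrakk> \<Longrightarrow> Linf_class M f \<odot>\<^bsub>\<Gamma>\<^esub> cls v = cls (\<lambda>x. f x *\<^sub>R v x)"
  unfolding Gamma_module_def module.simps
  by (rule UN2_ae_class[where h = "\<lambda>f g x. f x *\<^sub>R g x"]) (auto simp: sections_closed_Linf elim: eventually_elim2)

lemma \<Gamma>_zero: "\<zero>\<^bsub>\<Gamma>\<^esub> = cls (\<lambda>_. 0)"
  by (simp add: Gamma_module_def)

lemma \<Gamma>_scale: "v \<in> L \<Longrightarrow> module_scale M \<Gamma> c (cls v) = cls (\<lambda>x. c *\<^sub>R v x)"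
  by (simp add: module_scale_def \<Gamma>_smult Linf_fun_const)

lemma abelian_group_\<Gamma>: "abelian_group \<Gamma>"
proof (rule abelian_groupI)
  fix V assume "V \<in> carrier \<Gamma>"
  then obtain v where v: "v \<in> L" "V = cls v" by (rule carrier_\<Gamma>E)
  then have "(\<lambda>x. (-1) *\<^sub>R v x) \<in> L" by (intro sections_closed_scaleR)
  then show "\<exists>W\<in>carrier \<Gamma>. W \<oplus>\<^bsub>\<Gamma>\<^esub> V = \<zero>\<^bsub>\<Gamma>\<^esub>"
    using v by (intro bexI[of _ "cls (\<lambda>x. (-1) *\<^sub>R v x)"]) (simp_all add: \<Gamma>_add \<Gamma>_zero cls_in_carrier)
qed (auto elim!: carrier_\<Gamma>E simp: \<Gamma>_add \<Gamma>_zero cls_in_carrier sections_closed zero_in_L add_ac)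

lemma \<Gamma>_minus: "\<lbrakk>v \<in> L; w \<in> L\<rbrakk> \<Longrightarrow> cls v \<ominus>\<^bsub>\<Gamma>\<^esub> cls w = cls (\<lambda>x. v x - w x)"
proof -
  assume v: "v \<in> L" and w: "w \<in> L"
  have m: "(\<lambda>x. (-1) *\<^sub>R w x) \<in> L" using w by (rule sections_closed_scaleR)
  have "\<ominus>\<^bsub>\<Gamma>\<^esub> cls w = cls (\<lambda>x. (-1) *\<^sub>R w x)"
    using w m by (intro abelian_group.minus_equality[OF abelian_group_\<Gamma>]) (simp_all add: \<Gamma>_add \<Gamma>_zero cls_in_carrier)
  then show ?thesis using \<Gamma>_add[OF v m] by (simp add: a_minus_def)
qed

text \<open>
  The module laws hold for the representatives pointwise, before passing to classes.
\<close>

lemma module_\<Gamma>: "Module.module (Linf M) \<Gamma>"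
proof (rule Module.moduleI)
  show "cring (Linf M)" by (rule cring_Linf)
  show "abelian_group \<Gamma>" by (rule abelian_group_\<Gamma>)
qed (auto elim!: carrier_\<Gamma>E carrier_LinfE simp: \<Gamma>_add \<Gamma>_smult Linf_ops cls_in_carrier sections_closed
      sections_closed_Linf Linf_fun_closed Linf_fun_const scaleR_add_left scaleR_add_right)

lemma pnorm_cls:
  assumes "v \<in> L"
  shows "pnorm \<Gamma> (cls v) \<in> Lp_fun M p" "AE x in M. pnorm \<Gamma> (cls v) x = norm (v x)"
proof -
  define w where "w = (SOME w. w \<in> cls v)"
  have "w \<in> cls v" unfolding w_def by (rule someI[of _ v]) (simp add: ae_rel_iff assms)
  then have w: "w \<in> L" "AE x in M. v x = w x" by (auto simp: ae_rel_iff)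
  have e: "pnorm \<Gamma> (cls v) = (\<lambda>x. norm (w x))" by (simp add: Gamma_module_def w_def)
  show "pnorm \<Gamma> (cls v) \<in> Lp_fun M p" unfolding e using w(1) by (simp add: Lp_sections_def)
  show "AE x in M. pnorm \<Gamma> (cls v) x = norm (v x)" using w(2) by (auto simp: e elim: eventually_mono)
qed

lemma module_norm_cls: "v \<in> L \<Longrightarrow> module_norm M p \<Gamma> (cls v) = nrm v"
proof -
  assume v: "v \<in> L"
  note n = pnorm_cls[OF v]
  have "(\<integral>x. \<bar>pnorm \<Gamma> (cls v) x\<bar> powr p \<partial>M) = (\<integral>x. norm (v x) powr p \<partial>M)"
    using n LpD(3)[OF v] by (intro integral_cong_AE) (auto simp: Lp_fun_def elim: eventually_mono)
  then show ?thesis by (simp add: module_norm_def Lp_norm_def Lp_map_norm_eq)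
qed

text \<open>
  That the sections form a Banach module is what allows a gauge for all such modules to be
  applied to them.
\<close>

lemma Lp_Banach_module_\<Gamma>: "Lp_Banach_module M p \<Gamma>"
  unfolding Lp_Banach_module_def Lp_normed_module_def
proof (intro conjI ballI allI impI)
  show "Module.module (Linf M) \<Gamma>" by (rule module_\<Gamma>)
next
  fix V assume "V \<in> carrier \<Gamma>"
  then obtain v where v: "v \<in> L" "V = cls v" by (rule carrier_\<Gamma>E)
  note n = pnorm_cls[OF v(1)]
  show "pnorm \<Gamma> V \<in> Lp_fun M p" using n v by simp
  show "AE x in M. 0 \<le> pnorm \<Gamma> V x" using n(2) v by (auto elim: eventually_mono)
  have "(AE x in M. pnorm \<Gamma> V x = 0) \<longleftrightarrow> (AE x in M. v x = 0)"
    unfolding v(2)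
  proof
    assume "AE x in M. pnorm \<Gamma> (cls v) x = 0"
    with n(2) show "AE x in M. v x = 0" by eventually_elim simp
  next
    assume "AE x in M. v x = 0"
    with n(2) show "AE x in M. pnorm \<Gamma> (cls v) x = 0" by eventually_elim simp
  qed
  then show "(AE x in M. pnorm \<Gamma> V x = 0) \<longleftrightarrow> V = \<zero>\<^bsub>\<Gamma>\<^esub>"
    unfolding v(2) \<Gamma>_zero using ae_class_eq_iff[OF v(1) zero_in_L] by simp
next
  fix V W assume "V \<in> carrier \<Gamma>" "W \<in> carrier \<Gamma>"
  then obtain v w where v: "v \<in> L" "V = cls v" and w: "w \<in> L" "W = cls w" by (metis carrier_\<Gamma>E)
  show "AE x in M. pnorm \<Gamma> (V \<oplus>\<^bsub>\<Gamma>\<^esub> W) x \<le> pnorm \<Gamma> V x + pnorm \<Gamma> W x"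
    unfolding v(2) w(2) \<Gamma>_add[OF v(1) w(1)]
    using pnorm_cls(2)[OF v(1)] pnorm_cls(2)[OF w(1)] pnorm_cls(2)[OF sections_closed(1)[OF v(1) w(1)]]
    by eventually_elim (simp add: norm_triangle_ineq)
next
  fix F f V assume "F \<in> carrier (Linf M)" "f \<in> F" "V \<in> carrier \<Gamma>"
  then obtain g v where g: "g \<in> Linf_fun M" "F = Linf_class M g" and v: "v \<in> L" "V = cls v"
    by (metis carrier_\<Gamma>E carrier_LinfE)
  have "f \<in> Linf_class M g" using \<open>f \<in> F\<close> g by simp
  then have f: "AE x in M. g x = f x" by (simp add: ae_rel_iff)
  show "AE x in M. pnorm \<Gamma> (F \<odot>\<^bsub>\<Gamma>\<^esub> V) x = \<bar>f x\<bar> * pnorm \<Gamma> V x"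
    unfolding v(2) g(2) \<Gamma>_smult[OF g(1) v(1)]
    using f pnorm_cls(2)[OF v(1)] pnorm_cls(2)[OF sections_closed_Linf[OF g(1) v(1)]]
    by eventually_elim simp
next
  fix \<sigma> :: "nat \<Rightarrow> ('x \<Rightarrow> 'b) set"
  assume \<sigma>: "(\<forall>n. \<sigma> n \<in> carrier \<Gamma>) \<and>
    (\<forall>e>0. \<exists>N. \<forall>m\<ge>N. \<forall>n\<ge>N. module_norm M p \<Gamma> (\<sigma> m \<ominus>\<^bsub>\<Gamma>\<^esub> \<sigma> n) < e)"
  then have "\<forall>n. \<exists>v. v \<in> L \<and> \<sigma> n = cls v" by (metis carrier_\<Gamma>E)
  then obtain s where s: "\<And>n. s n \<in> L" "\<And>n. \<sigma> n = cls (s n)" by metis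
  have n: "module_norm M p \<Gamma> (\<sigma> m \<ominus>\<^bsub>\<Gamma>\<^esub> cls w) = nrm (\<lambda>x. s m x - w x)" if "w \<in> L" for m w
    unfolding s(2) \<Gamma>_minus[OF s(1) that] by (rule module_norm_cls[OF sections_closed(2)[OF s(1) that]])
  obtain l where l: "l \<in> Lp_maps M p" "(\<lambda>n. nrm (\<lambda>x. s n x - l x)) \<longlonglongrightarrow> 0"
    "\<And>x. l x = 0 \<or> (\<exists>r. (\<lambda>k. s (r k) x) \<longlonglongrightarrow> l x)"
  proof (rule Lp_complete)
    show "s n \<in> Lp_maps M p" for n using s(1) by (rule LpD)
    show "\<exists>N. \<forall>m\<ge>N. \<forall>n\<ge>N. nrm (\<lambda>x. s m x - s n x) < e" if "0 < e" for e
      using \<sigma> that n[OF s(1)] unfolding s(2)[symmetric] by simp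
  qed (use p in auto)
  have "l x \<in> E x" if x: "x \<in> space M" for x
    using l(3)[of x] subspace_0[OF subspace_E[OF x]] closed_sequentially[OF closed_E[OF x]] LpD(2)[OF s(1) x] by metis
  then have "l \<in> L" using l(1) by (simp add: Lp_sections_eq)
  then show "\<exists>V\<in>carrier \<Gamma>. (\<lambda>n. module_norm M p \<Gamma> (\<sigma> n \<ominus>\<^bsub>\<Gamma>\<^esub> V)) \<longlonglongrightarrow> 0"
    using l(2) n by (intro bexI[of _ "cls l"]) (simp_all add: cls_in_carrier)
qed

lemma \<Gamma>_norms:
  assumes "v \<in> L" "w \<in> L"
  shows "vnorm (module_space M p \<Gamma>) (cls v) = nrm v"
    "vnorm (module_space M p \<Gamma>) (vadd (module_space M p \<Gamma>) (cls v) (vscale (module_space M p \<Gamma>) (-1) (cls w)))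
      = nrm (\<lambda>x. v x - w x)"
    "vnorm (module_space M p \<Gamma>) (vscale (module_space M p \<Gamma>) (1/2) (vadd (module_space M p \<Gamma>) (cls v) (cls w)))
      = nrm (\<lambda>x. v x + w x) / 2"
proof -
  have m: "(\<lambda>x. (-1) *\<^sub>R w x) \<in> L" using assms(2) by (rule sections_closed_scaleR)
  have a: "(\<lambda>x. v x + w x) \<in> L" using assms by (rule sections_closed)
  show "vnorm (module_space M p \<Gamma>) (cls v) = nrm v"
    using assms by (simp add: module_space_def module_norm_cls)
  show "vnorm (module_space M p \<Gamma>) (vadd (module_space M p \<Gamma>) (cls v) (vscale (module_space M p \<Gamma>) (-1) (cls w)))
      = nrm (\<lambda>x. v x - w x)"
    using module_norm_cls[OF sections_closed(1)[OF assms(1) m]]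
    by (simp only: module_space_def normed_space.simps \<Gamma>_scale[OF assms(2)] \<Gamma>_add[OF assms(1) m]) simp
  show "vnorm (module_space M p \<Gamma>) (vscale (module_space M p \<Gamma>) (1/2) (vadd (module_space M p \<Gamma>) (cls v) (cls w)))
      = nrm (\<lambda>x. v x + w x) / 2"
    using module_norm_cls[OF sections_closed_scaleR[OF a, of "1/2"]] p
    by (simp add: module_space_def \<Gamma>_scale[OF a] \<Gamma>_add[OF assms] Lp_map_norm_scaleR)
qed

text \<open>
  From here on the space of sections is handled through representatives.
\<close>

lemma modulus_\<Gamma>:
  shows "\<lbrakk>v \<in> L; w \<in> L; nrm v = 1; nrm w = 1; \<epsilon> \<le> nrm (\<lambda>x. v x - w x)\<rbrakk> \<Longrightarrow>
           modulus (module_space M p \<Gamma>) \<epsilon> \<le> 1 - nrm (\<lambda>x. v x + w x) / 2" (is "PROP ?a")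
    and "0 \<le> modulus (module_space M p \<Gamma>) \<epsilon>" (is ?b) and "modulus (module_space M p \<Gamma>) \<epsilon> \<le> 1" (is ?c)
proof -
  define S where "S = {1 - nrm (\<lambda>x. v x + w x) / 2 | v w. v \<in> L \<and> w \<in> L \<and> nrm v = 1 \<and>
    nrm w = 1 \<and> \<epsilon> \<le> nrm (\<lambda>x. v x - w x)}"
  have m: "modulus (module_space M p \<Gamma>) \<epsilon> = Inf (insert 1 S)"
  proof -
    let ?B = "module_space M p \<Gamma>"
    have "{1 - vnorm ?B (vscale ?B (1/2) (vadd ?B v w)) | v w.
        v \<in> vecs ?B \<and> w \<in> vecs ?B \<and> vnorm ?B v = 1 \<and> vnorm ?B w = 1 \<and>
        vnorm ?B (vadd ?B v (vscale ?B (-1) w)) \<ge> \<epsilon>} = S" (is "?T = S")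
    proof (intro equalityI subsetI)
      fix z assume "z \<in> ?T"
      then obtain V W where z: "z = 1 - vnorm ?B (vscale ?B (1/2) (vadd ?B V W))"
        "V \<in> carrier \<Gamma>" "W \<in> carrier \<Gamma>" "vnorm ?B V = 1" "vnorm ?B W = 1"
        "vnorm ?B (vadd ?B V (vscale ?B (-1) W)) \<ge> \<epsilon>"
        by (auto simp: module_space_def)
      obtain v w where v: "v \<in> L" "V = cls v" and w: "w \<in> L" "W = cls w" using z(2,3) by (metis carrier_\<Gamma>E)
      show "z \<in> S" using z \<Gamma>_norms[OF v(1) w(1)] \<Gamma>_norms[OF w(1) w(1)] v w unfolding S_def by auto
    next
      fix z assume "z \<in> S"
      then obtain v w where z: "z = 1 - nrm (\<lambda>x. v x + w x) / 2" "v \<in> L" "w \<in> L"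
        "nrm v = 1" "nrm w = 1" "\<epsilon> \<le> nrm (\<lambda>x. v x - w x)" by (auto simp: S_def)
      have "cls v \<in> vecs ?B" "cls w \<in> vecs ?B" using z by (auto simp: module_space_def cls_in_carrier)
      then show "z \<in> ?T" using z \<Gamma>_norms[OF z(2,3)] \<Gamma>_norms[OF z(3,3)] by (intro CollectI exI[of _ "cls v"] exI[of _ "cls w"]) auto
    qed
    then show ?thesis by (simp add: modulus_def)
  qed
  have low: "0 \<le> z" if z: "z \<in> insert 1 S" for z
    using z p by (auto simp: S_def dest!: LpD(1) dest: Minkowski[of _ M p])
  then have "bdd_below (insert 1 S)" by (rule bdd_belowI)
  then have le: "modulus (module_space M p \<Gamma>) \<epsilon> \<le> z" if "z \<in> insert 1 S" for z
    unfolding m using that by (intro cInf_lower) auto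
  show ?c using le by simp
  show ?b unfolding m using low by (intro cInf_greatest) auto
  show "PROP ?a"
  proof -
    assume "v \<in> L" "w \<in> L" "nrm v = 1" "nrm w = 1" "\<epsilon> \<le> nrm (\<lambda>x. v x - w x)"
    then have "1 - nrm (\<lambda>x. v x + w x) / 2 \<in> S" unfolding S_def by blast
    then show "modulus (module_space M p \<Gamma>) \<epsilon> \<le> 1 - nrm (\<lambda>x. v x + w x) / 2" using le by blast
  qed
qed

lemma modulus_\<Gamma>_greatest:
  assumes "c \<le> 1" "\<And>v w. \<lbrakk>v \<in> L; w \<in> L; nrm v = 1; nrm w = 1;
      \<epsilon> \<le> nrm (\<lambda>x. v x - w x)\<rbrakk> \<Longrightarrow> c \<le> 1 - nrm (\<lambda>x. v x + w x) / 2"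
  shows "c \<le> modulus (module_space M p \<Gamma>) \<epsilon>"
proof (rule modulus_greatest[OF assms(1)])
  let ?B = "module_space M p \<Gamma>"
  fix V W assume z: "V \<in> vecs ?B" "W \<in> vecs ?B" "vnorm ?B V = 1" "vnorm ?B W = 1"
        "vnorm ?B (vadd ?B V (vscale ?B (-1) W)) \<ge> \<epsilon>"
  have "vecs ?B = carrier \<Gamma>" by (simp add: module_space_def)
  then obtain v w where v: "v \<in> L" "V = cls v" and w: "w \<in> L" "W = cls w" using z(1,2) by (metis carrier_\<Gamma>E)
  show "c \<le> 1 - vnorm ?B (vscale ?B (1/2) (vadd ?B V W))"
    using assms(2)[OF v(1) w(1)] z \<Gamma>_norms[OF v(1) w(1)] \<Gamma>_norms[OF w(1) w(1)] v w by simp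
qed

end

section \<open>The pointwise modulus\<close>

lemma ess_Inf_AE_eq:
  assumes "is_ess_Inf M F g"
  shows "AE x in M. ess_Inf M F x = g x"
proof -
  have e: "is_ess_Inf M F (ess_Inf M F)" unfolding ess_Inf_def by (rule someI[of "is_ess_Inf M F", OF assms])
  have "AE x in M. ess_Inf M F x \<le> g x" "AE x in M. g x \<le> ess_Inf M F x"
    using e assms by (auto simp: is_ess_Inf_def)
  then show ?thesis by eventually_elim simp
qed

context Lp_bundle
begin

text \<open>
  The sections at hand are only bounded; cutting them off to a set of finite measure makes
  them integrable.
\<close>

lemma bounded_section_on_finite_set:
  assumes "u \<in> sections M E" "C \<in> sets M" "emeasure M C < \<infinity>" "\<And>x. x \<in> C \<Longrightarrow> norm (u x) \<le> K"
  shows "(\<lambda>x. indicator C x *\<^sub>R u x) \<in> L"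
proof -
  have [measurable]: "u \<in> borel_measurable M" "C \<in> sets M" using assms by (auto simp: sections_eq)
  have "(\<lambda>x. indicator C x *\<^sub>R u x) \<in> Lp_maps M p"
  proof (rule Lp_maps_dominated[where w = "indicat_real C" and C = "\<bar>K\<bar>"])
    show "indicat_real C \<in> Lp_maps M p"
    proof -
      have "(\<lambda>x. norm (indicat_real C x) powr p) = indicat_real C" by (auto simp: indicator_def)
      then show ?thesis using assms by (simp add: Lp_maps_def)
    qed
    show "AE x in M. norm (indicat_real C x *\<^sub>R u x) \<le> \<bar>K\<bar> * norm (indicat_real C x)"
      using assms(4) by (intro always_eventually allI) (force simp: indicator_def)
  qed (use p in auto)
  then show ?thesis using assms(1) subspace_E by (auto simp: Lp_sections_eq sections_eq subspace_scale)
qed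

definition "pw_family \<epsilon> =
     {\<lambda>x. 1 - indicator A x * pnorm \<Gamma> (module_scale M \<Gamma> (1/2) (V \<oplus>\<^bsub>\<Gamma>\<^esub> W)) x | V W A.
        V \<in> carrier \<Gamma> \<and> W \<in> carrier \<Gamma> \<and> A \<in> sets M \<and>
        (AE x in M. x \<in> A \<longrightarrow>
           pnorm \<Gamma> V x = 1 \<and> pnorm \<Gamma> W x = 1 \<and> pnorm \<Gamma> (V \<ominus>\<^bsub>\<Gamma>\<^esub> W) x > \<epsilon>)}"

lemma pnorm_ops:
  assumes "v \<in> L" "w \<in> L"
  shows "AE x in M. pnorm \<Gamma> (cls v) x = norm (v x) \<and> pnorm \<Gamma> (cls w) x = norm (w x) \<and>
    pnorm \<Gamma> (cls v \<ominus>\<^bsub>\<Gamma>\<^esub> cls w) x = norm (v x - w x) \<and>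
    pnorm \<Gamma> (module_scale M \<Gamma> (1/2) (cls v \<oplus>\<^bsub>\<Gamma>\<^esub> cls w)) x = norm (v x + w x) / 2"
proof -
  note s = sections_closed[OF assms]
  show ?thesis
    unfolding \<Gamma>_minus[OF assms] \<Gamma>_add[OF assms] \<Gamma>_scale[OF s(1)]
    using pnorm_cls(2)[OF assms(1)] pnorm_cls(2)[OF assms(2)] pnorm_cls(2)[OF s(2)]
      pnorm_cls(2)[OF sections_closed_scaleR[OF s(1), of "1/2"]]
    by eventually_elim simp
qed

lemma pw_familyE:
  assumes "f \<in> pw_family \<epsilon>"
  obtains v w A where "v \<in> L" "w \<in> L" "A \<in> sets M"
    "AE x in M. x \<in> A \<longrightarrow> norm (v x) = 1 \<and> norm (w x) = 1 \<and> \<epsilon> < norm (v x - w x)"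
    "AE x in M. f x = 1 - indicator A x * (norm (v x + w x) / 2)"
proof -
  obtain V W A where f: "f = (\<lambda>x. 1 - indicator A x * pnorm \<Gamma> (module_scale M \<Gamma> (1/2) (V \<oplus>\<^bsub>\<Gamma>\<^esub> W)) x)"
    "V \<in> carrier \<Gamma>" "W \<in> carrier \<Gamma>" "A \<in> sets M" and A: "AE x in M. x \<in> A \<longrightarrow>
           pnorm \<Gamma> V x = 1 \<and> pnorm \<Gamma> W x = 1 \<and> pnorm \<Gamma> (V \<ominus>\<^bsub>\<Gamma>\<^esub> W) x > \<epsilon>"
    using assms unfolding pw_family_def by blast
  obtain v w where v: "v \<in> L" "V = cls v" and w: "w \<in> L" "W = cls w" using f(2,3) by (metis carrier_\<Gamma>E)
  show thesis
  proof (rule that[OF v(1) w(1) f(4)])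
    show "AE x in M. x \<in> A \<longrightarrow> norm (v x) = 1 \<and> norm (w x) = 1 \<and> \<epsilon> < norm (v x - w x)"
      using pnorm_ops[OF v(1) w(1)] A unfolding v(2) w(2) by eventually_elim auto
    show "AE x in M. f x = 1 - indicator A x * (norm (v x + w x) / 2)"
      using pnorm_ops[OF v(1) w(1)] unfolding f(1) v(2) w(2) by eventually_elim auto
  qed
qed

lemma pw_familyI:
  assumes "v \<in> L" "w \<in> L" "A \<in> sets M"
    "AE x in M. x \<in> A \<longrightarrow> norm (v x) = 1 \<and> norm (w x) = 1 \<and> \<epsilon> < norm (v x - w x)"
  shows "\<exists>f\<in>pw_family \<epsilon>. AE x in M. f x = 1 - indicator A x * (norm (v x + w x) / 2)"
proof -
  define f where "f = (\<lambda>x. 1 - indicator A x * pnorm \<Gamma> (module_scale M \<Gamma> (1/2) (cls v \<oplus>\<^bsub>\<Gamma>\<^esub> cls w)) x)"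
  have A: "AE x in M. x \<in> A \<longrightarrow> pnorm \<Gamma> (cls v) x = 1 \<and> pnorm \<Gamma> (cls w) x = 1 \<and> pnorm \<Gamma> (cls v \<ominus>\<^bsub>\<Gamma>\<^esub> cls w) x > \<epsilon>"
    using pnorm_ops[OF assms(1,2)] assms(4) by eventually_elim auto
  have "f \<in> pw_family \<epsilon>"
    unfolding pw_family_def f_def
    by (intro CollectI exI conjI) (rule refl cls_in_carrier[OF assms(1)] cls_in_carrier[OF assms(2)] assms(3) A)+
  moreover have "AE x in M. f x = 1 - indicator A x * (norm (v x + w x) / 2)"
    using pnorm_ops[OF assms(1,2)] unfolding f_def by eventually_elim auto
  ultimately show ?thesis by blast
qed

text \<open>
  The fibre modulus is a lower bound of the family, point by point, and it is measurable. It
  is the greatest one, because normalised dense sections, cut off to sets of finite measure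
  that exhaust the space, are admissible where they are more than \<open>\<epsilon>\<close> apart, and their pairs
  already compute the fibre modulus.
\<close>

lemma pointwise_modulus_eq:
  assumes "sigma_finite_measure M" "0 < \<epsilon>" "\<epsilon> < 2"
  shows "AE x in M. pointwise_modulus M \<Gamma> \<epsilon> x = modulus (subspace_of (E x)) \<epsilon>"
  unfolding pointwise_modulus_def pw_family_def[symmetric]
proof (rule ess_Inf_AE_eq, unfold is_ess_Inf_def, intro conjI ballI impI)
  show "(\<lambda>x. modulus (subspace_of (E x)) \<epsilon>) \<in> borel_measurable M"
    using is_bundle assms by (intro borel_measurable_modulus)
next
  fix f assume "f \<in> pw_family \<epsilon>"
  then obtain v w A where v: "v \<in> L" "w \<in> L"
    and A: "AE x in M. x \<in> A \<longrightarrow> norm (v x) = 1 \<and> norm (w x) = 1 \<and> \<epsilon> < norm (v x - w x)"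
    and f: "AE x in M. f x = 1 - indicator A x * (norm (v x + w x) / 2)" by (rule pw_familyE)
  show "AE x in M. modulus (subspace_of (E x)) \<epsilon> \<le> f x"
    using A f AE_space
  proof eventually_elim
    case (elim x)
    then show ?case using modulus_subspace(1)[of "v x" "E x" "w x" \<epsilon>] modulus_subspace(3)[of "E x" \<epsilon>]
        LpD(2)[OF v(1)] LpD(2)[OF v(2)] by (auto simp: indicator_def)
  qed
next
  fix h assume h: "h \<in> borel_measurable M" "\<forall>f\<in>pw_family \<epsilon>. AE x in M. h x \<le> f x"
  obtain u :: "nat \<Rightarrow> 'x \<Rightarrow> 'b" where u: "\<And>n. u n \<in> sections M E" "\<And>n x. norm (u n x) \<le> 1"
    "\<And>x e \<eta>. \<lbrakk>x \<in> space M; e \<in> E x; norm e = 1; 0 < \<eta>\<rbrakk> \<Longrightarrow> \<exists>n. norm (u n x) = 1 \<and> norm (u n x - e) < \<eta>"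
    using dense_units[OF is_bundle] by metis
  have um [measurable]: "u n \<in> borel_measurable M" for n using u(1) by (simp add: sections_eq)
  obtain C :: "nat \<Rightarrow> 'x set" where C: "range C \<subseteq> sets M" "(\<Union>k. C k) = space M" "\<And>k. emeasure M (C k) \<noteq> \<infinity>"
    using sigma_finite_measure.sigma_finite[OF assms(1)] by metis
  have [measurable]: "C k \<in> sets M" for k using C(1) by auto
  define P where "P i j x \<longleftrightarrow> norm (u i x) = 1 \<and> norm (u j x) = 1 \<and> \<epsilon> < norm (u i x - u j x)" for i j x
  have "AE x in M. x \<in> C k \<longrightarrow> P i j x \<longrightarrow> h x \<le> 1 - norm (u i x + u j x) / 2" for i j k
  proof -
    define A where "A = {x \<in> space M. x \<in> C k \<and> P i j x}"
    have "A \<in> sets M" unfolding A_def P_def by measurable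
    have c: "(\<lambda>x. indicator (C k) x *\<^sub>R u n x) \<in> L" for n
      using C u by (intro bounded_section_on_finite_set[where K = 1]) (auto simp: less_top)
    have "AE x in M. x \<in> A \<longrightarrow> norm (indicator (C k) x *\<^sub>R u i x) = 1 \<and> norm (indicator (C k) x *\<^sub>R u j x) = 1 \<and>
        \<epsilon> < norm (indicator (C k) x *\<^sub>R u i x - indicator (C k) x *\<^sub>R u j x)"
      by (intro always_eventually) (auto simp: A_def P_def)
    from pw_familyI[OF c c \<open>A \<in> sets M\<close> this] obtain f where f: "f \<in> pw_family \<epsilon>"
      "AE x in M. f x = 1 - indicator A x * (norm (indicator (C k) x *\<^sub>R u i x + indicator (C k) x *\<^sub>R u j x) / 2)" by blast
    have "AE x in M. h x \<le> f x" using h(2) f(1) by blast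
    then show ?thesis using f(2) AE_space by eventually_elim (auto simp: A_def)
  qed
  then have "AE x in M. \<forall>i j k. x \<in> C k \<longrightarrow> P i j x \<longrightarrow> h x \<le> 1 - norm (u i x + u j x) / 2"
    unfolding AE_all_countable by blast
  moreover have "AE x in M. h x \<le> 1"
  proof -
    obtain f where f: "f \<in> pw_family \<epsilon>" "AE x in M. f x = 1 - indicator {} x * (norm ((0::'b) + 0) / 2)"
      using pw_familyI[OF zero_in_L zero_in_L, of "{}" \<epsilon>] by auto
    have "AE x in M. h x \<le> f x" using h(2) f(1) by blast
    then show ?thesis using f(2) by eventually_elim simp
  qed
  ultimately show "AE x in M. h x \<le> modulus (subspace_of (E x)) \<epsilon>"
    using AE_space
  proof eventually_elim
    case (elim x)
    obtain k where k: "x \<in> C k" using C(2) elim by blast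
    have "modulus (subspace_of (E x)) \<epsilon> = (INF (i, j). if norm (u i x) = 1 \<and> norm (u j x) = 1 \<and> \<epsilon> < norm (u i x - u j x)
      then 1 - norm (u i x + u j x) / 2 else 1)"
      using elim assms u by (intro modulus_subspace_eq_INF) (auto simp: subspace_E sections_eq)
    also have "h x \<le> \<dots>" using elim k by (intro cINF_greatest) (auto simp: P_def split: prod.split)
    finally show ?case .
  qed
qed

text \<open>
  Unit vectors are never more than 2 apart, so only null sets are admissible.
\<close>

lemma pointwise_modulus_2: "AE x in M. pointwise_modulus M \<Gamma> 2 x = 1"
  unfolding pointwise_modulus_def pw_family_def[symmetric]
proof (rule ess_Inf_AE_eq, unfold is_ess_Inf_def, intro conjI ballI impI)
  fix f assume "f \<in> pw_family 2"
  then obtain v w A where "v \<in> L" "w \<in> L" "A \<in> sets M"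
    and A: "AE x in M. x \<in> A \<longrightarrow> norm (v x) = 1 \<and> norm (w x) = 1 \<and> 2 < norm (v x - w x)"
    and f: "AE x in M. f x = 1 - indicator A x * (norm (v x + w x) / 2)" by (rule pw_familyE)
  show "AE x in M. 1 \<le> f x"
    using A f
  proof eventually_elim
    case (elim x)
    then show ?case using norm_triangle_ineq4[of "v x" "w x"] by (auto simp: indicator_def)
  qed
next
  fix h assume h: "h \<in> borel_measurable M" "\<forall>f\<in>pw_family 2. AE x in M. h x \<le> f x"
  obtain f where f: "f \<in> pw_family 2" "AE x in M. f x = 1 - indicator {} x * (norm ((0::'b) + 0) / 2)"
    using pw_familyI[OF zero_in_L zero_in_L, of "{}" 2] by auto
  have "AE x in M. h x \<le> f x" using h(2) f(1) by blast
  then show "AE x in M. h x \<le> 1" using f(2) by eventually_elim simp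
qed simp

end

lemma strictly_convex_modulus_2:
  fixes V :: "'b::real_normed_vector set"
  assumes "strictly_convex (subspace_of V)" "subspace V"
  shows "modulus (subspace_of V) 2 = 1"
proof (rule antisym[OF modulus_subspace(3) modulus_subspace_greatest])
  fix v w assume vw: "v \<in> V" "w \<in> V" "norm v = 1" "norm w = 1" "2 \<le> norm (v - w)"
  have m: "- w \<in> V" using assms(2) vw(2) by (rule subspace_neg)
  have "v = - w"
  proof (rule ccontr)
    assume "v \<noteq> - w"
    moreover have "\<forall>v\<in>V. \<forall>w\<in>V. norm v = 1 \<and> norm w = 1 \<and> v \<noteq> w \<longrightarrow> norm ((1/2) *\<^sub>R (v + w)) < 1"
      using assms(1) by (simp add: strictly_convex_def subspace_of_def)
    ultimately have "norm ((1/2) *\<^sub>R (v + - w)) < 1" using vw m by (metis norm_minus_cancel)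
    then show False using vw by simp
  qed
  then show "1 \<le> 1 - norm (v + w) / 2" by simp
qed simp

section \<open>Selection from a Suslin scheme\<close>

text \<open>
  The set in question is the result of a Suslin operation on measurable sets; in general it is
  only measurable for the completion. If it is not null, one finds a measurable subset of
  positive measure together with measurable branches through the scheme.

  By continuity of the outer measure along increasing sequences one can bound the branches,
  one coordinate after the other, by numbers \<open>N i\<close> so that the outer measure stays above a
  fixed \<open>c > 0\<close>. The tree of bounded branches is finitely branching, so by Koenig's lemma a
  point that belongs to the scheme on arbitrarily long bounded strings belongs to it along an
  infinite branch. Thus the bounded part contains a decreasing intersection of measurable sets
  of measure at least \<open>c\<close>. The leftmost branch is measurable.
\<close>

lemma suslin_selection:
  fixes D :: "nat list \<Rightarrow> 'x set"
  assumes D [measurable]: "\<And>s. D s \<in> sets M" and fin: "emeasure M (D []) \<noteq> \<infinity>"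
    and pos: "0 < outer_measure_of M {x. \<exists>\<sigma>::nat \<Rightarrow> nat. \<forall>k. x \<in> D (map \<sigma> [0..<k])}"
  obtains T and \<tau> :: "nat \<Rightarrow> 'x \<Rightarrow> nat" where "T \<in> sets M" "0 < emeasure M T" "T \<subseteq> D []"
    "\<And>k. \<tau> k \<in> measurable M (count_space UNIV)"
    "\<And>x k. x \<in> T \<Longrightarrow> x \<in> D (map (\<lambda>i. \<tau> i x) [0..<k])"
proof -
  define S where "S b = {x. \<exists>\<sigma>::nat \<Rightarrow> nat. (\<forall>i<length b. \<sigma> i \<le> b ! i) \<and> (\<forall>k. x \<in> D (map \<sigma> [0..<k]))}" for b
  have S_sub: "S b \<subseteq> space M" for b using D[THEN sets.sets_into_space] unfolding S_def by blast
  obtain c where c: "0 < c" "c < outer_measure_of M (S [])"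
    using pos dense unfolding S_def by auto
  have step: "\<exists>n. c < outer_measure_of M (S (b @ [n]))" if "c < outer_measure_of M (S b)" for b
  proof -
    have "S b = (\<Union>n. S (b @ [n]))"
    proof (intro equalityI subsetI)
      fix x assume "x \<in> S b"
      then obtain \<sigma> where "\<forall>i<length b. \<sigma> i \<le> b ! i" "\<forall>k. x \<in> D (map \<sigma> [0..<k])" by (auto simp: S_def)
      then have "x \<in> S (b @ [\<sigma> (length b)])"
        unfolding S_def by (auto simp: nth_append intro!: exI[of _ \<sigma>] dest: less_SucE)
      then show "x \<in> (\<Union>n. S (b @ [n]))" by blast
    next
      fix x assume "x \<in> (\<Union>n. S (b @ [n]))"
      then obtain n \<sigma> where \<sigma>: "\<forall>i<length (b @ [n]). \<sigma> i \<le> (b @ [n]) ! i" "\<forall>k. x \<in> D (map \<sigma> [0..<k])" by (auto simp: S_def)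
      have "\<sigma> i \<le> b ! i" if "i < length b" for i using \<sigma>(1)[rule_format, of i] that by (simp add: nth_append)
      then show "x \<in> S b" using \<sigma>(2) by (auto simp: S_def)
    qed
    moreover have "(SUP n. outer_measure_of M (S (b @ [n]))) = outer_measure_of M (\<Union>n. S (b @ [n]))"
    proof (rule SUP_outer_measure_of_incseq)
      show "incseq (\<lambda>n. S (b @ [n]))"
      proof (rule incseq_SucI)
        fix n
        show "S (b @ [n]) \<subseteq> S (b @ [Suc n])"
        proof
          fix x assume "x \<in> S (b @ [n])"
          then obtain \<sigma> where \<sigma>: "\<forall>i<length (b @ [n]). \<sigma> i \<le> (b @ [n]) ! i" "\<forall>k. x \<in> D (map \<sigma> [0..<k])" by (auto simp: S_def)
          have "\<sigma> i \<le> (b @ [Suc n]) ! i" if "i < length (b @ [Suc n])" for i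
            using \<sigma>(1)[rule_format, of i] that by (auto simp: nth_append split: if_splits)
          then show "x \<in> S (b @ [Suc n])" using \<sigma>(2) unfolding S_def by blast
        qed
      qed
    qed (use S_sub in auto)
    ultimately have "c < (SUP n. outer_measure_of M (S (b @ [n])))" using that by simp
    then show ?thesis by (simp add: less_SUP_iff)
  qed
  have "\<exists>f. \<forall>k. (length (f k) = k \<and> c < outer_measure_of M (S (f k))) \<and> (\<exists>n. f (Suc k) = f k @ [n])"
  proof (rule dependent_nat_choice)
    show "\<exists>b. length b = 0 \<and> c < outer_measure_of M (S b)" using c by auto
  next
    fix b k assume "length b = k \<and> c < outer_measure_of M (S b)"
    then show "\<exists>b'. (length b' = Suc k \<and> c < outer_measure_of M (S b')) \<and> (\<exists>n. b' = b @ [n])"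
      using step[of b] by (metis length_append_singleton)
  qed
  then obtain f where f: "\<And>k. length (f k) = k" "\<And>k. c < outer_measure_of M (S (f k))" "\<And>k. \<exists>n. f (Suc k) = f k @ [n]" by blast
  define N where "N i = f (Suc i) ! i" for i
  have fN: "f k = map N [0..<k]" for k
  proof (induction k)
    case 0 then show ?case using f(1)[of 0] by simp
  next
    case (Suc k)
    obtain n where n: "f (Suc k) = f k @ [n]" using f(3) by blast
    then have "N k = n" using f(1)[of k] by (simp add: N_def nth_append)
    then show ?case using n Suc by simp
  qed
  \<comment> \<open>The string \<open>s\<close> extends to bounded strings of any length along which \<open>x\<close> stays in the scheme.\<close>
  define ext where "ext s x \<longleftrightarrow> (\<forall>k\<ge>length s. \<exists>t. length t = k \<and> (\<forall>i<k. t ! i \<le> N i) \<and> take (length s) t = s \<and>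
      (\<forall>j\<le>k. x \<in> D (take j t)))" for s x
  have ext_meas [measurable]: "Measurable.pred M (ext s)" for s unfolding ext_def by measurable
  have ext_step: "\<exists>n. ext (s @ [n]) x" if "ext s x" for s x
  proof (rule ccontr)
    assume "\<not> ?thesis"
    then have "\<forall>n. \<exists>k\<ge>Suc (length s). \<not> (\<exists>t. length t = k \<and> (\<forall>i<k. t ! i \<le> N i) \<and> take (Suc (length s)) t = s @ [n] \<and>
      (\<forall>j\<le>k. x \<in> D (take j t)))" unfolding ext_def by simp
    then obtain K where K: "\<And>n. Suc (length s) \<le> K n" "\<And>n. \<not> (\<exists>t. length t = K n \<and> (\<forall>i<K n. t ! i \<le> N i) \<and>
        take (Suc (length s)) t = s @ [n] \<and> (\<forall>j\<le>K n. x \<in> D (take j t)))" by metis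
    \<comment> \<open>Any upper bound of the lengths at which the finitely many children of \<open>s\<close> fail will do.\<close>
    define k where "k = (\<Sum>n\<le>N (length s). K n)"
    have Kk: "K n \<le> k" if "n \<le> N (length s)" for n
      unfolding k_def using that by (intro member_le_sum) auto
    have k: "Suc (length s) \<le> k" using K(1)[of 0] Kk[of 0] by simp
    then obtain t where t: "length t = k" "\<forall>i<k. t ! i \<le> N i" "take (length s) t = s" "\<forall>j\<le>k. x \<in> D (take j t)"
      using \<open>ext s x\<close> unfolding ext_def by (metis Suc_leD)
    define n where "n = t ! length s"
    have n: "n \<le> N (length s)" using t k by (simp add: n_def)
    have "take (Suc (length s)) (take (K n) t) = s @ [n]"
      using t k K(1)[of n] by (simp add: take_Suc_conv_app_nth n_def min_def)
    moreover have "length (take (K n) t) = K n" using t Kk[OF n] by simp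
    moreover have "\<forall>i<K n. take (K n) t ! i \<le> N i" using t Kk[OF n] by auto
    moreover have "\<forall>j\<le>K n. x \<in> D (take j (take (K n) t))" using t Kk[OF n] by (auto simp: min_def)
    ultimately show False using K(2)[of n] by blast
  qed
  define s where "s = rec_nat (\<lambda>x. []) (\<lambda>k r x. r x @ [LEAST n. ext (r x @ [n]) x])"
  have s0: "s 0 = (\<lambda>x. [])" and sS: "s (Suc k) = (\<lambda>x. s k x @ [LEAST n. ext (s k x @ [n]) x])" for k
    by (auto simp: s_def)
  define \<tau> where "\<tau> k x = (LEAST n. ext (s k x @ [n]) x)" for k x
  have s\<tau>: "s k x = map (\<lambda>i. \<tau> i x) [0..<k]" for k x by (induction k) (auto simp: s0 sS \<tau>_def)
  have s_meas: "s k \<in> measurable M (count_space UNIV)" for k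
  proof (induction k)
    case (Suc k)
    note [measurable] = Suc
    have "(\<lambda>x. r @ [LEAST n. ext (r @ [n]) x]) \<in> measurable M (count_space UNIV)" for r by measurable
    from measurable_compose_countable[OF this Suc] show ?case unfolding sS .
  qed (simp add: s0)
  have \<tau>_meas: "\<tau> k \<in> measurable M (count_space UNIV)" for k
  proof -
    have "(\<lambda>x. LEAST n. ext (r @ [n]) x) \<in> measurable M (count_space UNIV)" for r by measurable
    from measurable_compose_countable[OF this s_meas] show ?thesis unfolding \<tau>_def .
  qed
  define T where "T = {x \<in> space M. ext [] x}"
  define T' where "T' k = {x \<in> space M. \<exists>t. length t = k \<and> (\<forall>i<k. t ! i \<le> N i) \<and> (\<forall>j\<le>k. x \<in> D (take j t))}" for k
  have T'_meas: "T' k \<in> sets M" for k unfolding T'_def by measurable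
  have T'_dec: "decseq T'"
  proof (rule decseq_SucI)
    fix k show "T' (Suc k) \<subseteq> T' k"
    proof
      fix x assume "x \<in> T' (Suc k)"
      then obtain t where t: "x \<in> space M" "length t = Suc k" "\<forall>i<Suc k. t ! i \<le> N i" "\<forall>j\<le>Suc k. x \<in> D (take j t)" by (auto simp: T'_def)
      then have "length (take k t) = k \<and> (\<forall>i<k. take k t ! i \<le> N i) \<and> (\<forall>j\<le>k. x \<in> D (take j (take k t)))" by (auto simp: min_def)
      then show "x \<in> T' k" using t(1) unfolding T'_def by blast
    qed
  qed
  have T'_sub: "T' k \<subseteq> D []" for k unfolding T'_def by force
  have T_eq: "T = (\<Inter>k. T' k)" by (auto simp: T_def T'_def ext_def)
  have "c \<le> emeasure M (T' k)" for k
  proof -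
    have "S (f k) \<subseteq> T' k"
    proof
      fix x assume x: "x \<in> S (f k)"
      then obtain \<sigma> where \<sigma>: "\<forall>i<k. \<sigma> i \<le> N i" "\<forall>k. x \<in> D (map \<sigma> [0..<k])" by (auto simp: S_def fN)
      have "length (map \<sigma> [0..<k]) = k \<and> (\<forall>i<k. map \<sigma> [0..<k] ! i \<le> N i) \<and> (\<forall>j\<le>k. x \<in> D (take j (map \<sigma> [0..<k])))"
        using \<sigma> by (auto simp: take_map)
      moreover have "x \<in> space M" using x S_sub by auto
      ultimately show "x \<in> T' k" unfolding T'_def by blast
    qed
    then have "outer_measure_of M (S (f k)) \<le> emeasure M (T' k)"
      using outer_measure_of_mono[of "S (f k)" "T' k" M] T'_meas by simp
    then show ?thesis using f(2)[of k] by simp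
  qed
  moreover have "(INF k. emeasure M (T' k)) = emeasure M T"
    unfolding T_eq
  proof (rule INF_emeasure_decseq)
    show "emeasure M (T' k) \<noteq> \<infinity>" for k
      using emeasure_mono[OF T'_sub[of k] D] fin by (auto simp: top_unique)
  qed (use T'_meas T'_dec in auto)
  ultimately have "c \<le> emeasure M T" by (metis INF_greatest)
  show thesis
  proof (rule that[of T \<tau>])
    show "T \<in> sets M" unfolding T_def by measurable
    show "0 < emeasure M T" using c \<open>c \<le> emeasure M T\<close> by simp
    show "T \<subseteq> D []" using T'_sub T_eq by blast
    show "\<tau> k \<in> measurable M (count_space UNIV)" for k by (rule \<tau>_meas)
    fix x k assume "x \<in> T"
    have ext: "ext (s k x) x"
    proof (induction k)
      case 0 then show ?case using \<open>x \<in> T\<close> by (simp add: s0 T_def)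
    next
      case (Suc k)
      from ext_step[OF this] have "ext (s k x @ [LEAST n. ext (s k x @ [n]) x]) x" by (rule LeastI_ex)
      then show ?case by (simp add: sS)
    qed
    have "length (s k x) = k" by (simp add: s\<tau>)
    then have "x \<in> D (s k x)" using ext unfolding ext_def by (metis order_refl take_all)
    then show "x \<in> D (map (\<lambda>i. \<tau> i x) [0..<k])" by (simp add: s\<tau>)
  qed
qed

text \<open>
  The condition \<open>F \<le> 0\<close> is closed, so pairs of dense sections need not satisfy it anywhere and
  a measurable choice of a pair in the fibre that satisfies it exactly needs the Suslin
  scheme. A branch of the scheme is a fast convergent sequence of pairs of dense sections
  along which \<open>F\<close> is eventually at most any positive number.
\<close>

lemma bundle_pair_selection:
  fixes E :: "'x \<Rightarrow> 'b::{banach, second_countable_topology} set" and F :: "'b \<times> 'b \<Rightarrow> real"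
  assumes "sigma_finite_measure M" "Banach_bundle M E" "continuous_on UNIV F"
    and nonnull: "\<not> (AE x in M. \<forall>a\<in>E x. \<forall>b\<in>E x. 0 < F (a, b))"
  obtains T v w where "T \<in> sets M" "0 < emeasure M T" "emeasure M T < \<infinity>"
    "v \<in> sections M E" "w \<in> sections M E" "\<And>x. x \<in> T \<Longrightarrow> F (v x, w x) \<le> 0"
proof -
  obtain C :: "nat \<Rightarrow> 'x set" where C: "range C \<subseteq> sets M" "(\<Union>k. C k) = space M" "\<And>k. emeasure M (C k) \<noteq> \<infinity>"
    using sigma_finite_measure.sigma_finite[OF assms(1)] by metis
  have [measurable]: "C k \<in> sets M" for k using C(1) by auto
  define S where "S = {x \<in> space M. \<exists>a\<in>E x. \<exists>b\<in>E x. F (a, b) \<le> 0}"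
  have "\<exists>k. 0 < outer_measure_of M (S \<inter> C k)"
  proof (rule ccontr)
    assume "\<not> ?thesis"
    then have z: "outer_measure_of M (S \<inter> C k) = 0" for k by (simp add: zero_less_iff_neq_zero)
    have "\<exists>N\<in>null_sets M. S \<inter> C k \<subseteq> N" for k
    proof -
      have "S \<inter> C k \<subseteq> space M" by (auto simp: S_def)
      from outer_measure_of_attain[OF this] z[of k] show ?thesis by auto
    qed
    have "AE x in M. x \<notin> S \<inter> C k" for k
    proof -
      obtain N where N: "N \<in> null_sets M" "S \<inter> C k \<subseteq> N" using \<open>\<exists>N\<in>null_sets M. S \<inter> C k \<subseteq> N\<close> by blast
      show ?thesis using AE_not_in[OF N(1)] by eventually_elim (use N(2) in blast)
    qed
    then have "AE x in M. \<forall>k. x \<notin> S \<inter> C k" unfolding AE_all_countable by blast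
    then have "AE x in M. \<forall>a\<in>E x. \<forall>b\<in>E x. 0 < F (a, b)"
      using AE_space
    proof eventually_elim
      case (elim x)
      then obtain k where "x \<in> C k" using C(2) by blast
      then have "x \<notin> S" using elim by blast
      then show ?case using elim by (auto simp: S_def not_le)
    qed
    then show False using nonnull by blast
  qed
  then obtain k where k: "0 < outer_measure_of M (S \<inter> C k)" by blast
  obtain V :: "nat \<Rightarrow> 'x \<Rightarrow> 'b" where V: "\<And>n. V n \<in> sections M E"
    "\<And>x e \<eta>. \<lbrakk>x \<in> space M; e \<in> E x; 0 < \<eta>\<rbrakk> \<Longrightarrow> \<exists>n. norm (V n x - e) < \<eta>"
    using dense_sections[OF assms(2)] by metis
  have [measurable]: "V n \<in> borel_measurable M" for n using V(1) by (simp add: sections_eq)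
  define z where "z n x = (V (fst (prod_decode n)) x, V (snd (prod_decode n)) x)" for n x
  have z_meas [measurable]: "z n \<in> borel_measurable M" for n unfolding z_def by measurable
  have z_dense: "\<exists>n. dist (z n x) (a, b) < \<eta>" if ab: "x \<in> space M" "a \<in> E x" "b \<in> E x" "0 < \<eta>" for x a b \<eta>
  proof -
    obtain i j where ij: "norm (V i x - a) < \<eta> / 2" "norm (V j x - b) < \<eta> / 2"
      using V(2)[OF ab(1,2), of "\<eta> / 2"] V(2)[OF ab(1,3), of "\<eta> / 2"] ab(4) by auto
    have "dist (z (prod_encode (i, j)) x) (a, b) \<le> norm (V i x - a) + norm (V j x - b)"
      by (simp add: z_def dist_norm norm_Pair_le)
    then show ?thesis using ij by (intro exI[of _ "prod_encode (i, j)"]) simp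
  qed
  have F_meas: "F \<in> borel_measurable borel" using assms(3) by (rule borel_measurable_continuous_onI)
  have [measurable]: "(\<lambda>x. F (z n x)) \<in> borel_measurable M" for n by (rule measurable_compose[OF z_meas F_meas])
  define D where "D s = {x \<in> space M. x \<in> C k \<and> (\<forall>i<length s. F (z (s ! i) x) < (1/2) ^ i \<and>
     (Suc i < length s \<longrightarrow> dist (z (s ! i) x) (z (s ! Suc i) x) < (1/2) ^ i))}" for s
  have D_meas: "D s \<in> sets M" for s unfolding D_def by measurable
  have D_map: "x \<in> D (map \<sigma> [0..<n]) \<longleftrightarrow> x \<in> space M \<and> x \<in> C k \<and> (\<forall>i<n. F (z (\<sigma> i) x) < (1/2) ^ i) \<and>
     (\<forall>i. Suc i < n \<longrightarrow> dist (z (\<sigma> i) x) (z (\<sigma> (Suc i)) x) < (1/2) ^ i)" for x \<sigma> n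
    by (auto simp: D_def)
  have "S \<inter> C k \<subseteq> {x. \<exists>\<sigma>::nat \<Rightarrow> nat. \<forall>n. x \<in> D (map \<sigma> [0..<n])}"
  proof
    fix x assume x: "x \<in> S \<inter> C k"
    then obtain a b where ab: "x \<in> space M" "a \<in> E x" "b \<in> E x" "F (a, b) \<le> 0" by (auto simp: S_def)
    have "\<exists>n. F (z n x) < (1/2) ^ i \<and> dist (z n x) (a, b) < (1/2) ^ Suc i" for i :: nat
    proof -
      have "isCont F (a, b)" using assms(3) by (simp add: continuous_on_eq_continuous_at)
      then obtain d where d: "0 < d" "\<And>y. dist y (a, b) < d \<Longrightarrow> dist (F y) (F (a, b)) < (1/2) ^ i"
        unfolding continuous_at_eps_delta by (metis zero_less_power half_gt_zero_iff zero_less_one)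
      define d' where "d' = min d ((1/2) ^ Suc i)"
      have d': "0 < d'" "d' \<le> d" "d' \<le> (1/2) ^ Suc i" using d(1) by (simp_all add: d'_def)
      obtain n where "dist (z n x) (a, b) < d'" using z_dense[OF ab(1-3) d'(1)] by blast
      then show ?thesis using d(2)[of "z n x"] d' ab(4) by (intro exI[of _ n]) (simp add: dist_real_def)
    qed
    then obtain \<sigma> where \<sigma>: "\<And>i. F (z (\<sigma> i) x) < (1/2) ^ i" "\<And>i. dist (z (\<sigma> i) x) (a, b) < (1/2) ^ Suc i" by metis
    have "dist (z (\<sigma> i) x) (z (\<sigma> (Suc i)) x) < (1/2) ^ i" for i
    proof -
      have "(1/2) ^ Suc i + (1/2) ^ Suc (Suc i) \<le> (1/2::real) ^ i" by simp
      then show ?thesis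
        using dist_triangle2[of "z (\<sigma> i) x" "z (\<sigma> (Suc i)) x" "(a, b)"] \<sigma>(2)[of i] \<sigma>(2)[of "Suc i"]
        by linarith
    qed
    then show "x \<in> {x. \<exists>\<sigma>::nat \<Rightarrow> nat. \<forall>n. x \<in> D (map \<sigma> [0..<n])}"
      using \<sigma>(1) x ab(1) unfolding mem_Collect_eq D_map by blast
  qed
  from outer_measure_of_mono[OF this, of M] k
  have pos: "0 < outer_measure_of M {x. \<exists>\<sigma>::nat \<Rightarrow> nat. \<forall>n. x \<in> D (map \<sigma> [0..<n])}" by simp
  have D0: "D [] \<subseteq> C k" by (auto simp: D_def)
  have fin: "emeasure M A \<noteq> \<infinity>" if "A \<subseteq> D []" for A
    using emeasure_mono[OF order_trans[OF that D0], of M] C(3)[of k] by (auto simp: top_unique)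
  obtain T \<tau> where T: "T \<in> sets M" "0 < emeasure M T" "T \<subseteq> D []"
    and \<tau> [measurable]: "\<And>k. \<tau> k \<in> measurable M (count_space UNIV)"
    and TD: "\<And>x k. x \<in> T \<Longrightarrow> x \<in> D (map (\<lambda>i. \<tau> i x) [0..<k])"
    by (rule suslin_selection[OF D_meas fin[OF order_refl] pos]) blast
  have zt [measurable]: "(\<lambda>x. z (\<tau> i x) x) \<in> borel_measurable M" for i
    by (rule measurable_compose_countable[OF z_meas \<tau>])
  define y where "y x = lim (\<lambda>i. z (\<tau> i x) x)" for x
  have y_meas [measurable]: "y \<in> borel_measurable M" unfolding y_def by measurable
  have lim: "(\<lambda>i. z (\<tau> i x) x) \<longlonglongrightarrow> y x" and F0: "F (y x) \<le> 0" if x: "x \<in> T" for x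
  proof -
    have d: "F (z (\<tau> i x) x) < (1/2) ^ i" "dist (z (\<tau> i x) x) (z (\<tau> (Suc i) x) x) < (1/2) ^ i" for i
      using TD[OF x, of "Suc (Suc i)"] unfolding D_map by auto
    have "summable (\<lambda>i. norm (z (\<tau> (Suc i) x) x - z (\<tau> i x) x))"
    proof (rule summable_comparison_test)
      show "\<exists>N. \<forall>n\<ge>N. norm (norm (z (\<tau> (Suc n) x) x - z (\<tau> n x) x)) \<le> (1/2) ^ n"
        using d(2) by (auto simp: dist_norm norm_minus_commute less_imp_le)
    qed (simp add: summable_geometric)
    then have "convergent (\<lambda>n. \<Sum>i<n. z (\<tau> (Suc i) x) x - z (\<tau> i x) x)"
      unfolding summable_iff_convergent[symmetric] by (rule summable_norm_cancel)
    then have "convergent (\<lambda>n. z (\<tau> 0 x) x + (\<Sum>i<n. z (\<tau> (Suc i) x) x - z (\<tau> i x) x))"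
      by (intro convergent_add convergent_const)
    then have "convergent (\<lambda>i. z (\<tau> i x) x)"
      using sum_lessThan_telescope[of "\<lambda>i. z (\<tau> i x) x"] by simp
    then show lim: "(\<lambda>i. z (\<tau> i x) x) \<longlonglongrightarrow> y x" by (simp add: y_def convergent_LIMSEQ_iff)
    have "(\<lambda>i. F (z (\<tau> i x) x)) \<longlonglongrightarrow> F (y x)"
    proof (rule isCont_tendsto_compose[OF _ lim])
      show "isCont F (y x)" using assms(3) continuous_on_eq_continuous_at[OF open_UNIV, of F] by blast
    qed
    moreover have "(\<lambda>i. (1/2::real) ^ i) \<longlonglongrightarrow> 0" by (rule LIMSEQ_power_zero) simp
    ultimately show "F (y x) \<le> 0"
      by (rule LIMSEQ_le) (intro exI[of _ 0] allI impI less_imp_le d(1))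
  qed
  have yE: "fst (y x) \<in> E x" "snd (y x) \<in> E x" if "x \<in> T" for x
  proof -
    have x: "x \<in> space M" using T that sets.sets_into_space by blast
    then have cl: "closed (E x)" using assms(2) by (simp add: Banach_bundle_def)
    have in_E: "fst (z n x) \<in> E x" "snd (z n x) \<in> E x" for n using V(1) x by (auto simp: z_def sections_eq)
    show "fst (y x) \<in> E x" using closed_sequentially[OF cl _ tendsto_fst[OF lim[OF that]]] in_E by simp
    show "snd (y x) \<in> E x" using closed_sequentially[OF cl _ tendsto_snd[OF lim[OF that]]] in_E by simp
  qed
  define v where "v x = (if x \<in> T then fst (y x) else 0)" for x
  define w where "w x = (if x \<in> T then snd (y x) else 0)" for x
  have E0: "0 \<in> E x" if "x \<in> space M" for x using assms(2) that by (simp add: Banach_bundle_def subspace_0)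
  have fs: "(\<lambda>x. fst (y x)) \<in> borel_measurable M" "(\<lambda>x. snd (y x)) \<in> borel_measurable M"
    by (auto intro!: borel_measurable_continuous_on[OF _ y_meas] continuous_intros)
  note [measurable] = fs T(1)
  have "v \<in> borel_measurable M" "w \<in> borel_measurable M" unfolding v_def w_def by measurable
  then have "v \<in> sections M E" "w \<in> sections M E" using E0 yE by (auto simp: sections_eq v_def w_def)
  moreover have "F (v x, w x) \<le> 0" if "x \<in> T" for x using F0[OF that] that by (simp add: v_def w_def)
  moreover have "emeasure M T < \<infinity>" using fin[OF T(3)] by (simp add: less_top)
  ultimately show thesis using T by (intro that[of T v w])
qed

section \<open>The global modulus bounds the fibre moduli from below\<close>

context Lp_bundle
begin

text \<open>
  If the fibre modulus were smaller on a set that is not null, then there would be pairs of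
  unit vectors in these fibres, at distance at least \<open>\<epsilon>\<close>, whose midpoints have norm above
  \<open>1 - m\<close>. Selected measurably and cut off to a set of finite measure they are a multiple of
  an admissible pair of sections with such a midpoint. The condition on the distance is not
  strict, and for \<open>\<epsilon> = 2\<close> it cannot be relaxed; hence the selection of exact solutions.
\<close>

lemma modulus_\<Gamma>_le_fibre:
  assumes "sigma_finite_measure M" "0 < \<epsilon>"
  shows "AE x in M. modulus (module_space M p \<Gamma>) \<epsilon> \<le> modulus (subspace_of (E x)) \<epsilon>"
proof -
  define m where "m = modulus (module_space M p \<Gamma>) \<epsilon>"
  define F where "F c = (\<lambda>(a :: 'b, b :: 'b). max (max \<bar>norm a - 1\<bar> \<bar>norm b - 1\<bar>) (max (\<epsilon> - norm (a - b)) (c - norm (a + b) / 2)))" for c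
  have F_le: "F c (a, b) \<le> 0 \<longleftrightarrow> norm a = 1 \<and> norm b = 1 \<and> \<epsilon> \<le> norm (a - b) \<and> c \<le> norm (a + b) / 2" for c a b
    by (auto simp: F_def)
  have F_cont: "continuous_on UNIV (F c)" for c
    unfolding F_def case_prod_unfold by (intro continuous_intros) auto
  have "AE x in M. \<forall>a\<in>E x. \<forall>b\<in>E x. 0 < F c (a, b)" if "1 - m < c" for c
  proof (rule ccontr)
    assume "\<not> ?thesis"
    then obtain T v w where T: "T \<in> sets M" "0 < emeasure M T" "emeasure M T < \<infinity>"
      and v: "v \<in> sections M E" "w \<in> sections M E" and le: "\<And>x. x \<in> T \<Longrightarrow> F c (v x, w x) \<le> 0"
      by (rule bundle_pair_selection[OF assms(1) is_bundle F_cont]) blast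
    define v' where "v' x = indicator T x *\<^sub>R v x" for x
    define w' where "w' x = indicator T x *\<^sub>R w x" for x
    have L: "v' \<in> L" "w' \<in> L"
      unfolding v'_def w'_def using T v le F_le by (auto intro!: bounded_section_on_finite_set[where K = 1])
    define a where "a = nrm v'"
    have "a \<noteq> 0"
    proof
      assume "a = 0"
      then have "AE x in M. v' x = 0" using Lp_map_norm_eq_0_iff[OF LpD(1)[OF L(1)]] p by (simp add: a_def)
      then have "AE x in M. x \<notin> T"
      proof eventually_elim
        case (elim x)
        then show ?case using le[of x] unfolding F_le by (auto simp: v'_def)
      qed
      then have "emeasure M T = 0" using T(1) by (simp add: AE_iff_null_sets null_setsD1)
      then show False using T(2) by simp
    qed
    then have a: "0 < a" using Lp_map_norm_nonneg[of M p v'] by (simp add: a_def)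
    have aw: "nrm w' = a"
      unfolding a_def using LpD(3)[OF L(1)] LpD(3)[OF L(2)]
      by (intro Lp_map_norm_cong_AE always_eventually) (use le F_le in \<open>auto simp: v'_def w'_def indicator_def\<close>)
    define V where "V x = (1 / a) *\<^sub>R v' x" for x
    define W where "W x = (1 / a) *\<^sub>R w' x" for x
    have VL: "V \<in> L" "W \<in> L" unfolding V_def W_def using L by (auto intro!: sections_closed_scaleR)
    have V1: "nrm V = 1" "nrm W = 1"
      unfolding V_def W_def using a aw p by (auto simp: Lp_map_norm_scaleR a_def)
    have key: "C \<le> nrm g"
      if "g \<in> L" "\<And>x. x \<in> T \<Longrightarrow> C * norm (V x) \<le> norm (g x)" "0 \<le> C" for g C
    proof -
      have "nrm (\<lambda>x. C *\<^sub>R V x) \<le> nrm g"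
      proof (rule Lp_map_norm_mono)
        show "(\<lambda>x. C *\<^sub>R V x) \<in> Lp_maps M p" "g \<in> Lp_maps M p"
          using that sections_closed_scaleR[OF VL(1)] by (auto intro: LpD(1))
        have "norm (C *\<^sub>R V x) \<le> norm (g x)" for x
          using that(2)[of x] that(3) by (cases "x \<in> T") (auto simp: V_def v'_def)
        then show "AE x in M. norm (C *\<^sub>R V x) \<le> norm (g x)" by simp
      qed (use p in simp)
      then show ?thesis using V1 that(3) p by (simp add: Lp_map_norm_scaleR)
    qed
    have on_T: "norm (V x) = 1 / a" "norm (V x - W x) = norm (v x - w x) / a" "norm (V x + W x) = norm (v x + w x) / a" if "x \<in> T" for x
      using that le[OF that] a unfolding F_le
      by (auto simp: V_def W_def v'_def w'_def simp flip: scaleR_diff_right scaleR_add_right)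
    have "\<epsilon> \<le> nrm (\<lambda>x. V x - W x)"
      using le a assms unfolding F_le by (intro key sections_closed VL) (auto simp: on_T divide_right_mono)
    then have m_le: "m \<le> 1 - nrm (\<lambda>x. V x + W x) / 2"
      unfolding m_def using VL V1 by (intro modulus_\<Gamma>(1))
    have "0 < c" using that modulus_\<Gamma>(3)[of \<epsilon>] by (simp add: m_def)
    have "2 * c \<le> nrm (\<lambda>x. V x + W x)"
    proof (intro key sections_closed VL)
      fix x assume x: "x \<in> T"
      have "2 * c / a \<le> norm (v x + w x) / a" using le[OF x] a unfolding F_le by (intro divide_right_mono) auto
      then show "2 * c * norm (V x) \<le> norm (V x + W x)" by (simp add: on_T[OF x])
    qed (use \<open>0 < c\<close> in simp)
    then show False using m_le that by simp
  qed
  then have "AE x in M. \<forall>a\<in>E x. \<forall>b\<in>E x. 0 < F (1 - m + 1 / real (Suc n)) (a, b)" for n by simp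
  then have "AE x in M. \<forall>n. \<forall>a\<in>E x. \<forall>b\<in>E x. 0 < F (1 - m + 1 / real (Suc n)) (a, b)"
    by (simp add: AE_all_countable)
  then show ?thesis
  proof eventually_elim
    case (elim x)
    show ?case unfolding m_def[symmetric]
    proof (rule modulus_subspace_greatest)
      show "m \<le> 1" using modulus_\<Gamma>(3) by (simp add: m_def)
      fix a b assume ab: "a \<in> E x" "b \<in> E x" "norm a = 1" "norm b = 1" "\<epsilon> \<le> norm (a - b)"
      show "m \<le> 1 - norm (a + b) / 2"
      proof (rule field_le_epsilon)
        fix e :: real assume "0 < e"
        then obtain n where n: "1 / real (Suc n) < e" using nat_approx_posE by blast
        have "\<not> F (1 - m + 1 / real (Suc n)) (a, b) \<le> 0" using elim ab by (meson not_le)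
        then have "norm (a + b) / 2 < 1 - m + 1 / real (Suc n)" using ab unfolding F_le by auto
        then show "m \<le> 1 - norm (a + b) / 2 + e" using n by simp
      qed
    qed
  qed
qed

end

section \<open>Day's theorem for bundles\<close>

text \<open>
  For vectors of rather different length the gain comes from the strict convexity of the
  power, for vectors of nearly the same length from the convexity of the space: if the longer
  one has norm one, then normalising the shorter one costs at most \<open>e / 2\<close> of the distance
  \<open>e\<close>.
\<close>

lemma midpoint_powr_uniformly_convex:
  fixes V :: "'b::real_normed_vector set"
  assumes V: "subspace V" "a \<in> V" "b \<in> V" and p: "1 < p"
    and e: "0 < e" "e \<le> 1" and d: "0 < d" "d \<le> modulus (subspace_of V) (e / 2)"
    and gap: "\<And>t. \<lbrakk>0 \<le> t; t \<le> 1 - e / 2\<rbrakk> \<Longrightarrow> ((1 + t) / 2) powr p \<le> (1 - \<theta>) * ((1 + t powr p) / 2)"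
    and far: "e * norm a \<le> norm (a - b)" and le: "norm b \<le> norm a"
  shows "(norm (a + b) / 2) powr p \<le> (1 - min \<theta> (d / 2)) * ((norm a powr p + norm b powr p) / 2)"
proof (cases "a = 0")
  case True
  then show ?thesis using le by simp
next
  case False
  define s where "s = norm a"
  define t where "t = norm b / s"
  have s: "0 < s" using False by (simp add: s_def)
  have t: "0 \<le> t" "t \<le> 1" "norm b = s * t" using s le by (auto simp: t_def s_def)
  have split: "(s * r) powr p = s powr p * r powr p" for r by (rule powr_mult)
  have sum: "(norm a powr p + norm b powr p) / 2 = s powr p * ((1 + t powr p) / 2)"
    unfolding t(3) split s_def[symmetric] by (simp add: algebra_simps)
  have weaken: "(1 - \<theta>') * ((1 + t powr p) / 2) \<le> (1 - min \<theta> (d / 2)) * ((1 + t powr p) / 2)" if "min \<theta> (d / 2) \<le> \<theta>'" for \<theta>'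
    using that by (intro mult_right_mono) auto
  have "\<exists>r. norm (a + b) / 2 \<le> s * r \<and> r powr p \<le> (1 - min \<theta> (d / 2)) * ((1 + t powr p) / 2)"
  proof (cases "t \<le> 1 - e / 2")
    case True
    have "norm (a + b) / 2 \<le> s * ((1 + t) / 2)"
      using norm_triangle_ineq[of a b] t(3) by (simp add: s_def algebra_simps)
    moreover have "((1 + t) / 2) powr p \<le> (1 - min \<theta> (d / 2)) * ((1 + t powr p) / 2)"
      by (rule order_trans[OF gap[OF t(1) True] weaken]) simp
    ultimately show ?thesis by blast
  next
    case False
    then have t_half: "1 / 2 \<le> t" using e by simp
    then have b0: "0 < norm b" using t(3) s by simp
    define a' where "a' = (1 / s) *\<^sub>R a"
    define b' where "b' = (1 / norm b) *\<^sub>R b"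
    have unit: "a' \<in> V" "b' \<in> V" "norm a' = 1" "norm b' = 1"
      using V s b0 by (auto simp: a'_def b'_def subspace_scale s_def)
    have ab: "a = s *\<^sub>R a'" "b = (s * t) *\<^sub>R b'"
      using s b0 by (auto simp: a'_def b'_def t(3)[symmetric])
    have "e \<le> norm (a' - t *\<^sub>R b')"
    proof -
      have "a - b = s *\<^sub>R (a' - t *\<^sub>R b')" using ab by (simp add: scaleR_diff_right)
      then have "s * e \<le> s * norm (a' - t *\<^sub>R b')" using far s by (simp add: s_def mult.commute)
      then show ?thesis using s by simp
    qed
    also have "\<dots> \<le> norm (a' - b') + norm ((1 - t) *\<^sub>R b')"
      using norm_triangle_ineq[of "a' - b'" "(1 - t) *\<^sub>R b'"] by (simp add: algebra_simps)
    also have "norm ((1 - t) *\<^sub>R b') = 1 - t" using t unit by simp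
    finally have "e / 2 \<le> norm (a' - b')" using False by simp
    then have "d \<le> 1 - norm (a' + b') / 2" using modulus_subspace(1)[OF unit] d(2) by (meson order_trans)
    then have ab': "norm (a' + b') \<le> 2 * (1 - d)" by simp
    have d1: "d \<le> 1" using d(2) modulus_subspace(3) order_trans by blast
    have "norm (a + b) \<le> s * ((1 + t) * (1 - d / 2))"
    proof -
      have "a + b = s *\<^sub>R (t *\<^sub>R (a' + b') + (1 - t) *\<^sub>R a')" unfolding ab by (simp add: algebra_simps)
      then have "norm (a + b) = s * norm (t *\<^sub>R (a' + b') + (1 - t) *\<^sub>R a')" using s by simp
      also have "norm (t *\<^sub>R (a' + b') + (1 - t) *\<^sub>R a') \<le> t * norm (a' + b') + (1 - t)"
        using norm_triangle_ineq[of "t *\<^sub>R (a' + b')" "(1 - t) *\<^sub>R a'"] t unit by simp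
      also have "t * norm (a' + b') + (1 - t) \<le> t * (2 * (1 - d)) + (1 - t)"
        using ab' t by (intro add_mono mult_left_mono) auto
      also have "\<dots> \<le> (1 + t) * (1 - d / 2)"
      proof -
        have "d * (1 + t) \<le> d * (4 * t)" using d t_half by (intro mult_left_mono) auto
        then show ?thesis by (simp add: algebra_simps)
      qed
      finally show ?thesis using s by simp
    qed
    moreover have "((1 + t) / 2 * (1 - d / 2)) powr p \<le> (1 - min \<theta> (d / 2)) * ((1 + t powr p) / 2)"
    proof -
      have "((1 + t) / 2 * (1 - d / 2)) powr p = ((1 + t) / 2) powr p * (1 - d / 2) powr p" by (rule powr_mult)
      also have "\<dots> \<le> ((1 + t powr p) / 2) * (1 - d / 2)"
        using powr_midpoint_le[of p 1 t] powr_mono'[of 1 p "1 - d / 2"] p t d d1 by (intro mult_mono) auto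
      also have "\<dots> \<le> (1 - min \<theta> (d / 2)) * ((1 + t powr p) / 2)"
        using weaken[of "d / 2"] by (simp add: mult.commute)
      finally show ?thesis .
    qed
    ultimately show ?thesis by (intro exI[of _ "(1 + t) / 2 * (1 - d / 2)"]) simp
  qed
  then obtain r where r: "norm (a + b) / 2 \<le> s * r" "r powr p \<le> (1 - min \<theta> (d / 2)) * ((1 + t powr p) / 2)" by blast
  have "(norm (a + b) / 2) powr p \<le> (s * r) powr p" using r(1) p by (intro powr_mono2) auto
  also have "\<dots> \<le> s powr p * ((1 - min \<theta> (d / 2)) * ((1 + t powr p) / 2))"
    unfolding split using r(2) by (intro mult_left_mono) auto
  finally show ?thesis unfolding sum by (simp add: mult.left_commute)
qed

text \<open>
  The uniform convexity in a form that can be integrated. If \<open>a\<close> and \<open>b\<close> are far apart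
  relative to their length, the subtracted term is at most the gain of the previous lemma, by
  \<open>\<parallel>a - b\<parallel> \<le> 2 max \<parallel>a\<parallel> \<parallel>b\<parallel>\<close>; otherwise it is not positive.
\<close>

lemma midpoint_powr_defect:
  fixes V :: "'b::real_normed_vector set"
  assumes V: "subspace V" "a \<in> V" "b \<in> V" and p: "1 < p"
    and e: "0 < e" "e \<le> 1" and d: "0 < d" "d \<le> modulus (subspace_of V) (e / 2)" and \<theta>: "0 < \<theta>"
    and gap: "\<And>t. \<lbrakk>0 \<le> t; t \<le> 1 - e / 2\<rbrakk> \<Longrightarrow> ((1 + t) / 2) powr p \<le> (1 - \<theta>) * ((1 + t powr p) / 2)"
  shows "(norm (a + b) / 2) powr p \<le> (norm a powr p + norm b powr p) / 2
     - min \<theta> (d / 2) / 2 powr (p + 1) * (norm (a - b) powr p - e powr p * (norm a powr p + norm b powr p))"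
proof -
  define m where "m = min \<theta> (d / 2)"
  define c where "c = m / 2 powr (p + 1)"
  have m: "0 < m" using d(1) \<theta> by (simp add: m_def)
  then have c: "0 \<le> c" by (simp add: c_def)
  have c2: "c * 2 powr p = m / 2" by (simp add: c_def powr_add)
  have main: "(norm (a + b) / 2) powr p \<le> (norm a powr p + norm b powr p) / 2
     - c * (norm (a - b) powr p - e powr p * (norm a powr p + norm b powr p))"
    if ab: "a \<in> V" "b \<in> V" and le: "norm b \<le> norm a" for a b
  proof -
    define S where "S = norm a powr p + norm b powr p"
    have S: "norm a powr p \<le> S" "0 \<le> S" by (auto simp: S_def)
    show ?thesis unfolding S_def[symmetric]
    proof (cases "e * norm a \<le> norm (a - b)")
      case True
      have "(norm (a + b) / 2) powr p \<le> (1 - m) * (S / 2)"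
        unfolding m_def S_def using midpoint_powr_uniformly_convex[OF V(1) ab p e d gap True le] .
      moreover have "c * norm (a - b) powr p \<le> c * (2 powr p * S)"
      proof (rule mult_left_mono[OF _ c])
        have "norm (a - b) powr p \<le> (2 * norm a) powr p"
          using norm_triangle_ineq4[of a b] le p by (intro powr_mono2) auto
        also have "\<dots> = 2 powr p * norm a powr p" by (rule powr_mult)
        also have "\<dots> \<le> 2 powr p * S" using S by (intro mult_left_mono) auto
        finally show "norm (a - b) powr p \<le> 2 powr p * S" .
      qed
      moreover have "c * (2 powr p * S) = m / 2 * S" using c2 by (simp flip: mult.assoc)
      moreover have "0 \<le> c * (e powr p * S)" using c S by simp
      moreover have "(1 - m) * (S / 2) = S / 2 - m / 2 * S" by (simp add: left_diff_distrib)
      ultimately show "(norm (a + b) / 2) powr p \<le> S / 2 - c * (norm (a - b) powr p - e powr p * S)"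
        unfolding right_diff_distrib by linarith
    next
      case False
      have "norm (a - b) powr p \<le> (e * norm a) powr p" using False p by (intro powr_mono2) auto
      also have "\<dots> = e powr p * norm a powr p" by (rule powr_mult)
      also have "\<dots> \<le> e powr p * S" using S by (intro mult_left_mono) auto
      finally have "c * (norm (a - b) powr p - e powr p * S) \<le> 0" using c by (simp add: mult_nonneg_nonpos)
      moreover have "(norm (a + b) / 2) powr p \<le> S / 2"
      proof -
        have "(norm (a + b) / 2) powr p \<le> ((norm a + norm b) / 2) powr p"
          using norm_triangle_ineq[of a b] p by (intro powr_mono2) auto
        also have "\<dots> \<le> S / 2" unfolding S_def using p by (intro powr_midpoint_le) auto
        finally show ?thesis .
      qed
      ultimately show "(norm (a + b) / 2) powr p \<le> S / 2 - c * (norm (a - b) powr p - e powr p * S)" by simp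
    qed
  qed
  have "(norm (a + b) / 2) powr p \<le> (norm a powr p + norm b powr p) / 2
     - c * (norm (a - b) powr p - e powr p * (norm a powr p + norm b powr p))"
  proof (cases "norm b \<le> norm a")
    case True
    then show ?thesis using main V by blast
  next
    case False
    then show ?thesis using main[of b a] V by (simp add: add.commute norm_minus_commute)
  qed
  then show ?thesis by (simp add: c_def m_def)
qed

context Lp_bundle
begin

text \<open>
  Integrating the pointwise defect of the midpoint. With \<open>e = \<epsilon> / 4\<close> the term that is
  subtracted from \<open>\<parallel>v - w\<parallel>\<close> to the power \<open>p\<close> has integral at most half of \<open>\<epsilon>\<close> to the power
  \<open>p\<close>, because \<open>p \<ge> 1\<close>.
\<close>

lemma uniformly_convex_\<Gamma>:
  assumes fibres: "\<And>\<epsilon>. \<lbrakk>0 < \<epsilon>; \<epsilon> \<le> 2\<rbrakk> \<Longrightarrow> \<exists>d>0. AE x in M. d \<le> modulus (subspace_of (E x)) \<epsilon>"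
  shows "uniformly_convex (module_space M p \<Gamma>)"
  unfolding uniformly_convex_def
proof
  fix \<epsilon> :: real assume "\<epsilon> \<in> {0<..2}"
  then have \<epsilon>: "0 < \<epsilon>" "\<epsilon> \<le> 2" by auto
  define e where "e = \<epsilon> / 4"
  have e: "0 < e" "e \<le> 1" "e / 2 \<le> 2" using \<epsilon> by (auto simp: e_def)
  obtain d where d: "0 < d" "AE x in M. d \<le> modulus (subspace_of (E x)) (e / 2)"
    using fibres[of "e / 2"] e by auto
  obtain \<theta> where \<theta>: "0 < \<theta>" "\<And>t. \<lbrakk>0 \<le> t; t \<le> 1 - e / 2\<rbrakk> \<Longrightarrow> ((1 + t) / 2) powr p \<le> (1 - \<theta>) * ((1 + t powr p) / 2)"
    using powr_midpoint_gap[of p "e / 2"] p e by auto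
  define c where "c = min \<theta> (d / 2) / 2 powr (p + 1)"
  have c: "0 < c" using d \<theta> by (simp add: c_def)
  define \<kappa> where "\<kappa> = c * \<epsilon> powr p / 2"
  have \<kappa>: "0 < \<kappa>" using c \<epsilon> by (simp add: \<kappa>_def)
  define r where "r = (max 0 (1 - \<kappa>)) powr (1 / p)"
  have "r < 1"
  proof -
    have "r < 1 powr (1 / p)" unfolding r_def using \<kappa> p by (intro powr_less_mono2) auto
    then show ?thesis by simp
  qed
  have rp: "r powr p = max 0 (1 - \<kappa>)" using p by (simp add: r_def powr_powr)
  have "1 - r \<le> modulus (module_space M p \<Gamma>) \<epsilon>"
  proof (rule modulus_\<Gamma>_greatest)
    show "1 - r \<le> 1" by (simp add: r_def)
    fix v w assume vw: "v \<in> L" "w \<in> L" "nrm v = 1" "nrm w = 1"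
      "\<epsilon> \<le> nrm (\<lambda>x. v x - w x)"
    have iv: "integrable M (\<lambda>x. norm (v x) powr p)" "(\<integral>x. norm (v x) powr p \<partial>M) = 1"
      using LpD(1)[OF vw(1)] Lp_map_norm_powr[of p M v] vw(3) p by (auto simp: Lp_maps_def)
    have iw: "integrable M (\<lambda>x. norm (w x) powr p)" "(\<integral>x. norm (w x) powr p \<partial>M) = 1"
      using LpD(1)[OF vw(2)] Lp_map_norm_powr[of p M w] vw(4) p by (auto simp: Lp_maps_def)
    have idiff: "integrable M (\<lambda>x. norm (v x - w x) powr p)"
      using LpD(1)[OF sections_closed(2)[OF vw(1,2)]] by (auto simp: Lp_maps_def)
    have i\<epsilon>: "\<epsilon> powr p \<le> (\<integral>x. norm (v x - w x) powr p \<partial>M)"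
      using powr_mono2[of p \<epsilon>, OF _ _ vw(5)] p \<epsilon> by (simp add: Lp_map_norm_powr)
    have s: "(\<lambda>x. (1 / 2) *\<^sub>R (v x + w x)) \<in> L"
      by (intro sections_closed_scaleR sections_closed vw)
    have isum: "integrable M (\<lambda>x. (norm (v x + w x) / 2) powr p)"
      using LpD(1)[OF s] by (auto simp: Lp_maps_def)
    have "(\<integral>x. (norm (v x + w x) / 2) powr p \<partial>M)
      \<le> (\<integral>x. (norm (v x) powr p + norm (w x) powr p) / 2
         - c * (norm (v x - w x) powr p - e powr p * (norm (v x) powr p + norm (w x) powr p)) \<partial>M)"
    proof (rule integral_mono_AE)
      show "AE x in M. (norm (v x + w x) / 2) powr p \<le> (norm (v x) powr p + norm (w x) powr p) / 2
         - c * (norm (v x - w x) powr p - e powr p * (norm (v x) powr p + norm (w x) powr p))"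
        using d(2) AE_space
      proof eventually_elim
        case (elim x)
        show ?case unfolding c_def
          using elim d e \<theta> p subspace_E[OF elim(2)] LpD(2)[OF vw(1) elim(2)] LpD(2)[OF vw(2) elim(2)]
          by (intro midpoint_powr_defect[of "E x"]) auto
      qed
    qed (use iv iw idiff isum in auto)
    also have "\<dots> = 1 - c * ((\<integral>x. norm (v x - w x) powr p \<partial>M) - e powr p * 2)"
      using iv iw idiff by simp
    also have "\<dots> \<le> 1 - c * (\<epsilon> powr p / 2)"
    proof -
      have "e powr p = \<epsilon> powr p / 4 powr p" using \<epsilon> by (simp add: e_def powr_divide)
      also have "\<dots> \<le> \<epsilon> powr p / 4" using powr_mono[of 1 p 4] p by (intro divide_left_mono) auto
      finally have "\<epsilon> powr p / 2 \<le> (\<integral>x. norm (v x - w x) powr p \<partial>M) - e powr p * 2" using i\<epsilon> by simp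
      then show ?thesis using c by simp
    qed
    also have "\<dots> \<le> r powr p" unfolding rp \<kappa>_def by simp
    finally have "(\<integral>x. norm ((1 / 2) *\<^sub>R (v x + w x)) powr p \<partial>M) \<le> r powr p" by simp
    then have "nrm (\<lambda>x. (1 / 2) *\<^sub>R (v x + w x)) \<le> r"
      using p by (subst Lp_map_norm_le_iff) (auto simp: r_def)
    then show "1 - r \<le> 1 - nrm (\<lambda>x. v x + w x) / 2" using p by (simp add: Lp_map_norm_scaleR)
  qed
  then show "0 < modulus (module_space M p \<Gamma>) \<epsilon>" using \<open>r < 1\<close> by simp
qed

end

section \<open>Values near the essential infimum\<close>

lemma AE_imp_ex:
  assumes "AE x in M. P x" "emeasure M (space M) \<noteq> 0"
  shows "\<exists>x. P x"
proof (rule ccontr)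
  assume "\<not> ?thesis"
  then have "AE x in M. x \<notin> space M" using assms(1) by simp
  then have "space M \<in> null_sets M" by (simp add: AE_iff_null_sets)
  then show False using assms(2) by auto
qed

lemma ess_inf_posD:
  assumes "0 < ess_inf M (\<lambda>x. ereal (f x))"
  obtains d where "0 < d" "AE x in M. d \<le> f x"
proof -
  obtain c where c: "AE x in M. c \<le> ereal (f x)" "0 < c" using assms by (auto simp: ess_inf_def less_Sup_iff)
  obtain d where d: "ereal 0 < ereal d" "ereal d < c" using ereal_dense2[of 0 c] c(2) by (auto simp: zero_ereal_def)
  have "AE x in M. d \<le> f x" using c(1) by eventually_elim (use d in \<open>auto dest: less_le_trans\<close>)
  then show thesis using d(1) by (intro that) auto
qed

lemma ess_inf_geI: "AE x in M. c \<le> f x \<Longrightarrow> c \<le> ess_inf M f"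
  by (auto simp: ess_inf_def intro: Sup_upper)

lemma ess_inf_cong_AE:
  assumes "AE x in M. f x = g x"
  shows "ess_inf M f = ess_inf M g"
proof -
  have "(AE x in M. c \<le> f x) \<longleftrightarrow> (AE x in M. c \<le> g x)" for c
  proof
    assume "AE x in M. c \<le> f x"
    with assms show "AE x in M. c \<le> g x" by eventually_elim simp
  next
    assume "AE x in M. c \<le> g x"
    with assms show "AE x in M. c \<le> f x" by eventually_elim simp
  qed
  then show ?thesis by (simp add: ess_inf_def)
qed

lemma ess_inf_approximated:
  fixes f :: "'x \<Rightarrow> real"
  assumes P: "AE x in M. P x" and bounds: "AE x in M. a \<le> f x \<and> f x \<le> b" and nonnull: "emeasure M (space M) \<noteq> 0"
  obtains t s where "ess_inf M (\<lambda>x. ereal (f x)) = ereal t" "a \<le> t" "t \<le> b" "\<And>j::nat. P (s j)"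
    "\<And>j. t \<le> f (s j)" "\<And>j. f (s j) \<le> b" "(\<lambda>j. f (s j)) \<longlonglongrightarrow> t"
proof -
  note ex = AE_imp_ex[OF _ nonnull]
  define T where "T = ess_inf M (\<lambda>x. ereal (f x))"
  have aT: "ereal a \<le> T" unfolding T_def using bounds by (intro ess_inf_geI) (auto elim: eventually_mono)
  have Tb: "T \<le> ereal b"
    unfolding T_def ess_inf_def
  proof (rule Sup_least)
    fix c assume "c \<in> {c. AE x in M. c \<le> ereal (f x)}"
    then have "AE x in M. c \<le> ereal (f x)" by simp
    then have "AE x in M. c \<le> ereal b" using bounds by eventually_elim (meson ereal_less_eq(3) order_trans)
    then show "c \<le> ereal b" using ex by blast
  qed
  obtain t where t: "T = ereal t" using aT Tb by (cases T) auto
  have low: "AE x in M. t \<le> f x"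
  proof -
    have "AE x in M. t - 1 / real (Suc j) \<le> f x" for j
    proof -
      have "ereal (t - 1 / real (Suc j)) < T" by (simp add: t)
      then obtain c where c: "AE x in M. c \<le> ereal (f x)" "ereal (t - 1 / real (Suc j)) < c"
        by (auto simp: T_def ess_inf_def less_Sup_iff)
      show ?thesis using c(1)
      proof eventually_elim
        case (elim x)
        then have "ereal (t - 1 / real (Suc j)) < ereal (f x)" using c(2) by (rule less_le_trans[rotated])
        then show ?case by simp
      qed
    qed
    then have "AE x in M. \<forall>j. t - 1 / real (Suc j) \<le> f x" unfolding AE_all_countable by blast
    then show ?thesis
    proof eventually_elim
      case (elim x)
      show ?case
      proof (rule field_le_epsilon)
        fix e :: real assume "0 < e"
        then obtain j where "1 / real (Suc j) < e" using nat_approx_posE by blast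
        then show "t \<le> f x + e" using elim[rule_format, of j] by simp
      qed
    qed
  qed
  have "\<exists>x. P x \<and> t \<le> f x \<and> f x \<le> b \<and> f x < t + 1 / real (Suc j)" for j
  proof (rule ccontr)
    assume no: "\<not> ?thesis"
    have "AE x in M. ereal (t + 1 / real (Suc j)) \<le> ereal (f x)"
      using P low bounds by eventually_elim (use no in force)
    then have "ereal (t + 1 / real (Suc j)) \<le> T" unfolding T_def by (rule ess_inf_geI)
    then show False by (simp add: t)
  qed
  then obtain s where s: "\<And>j. P (s j)" "\<And>j. t \<le> f (s j)" "\<And>j. f (s j) \<le> b" "\<And>j. f (s j) < t + 1 / real (Suc j)" by metis
  have "(\<lambda>j. t + 1 / real (Suc j)) \<longlonglongrightarrow> t + 0" by (intro tendsto_add tendsto_const LIMSEQ_Suc[OF lim_1_over_n])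
  then have "(\<lambda>j. f (s j)) \<longlonglongrightarrow> t"
    using s(2,4) by (intro tendsto_sandwich[of "\<lambda>_. t" "\<lambda>j. f (s j)" sequentially "\<lambda>j. t + 1 / real (Suc j)"]) (auto intro!: always_eventually less_imp_le)
  then show thesis using s aT Tb t by (intro that[of t s]) (auto simp: T_def)
qed

section \<open>Exhaustion by restricted measures\<close>

text \<open>
  Restricting the measure by a density keeps the \<open>\<sigma>\<close>-algebra and the underlying space, so that
  a bundle stays a bundle.
\<close>

definition restrict_mass :: "'x measure \<Rightarrow> 'x set \<Rightarrow> 'x measure" where
  "restrict_mass M X = density M (\<lambda>x. ennreal (indicat_real X x))"

lemma restrict_mass_simps [simp]:
  "space (restrict_mass M X) = space M" "sets (restrict_mass M X) = sets M"
  "measurable (restrict_mass M X) N = measurable M N"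
  by (auto simp: restrict_mass_def)

lemma AE_restrict_mass:
  assumes "X \<in> sets M"
  shows "(AE x in restrict_mass M X. P x) \<longleftrightarrow> (AE x in M. x \<in> X \<longrightarrow> P x)"
proof -
  have "(AE x in restrict_mass M X. P x) \<longleftrightarrow> (AE x in M. 0 < ennreal (indicat_real X x) \<longrightarrow> P x)"
    unfolding restrict_mass_def using assms by (intro AE_density) simp
  also have "\<dots> \<longleftrightarrow> (AE x in M. x \<in> X \<longrightarrow> P x)" by (intro AE_cong) (auto simp: indicator_def)
  finally show ?thesis .
qed

lemma sigma_finite_restrict_mass:
  assumes "sigma_finite_measure M" "X \<in> sets M"
  shows "sigma_finite_measure (restrict_mass M X)"
  unfolding restrict_mass_def using assms
  by (subst sigma_finite_measure.sigma_finite_iff_density_finite) auto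

lemma Lp_maps_restrict_mass:
  assumes "v \<in> Lp_maps M p" "X \<in> sets M"
  shows "v \<in> Lp_maps (restrict_mass M X) p"
    and "(\<integral>x. norm (v x) powr p \<partial>restrict_mass M X) = (\<integral>x. indicat_real X x * norm (v x) powr p \<partial>M)"
proof -
  note v = Lp_mapsD[OF assms(1)]
  have m: "(\<lambda>x. norm (v x) powr p) \<in> borel_measurable M" using v(1) by measurable
  have "integrable M (\<lambda>x. indicat_real X x * norm (v x) powr p)"
    using v(2) assms(2) integrable_mult_indicator[of X M "\<lambda>x. norm (v x) powr p"] by simp
  then have "integrable (restrict_mass M X) (\<lambda>x. norm (v x) powr p)"
    unfolding restrict_mass_def using m assms(2) by (subst integrable_density) auto
  then show "v \<in> Lp_maps (restrict_mass M X) p" using v(1) by (simp add: Lp_maps_def)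
  show "(\<integral>x. norm (v x) powr p \<partial>restrict_mass M X) = (\<integral>x. indicat_real X x * norm (v x) powr p \<partial>M)"
    unfolding restrict_mass_def using m assms(2) by (subst integral_density) auto
qed

lemma Lp_map_norm_exhaustion:
  assumes "v \<in> Lp_maps M p" "0 < p" and X: "\<And>n. X n \<in> sets M" "incseq X" "AE x in M. \<exists>n. x \<in> X n"
  shows "(\<lambda>n. Lp_map_norm (restrict_mass M (X n)) p v) \<longlonglongrightarrow> Lp_map_norm M p v"
proof -
  note v = Lp_mapsD[OF assms(1)]
  have "(\<lambda>n. \<integral>x. indicat_real (X n) x * norm (v x) powr p \<partial>M) \<longlonglongrightarrow> (\<integral>x. norm (v x) powr p \<partial>M)"
  proof (rule integral_dominated_convergence)
    show "integrable M (\<lambda>x. norm (v x) powr p)" by (rule v(2))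
    show "AE x in M. (\<lambda>n. indicat_real (X n) x * norm (v x) powr p) \<longlonglongrightarrow> norm (v x) powr p"
      using X(3)
    proof eventually_elim
      case (elim x)
      then obtain n where n: "x \<in> X n" by blast
      have "\<forall>\<^sub>F k in sequentially. indicat_real (X k) x * norm (v x) powr p = norm (v x) powr p"
        using eventually_ge_at_top[of n]
      proof eventually_elim
        case (elim k)
        then show ?case using n incseqD[OF X(2), of n k] by auto
      qed
      then show ?case by (rule tendsto_eventually)
    qed
    show "AE x in M. norm (indicat_real (X n) x * norm (v x) powr p) \<le> norm (v x) powr p" for n
      by (auto simp: indicator_def)
    show "(\<lambda>x. norm (v x) powr p) \<in> borel_measurable M" using v(1) by measurable
    show "(\<lambda>x. indicat_real (X n) x * norm (v x) powr p) \<in> borel_measurable M" for n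
      using v(1) X(1) by measurable
  qed
  then show ?thesis
    unfolding Lp_map_norm_eq Lp_maps_restrict_mass(2)[OF assms(1) X(1)]
    using assms(2) by (intro tendsto_powr') auto
qed

lemma Banach_bundle_restrict_mass: "Banach_bundle M E \<Longrightarrow> Banach_bundle (restrict_mass M X) E"
  by (simp add: Banach_bundle_def)

context Lp_bundle
begin

text \<open>
  Normalising two sections of norm close to one changes their sum and their difference little.
\<close>

lemma normalised_pair:
  assumes vw: "v \<in> L" "w \<in> L" and pos: "0 < nrm v" "0 < nrm w"
  obtains v' w' where "v' \<in> L" "w' \<in> L" "nrm v' = 1" "nrm w' = 1"
    "nrm (\<lambda>x. v x - w x) \<le> nrm (\<lambda>x. v' x - w' x) + (\<bar>nrm v - 1\<bar> + \<bar>nrm w - 1\<bar>)"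
    "nrm (\<lambda>x. v x + w x) \<le> nrm (\<lambda>x. v' x + w' x) + (\<bar>nrm v - 1\<bar> + \<bar>nrm w - 1\<bar>)"
proof -
  define \<alpha> where "\<alpha> = nrm v"
  define \<beta> where "\<beta> = nrm w"
  define v' where "v' x = (1 / \<alpha>) *\<^sub>R v x" for x
  define w' where "w' x = (1 / \<beta>) *\<^sub>R w x" for x
  have \<alpha>\<beta>: "0 < \<alpha>" "0 < \<beta>" using pos by (auto simp: \<alpha>_def \<beta>_def)
  have L': "v' \<in> L" "w' \<in> L" unfolding v'_def w'_def using vw by (auto intro: sections_closed_scaleR)
  have unit: "nrm v' = 1" "nrm w' = 1"
    unfolding v'_def w'_def using p \<alpha>\<beta> by (auto simp: Lp_map_norm_scaleR simp flip: \<alpha>_def \<beta>_def)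
  have vv': "v x = v' x + (\<alpha> - 1) *\<^sub>R v' x" "w x = w' x + (\<beta> - 1) *\<^sub>R w' x" for x
  proof -
    have "v' x + (\<alpha> - 1) *\<^sub>R v' x = \<alpha> *\<^sub>R v' x" "w' x + (\<beta> - 1) *\<^sub>R w' x = \<beta> *\<^sub>R w' x"
      by (simp_all add: scaleR_diff_left)
    moreover have "v x = \<alpha> *\<^sub>R v' x" "w x = \<beta> *\<^sub>R w' x" using \<alpha>\<beta> by (simp_all add: v'_def w'_def)
    ultimately show "v x = v' x + (\<alpha> - 1) *\<^sub>R v' x" "w x = w' x + (\<beta> - 1) *\<^sub>R w' x" by simp_all
  qed
  have perturb: "nrm (\<lambda>x. v x + c *\<^sub>R w x) \<le> nrm (\<lambda>x. v' x + c *\<^sub>R w' x) + (\<bar>\<alpha> - 1\<bar> + \<bar>\<beta> - 1\<bar>)"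
    if c: "\<bar>c\<bar> = 1" for c
  proof -
    define a where "a = (\<lambda>x. v' x + c *\<^sub>R w' x)"
    define b where "b = (\<lambda>x. (\<alpha> - 1) *\<^sub>R v' x)"
    define d where "d = (\<lambda>x. (c * (\<beta> - 1)) *\<^sub>R w' x)"
    have L: "a \<in> L" "b \<in> L" "d \<in> L" unfolding a_def b_def d_def
      using L' by (auto intro!: sections_closed sections_closed_scaleR)
    have "(\<lambda>x. v x + c *\<^sub>R w x) = (\<lambda>x. a x + (b x + d x))"
      by (rule ext) (simp add: a_def b_def d_def vv' scaleR_add_right algebra_simps)
    then have "nrm (\<lambda>x. v x + c *\<^sub>R w x) \<le> nrm a + nrm (\<lambda>x. b x + d x)"
      using Minkowski[OF LpD(1)[OF L(1)] LpD(1)[OF sections_closed(1)[OF L(2,3)]]] p by simp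
    also have "nrm (\<lambda>x. b x + d x) \<le> nrm b + nrm d"
      using Minkowski[OF LpD(1)[OF L(2)] LpD(1)[OF L(3)]] p by simp
    also have "nrm b = \<bar>\<alpha> - 1\<bar>" using p unit by (simp add: b_def Lp_map_norm_scaleR)
    also have "nrm d = \<bar>\<beta> - 1\<bar>" using p unit c by (simp add: d_def Lp_map_norm_scaleR abs_mult)
    finally show ?thesis by (simp add: a_def)
  qed
  show thesis
    using perturb[of 1] perturb[of "-1"] L' unit by (intro that[of v' w']) (auto simp flip: \<alpha>_def \<beta>_def)
qed

lemma widen_unit_pair_\<Gamma>:
  assumes vw: "v \<in> L" "w \<in> L" and unit: "nrm v = 1" "nrm w = 1"
    and gap: "0 < nrm (\<lambda>x. v x - w x)" "nrm (\<lambda>x. v x - w x) < 2" and "0 < \<eta>"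
  obtains v' w' where "v' \<in> L" "w' \<in> L" "nrm v' = 1" "nrm w' = 1"
    "nrm (\<lambda>x. v x - w x) < nrm (\<lambda>x. v' x - w' x)"
    "nrm (\<lambda>x. v x + w x) / 2 - \<eta> \<le> nrm (\<lambda>x. v' x + w' x) / 2"
proof -
  define a where "a x = (1/2) *\<^sub>R (v x + w x)" for x
  define b where "b x = (1/2) *\<^sub>R (v x - w x)" for x
  define g where "g s t x = s *\<^sub>R a x + t *\<^sub>R b x" for s t :: real and x
  define q where "q s t = nrm (g s t)" for s t
  have ab: "a \<in> L" "b \<in> L" unfolding a_def b_def using vw by (auto intro!: sections_closed sections_closed_scaleR)
  have gL: "g s t \<in> L" for s t unfolding g_def using ab by (intro sections_closed sections_closed_scaleR)
  have g_add: "g (s + s') (t + t') = (\<lambda>x. g s t x + g s' t' x)" for s s' t t'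
    by (rule ext) (simp add: g_def algebra_simps)
  have g_scale: "g (c * s) (c * t) = (\<lambda>x. c *\<^sub>R g s t x)" for c s t
    by (rule ext) (simp add: g_def scaleR_add_right)
  have half: "(1/2) *\<^sub>R z + (1/2) *\<^sub>R z = z" for z :: 'b by (simp flip: scaleR_add_left)
  have g_vw: "g 1 1 = v" "g 1 (-1) = w" "g 0 2 = (\<lambda>x. v x - w x)" "g 1 0 = (\<lambda>x. (1/2) *\<^sub>R (v x + w x))"
    by (auto simp: g_def a_def b_def algebra_simps half fun_eq_iff)
  obtain s1 t1 s2 t2 where st: "q s1 t1 = 1" "q s2 t2 = 1" "q 0 2 < q (s1 - s2) (t1 - t2)"
    "q 1 0 - \<eta> \<le> q ((s1 + s2) / 2) ((t1 + t2) / 2)"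
  proof (rule perturb_pair[of q \<eta>])
    show "q (s + s') (t + t') \<le> q s t + q s' t'" for s t s' t'
      unfolding q_def g_add using p by (intro Minkowski LpD(1) gL) simp
    show "q (c * s) (c * t) = \<bar>c\<bar> * q s t" for c s t
      unfolding q_def g_scale using p by (simp add: Lp_map_norm_scaleR)
    show "q 1 1 = 1" "q 1 (-1) = 1" "0 < q 0 2" "q 0 2 < 2" using unit gap by (auto simp: q_def g_vw)
  qed (use assms in auto)
  show thesis
  proof (rule that[of "g s1 t1" "g s2 t2"])
    have "(\<lambda>x. g s1 t1 x - g s2 t2 x) = g (s1 - s2) (t1 - t2)" by (auto simp: g_def algebra_simps)
    then show "nrm (\<lambda>x. v x - w x) < nrm (\<lambda>x. g s1 t1 x - g s2 t2 x)"
      using st(3) by (simp add: q_def g_vw)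
    have "g ((s1 + s2) / 2) ((t1 + t2) / 2) = (\<lambda>x. (1/2) *\<^sub>R (g s1 t1 x + g s2 t2 x))"
      using g_scale[of "1/2" "s1 + s2" "t1 + t2"] by (simp add: g_add)
    then show "nrm (\<lambda>x. v x + w x) / 2 - \<eta> \<le> nrm (\<lambda>x. g s1 t1 x + g s2 t2 x) / 2"
      using st(4) p by (simp add: q_def g_vw Lp_map_norm_scaleR)
  qed (use st gL in \<open>auto simp: q_def\<close>)
qed

text \<open>
  Equality in the triangle inequality forces the norms to agree pointwise, by strict convexity
  of the power, and the distance to be the sum of the norms pointwise.
\<close>

lemma antipodal_pair:
  assumes vw: "v \<in> L" "w \<in> L" and unit: "nrm v = 1" "nrm w = 1"
    and far: "2 \<le> nrm (\<lambda>x. v x - w x)"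
  shows "AE x in M. norm (w x) = norm (v x) \<and> norm (v x - w x) = 2 * norm (v x)"
proof -
  have iv: "integrable M (\<lambda>x. norm (v x) powr p)" "(\<integral>x. norm (v x) powr p \<partial>M) = 1"
    using LpD(1)[OF vw(1)] Lp_map_norm_powr[of p M v] unit p by (auto simp: Lp_maps_def)
  have iw: "integrable M (\<lambda>x. norm (w x) powr p)" "(\<integral>x. norm (w x) powr p \<partial>M) = 1"
    using LpD(1)[OF vw(2)] Lp_map_norm_powr[of p M w] unit p by (auto simp: Lp_maps_def)
  have idiff: "integrable M (\<lambda>x. norm (v x - w x) powr p)"
    using LpD(1)[OF sections_closed(2)[OF vw(1,2)]] by (auto simp: Lp_maps_def)
  have i2: "2 powr p \<le> (\<integral>x. norm (v x - w x) powr p \<partial>M)"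
    using powr_mono2[of p 2, OF _ _ far] p by (simp add: Lp_map_norm_powr)
  define f where "f x = 2 powr p * ((norm (v x) powr p + norm (w x) powr p) / 2) - norm (v x - w x) powr p" for x
  have chain: "norm (v x - w x) powr p \<le> 2 powr p * ((norm (v x) + norm (w x)) / 2) powr p"
    "2 powr p * ((norm (v x) + norm (w x)) / 2) powr p \<le> 2 powr p * ((norm (v x) powr p + norm (w x) powr p) / 2)" for x
  proof -
    have "norm (v x - w x) powr p \<le> (2 * ((norm (v x) + norm (w x)) / 2)) powr p"
      using norm_triangle_ineq4[of "v x" "w x"] p by (intro powr_mono2) auto
    then show "norm (v x - w x) powr p \<le> 2 powr p * ((norm (v x) + norm (w x)) / 2) powr p"
      unfolding powr_mult .
    show "2 powr p * ((norm (v x) + norm (w x)) / 2) powr p \<le> 2 powr p * ((norm (v x) powr p + norm (w x) powr p) / 2)"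
      using p by (intro mult_left_mono powr_midpoint_le) auto
  qed
  have f0: "0 \<le> f x" for x unfolding f_def diff_ge_0_iff_ge by (rule order_trans[OF chain])
  have f_int: "integrable M f" unfolding f_def using iv iw idiff by simp
  have "(\<integral>x. f x \<partial>M) = 2 powr p - (\<integral>x. norm (v x - w x) powr p \<partial>M)"
    unfolding f_def using iv iw idiff by simp
  then have "(\<integral>x. f x \<partial>M) = 0" using i2 integral_nonneg_AE[of f M] f0 by simp
  then have "AE x in M. f x = 0" using integral_nonneg_eq_0_iff_AE[OF f_int] f0 by simp
  then show ?thesis
  proof eventually_elim
    case (elim x)
    then have "norm (v x - w x) powr p = 2 powr p * ((norm (v x) + norm (w x)) / 2) powr p"
      and "2 powr p * ((norm (v x) + norm (w x)) / 2) powr p = 2 powr p * ((norm (v x) powr p + norm (w x) powr p) / 2)"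
      using chain[of x] by (auto simp: f_def)
    then have eq: "norm (v x) = norm (w x)" and "norm (v x - w x) powr p = (2 * norm (v x)) powr p"
      using powr_midpoint_eq[OF p, of "norm (v x)" "norm (w x)"] by (auto simp: powr_mult)
    then have "(norm (v x - w x) powr p) powr (1 / p) = ((2 * norm (v x)) powr p) powr (1 / p)" by simp
    then show ?case using p eq by (simp add: powr_powr)
  qed
qed

text \<open>
  A pair of sections is restricted to the sets of an exhaustion and normalised again. This may
  decrease the distance, so the pair is moved apart before; at distance 2 that is impossible,
  but then both sections have the same pointwise norm, the same constant normalises both, and
  the distance remains 2.
\<close>

lemma modulus_\<Gamma>_exhaustion:
  assumes X: "\<And>n. X n \<in> sets M" "incseq X" "AE x in M. \<exists>n. x \<in> X n" and \<epsilon>: "0 < \<epsilon>" "\<epsilon> \<le> 2" and "c \<le> 1"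
    and c: "\<forall>\<^sub>F n in sequentially. c \<le> modulus (module_space (restrict_mass M (X n)) p (Gamma_module (restrict_mass M (X n)) E p)) \<epsilon>"
  shows "c \<le> modulus (module_space M p \<Gamma>) \<epsilon>"
proof (rule modulus_\<Gamma>_greatest[OF \<open>c \<le> 1\<close>])
  define N where "N n = restrict_mass M (X n)" for n
  have N: "Lp_bundle (N n) E p" for n
    using is_bundle p by (simp add: N_def Lp_bundle_def Banach_bundle_restrict_mass)
  have LN: "v \<in> Lp_sections (N n) E p" if "v \<in> L" for v n
    using that X(1) by (auto simp: N_def Lp_sections_eq Lp_maps_restrict_mass)
  have lim: "(\<lambda>n. Lp_map_norm (N n) p v) \<longlonglongrightarrow> nrm v" if "v \<in> L" for v
    unfolding N_def using that p X by (intro Lp_map_norm_exhaustion LpD(1)) auto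
  have pos: "\<forall>\<^sub>F n in sequentially. 0 < Lp_map_norm (N n) p v" if "v \<in> L" "nrm v = 1" for v
    using order_tendstoD(1)[OF lim[OF that(1)], of 0] that(2) by simp
  have strict: "c \<le> 1 - nrm (\<lambda>x. v x + w x) / 2"
    if vw: "v \<in> L" "w \<in> L" and unit: "nrm v = 1" "nrm w = 1"
      and gap: "\<epsilon> < nrm (\<lambda>x. v x - w x)" for v w
  proof -
    define r where "r n = \<bar>Lp_map_norm (N n) p v - 1\<bar> + \<bar>Lp_map_norm (N n) p w - 1\<bar>" for n
    have "r \<longlonglongrightarrow> \<bar>1 - 1\<bar> + \<bar>1 - 1\<bar>" unfolding r_def
      using lim[OF vw(1)] lim[OF vw(2)] unit by (intro tendsto_intros) auto
    then have r: "r \<longlonglongrightarrow> 0" by simp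
    have "(\<lambda>n. Lp_map_norm (N n) p (\<lambda>x. v x - w x) - r n) \<longlonglongrightarrow> nrm (\<lambda>x. v x - w x) - 0"
      by (intro tendsto_diff r lim sections_closed vw)
    then have far: "\<forall>\<^sub>F n in sequentially. \<epsilon> < Lp_map_norm (N n) p (\<lambda>x. v x - w x) - r n"
      using gap by (intro order_tendstoD(1)) auto
    have "(\<lambda>n. 1 - (Lp_map_norm (N n) p (\<lambda>x. v x + w x) - r n) / 2) \<longlonglongrightarrow> 1 - (nrm (\<lambda>x. v x + w x) - 0) / 2"
      by (intro tendsto_intros r lim sections_closed vw) auto
    moreover have "\<forall>\<^sub>F n in sequentially. c \<le> 1 - (Lp_map_norm (N n) p (\<lambda>x. v x + w x) - r n) / 2"
      using far pos[OF vw(1) unit(1)] pos[OF vw(2) unit(2)] c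
    proof eventually_elim
      case (elim n)
      obtain v' w' where v': "v' \<in> Lp_sections (N n) E p" "w' \<in> Lp_sections (N n) E p"
        "Lp_map_norm (N n) p v' = 1" "Lp_map_norm (N n) p w' = 1"
        "Lp_map_norm (N n) p (\<lambda>x. v x - w x) \<le> Lp_map_norm (N n) p (\<lambda>x. v' x - w' x) + r n"
        "Lp_map_norm (N n) p (\<lambda>x. v x + w x) \<le> Lp_map_norm (N n) p (\<lambda>x. v' x + w' x) + r n"
        unfolding r_def by (rule Lp_bundle.normalised_pair[OF N LN[OF vw(1)] LN[OF vw(2)] elim(2,3)])
      have "\<epsilon> \<le> Lp_map_norm (N n) p (\<lambda>x. v' x - w' x)" using v'(5) elim(1) by simp
      from Lp_bundle.modulus_\<Gamma>(1)[OF N v'(1-4) this] elim(4)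
      have "c \<le> 1 - Lp_map_norm (N n) p (\<lambda>x. v' x + w' x) / 2" by (simp add: N_def)
      then show ?case using v'(6) by argo
    qed
    ultimately show ?thesis by (intro tendsto_lowerbound[where F = sequentially]) auto
  qed
  fix v w assume vw: "v \<in> L" "w \<in> L" and unit: "nrm v = 1" "nrm w = 1"
    and gap: "\<epsilon> \<le> nrm (\<lambda>x. v x - w x)"
  show "c \<le> 1 - nrm (\<lambda>x. v x + w x) / 2"
  proof (cases "nrm (\<lambda>x. v x - w x) < 2")
    case True
    show ?thesis
    proof (rule field_le_epsilon)
      fix \<eta> :: real assume "0 < \<eta>"
      obtain v' w' where v': "v' \<in> L" "w' \<in> L" "nrm v' = 1" "nrm w' = 1"
        "nrm (\<lambda>x. v x - w x) < nrm (\<lambda>x. v' x - w' x)"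
        "nrm (\<lambda>x. v x + w x) / 2 - \<eta> \<le> nrm (\<lambda>x. v' x + w' x) / 2"
        by (rule widen_unit_pair_\<Gamma>[OF vw unit less_le_trans[OF \<epsilon>(1) gap] True \<open>0 < \<eta>\<close>])
      have "c \<le> 1 - nrm (\<lambda>x. v' x + w' x) / 2" using v' gap by (intro strict) auto
      then show "c \<le> 1 - nrm (\<lambda>x. v x + w x) / 2 + \<eta>" using v'(6) by simp
    qed
  next
    case False
    then have anti: "AE x in M. norm (w x) = norm (v x) \<and> norm (v x - w x) = 2 * norm (v x)"
      using vw unit by (intro antipodal_pair) auto
    have "(\<lambda>n. 1 - Lp_map_norm (N n) p (\<lambda>x. v x + w x) / Lp_map_norm (N n) p v / 2) \<longlonglongrightarrow> 1 - nrm (\<lambda>x. v x + w x) / 1 / 2"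
      using lim[OF vw(1)] unit by (intro tendsto_intros lim sections_closed vw) auto
    moreover have "\<forall>\<^sub>F n in sequentially. c \<le> 1 - Lp_map_norm (N n) p (\<lambda>x. v x + w x) / Lp_map_norm (N n) p v / 2"
      using pos[OF vw(1) unit(1)] c
    proof eventually_elim
      case (elim n)
      define \<alpha> where "\<alpha> = Lp_map_norm (N n) p v"
      have \<alpha>: "0 < \<alpha>" using elim by (simp add: \<alpha>_def)
      have antiN: "AE x in N n. norm (w x) = norm (v x) \<and> norm (v x - w x) = 2 * norm (v x)"
        unfolding N_def AE_restrict_mass[OF X(1)] using anti by eventually_elim simp
      have meas: "v \<in> borel_measurable (N n)" "w \<in> borel_measurable (N n)" using LpD(3) vw by (auto simp: N_def)
      have w: "Lp_map_norm (N n) p w = \<alpha>" unfolding \<alpha>_def using antiN meas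
        by (intro Lp_map_norm_cong_AE) (auto elim: eventually_mono)
      have "Lp_map_norm (N n) p (\<lambda>x. v x - w x) = Lp_map_norm (N n) p (\<lambda>x. 2 *\<^sub>R v x)"
        using antiN meas by (intro Lp_map_norm_cong_AE) (auto elim: eventually_mono)
      then have diff: "Lp_map_norm (N n) p (\<lambda>x. v x - w x) = 2 * \<alpha>" using p by (simp add: Lp_map_norm_scaleR \<alpha>_def)
      have sc: "Lp_map_norm (N n) p (\<lambda>x. (1 / \<alpha>) *\<^sub>R u x) = Lp_map_norm (N n) p u / \<alpha>" for u :: "'x \<Rightarrow> 'b"
        using p \<alpha> by (simp add: Lp_map_norm_scaleR)
      have "modulus (module_space (N n) p (Gamma_module (N n) E p)) \<epsilon>
        \<le> 1 - Lp_map_norm (N n) p (\<lambda>x. (1 / \<alpha>) *\<^sub>R v x + (1 / \<alpha>) *\<^sub>R w x) / 2"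
      proof (rule Lp_bundle.modulus_\<Gamma>(1)[OF N])
        show "(\<lambda>x. (1 / \<alpha>) *\<^sub>R v x) \<in> Lp_sections (N n) E p" "(\<lambda>x. (1 / \<alpha>) *\<^sub>R w x) \<in> Lp_sections (N n) E p"
          using vw by (auto intro!: LN sections_closed_scaleR)
        show "Lp_map_norm (N n) p (\<lambda>x. (1 / \<alpha>) *\<^sub>R v x) = 1" "Lp_map_norm (N n) p (\<lambda>x. (1 / \<alpha>) *\<^sub>R w x) = 1"
          using \<alpha> by (simp_all only: sc w) (simp_all flip: \<alpha>_def)
        show "\<epsilon> \<le> Lp_map_norm (N n) p (\<lambda>x. (1 / \<alpha>) *\<^sub>R v x - (1 / \<alpha>) *\<^sub>R w x)"
          unfolding scaleR_diff_right[symmetric] sc diff using \<alpha> \<epsilon> by simp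
      qed
      then show ?case using elim(2) unfolding scaleR_add_right[symmetric] sc by (simp add: N_def \<alpha>_def)
    qed
    ultimately have "c \<le> 1 - nrm (\<lambda>x. v x + w x) / 1 / 2"
      by (intro tendsto_lowerbound[where F = sequentially]) auto
    then show ?thesis by simp
  qed
qed

text \<open>
  Let \<open>\<delta>\<close> be the fibre modulus at \<open>\<epsilon> / 5\<close> and let \<open>c\<close> be a positive essential lower bound of
  \<open>\<phi> \<epsilon> (\<delta> x)\<close>. If the essential infimum \<open>t\<close> of \<open>\<delta>\<close> is positive, then \<open>c \<le> \<phi> \<epsilon> t\<close> by continuity
  and the hypothesis on the gauge applies. If it is 0, then \<open>\<delta>\<close> is still positive almost
  everywhere, but nothing is known about \<open>\<phi> \<epsilon>\<close> near 0. Therefore the hypothesis is applied to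
  the measures restricted to the sets where \<open>\<delta>\<close> is at least \<open>1 / (n + 1)\<close>, and the bounds are
  passed to the limit.
\<close>

lemma gauge_le_modulus_\<Gamma>:
  assumes "sigma_finite_measure M" and nonnull: "emeasure M (space M) \<noteq> 0" and \<epsilon>: "0 < \<epsilon>" "\<epsilon> \<le> 2"
    and gauge: "convexity_gauge \<phi>"
    and \<phi>: "\<And>(N :: 'x measure) (\<M> :: ('x, ('x \<Rightarrow> 'b) set) normed_module).
      \<lbrakk>sigma_finite_measure N; emeasure N (space N) \<noteq> 0; Lp_Banach_module N p \<M>\<rbrakk> \<Longrightarrow>
      zero_ext \<phi> \<epsilon> (real_of_ereal (ess_inf N (\<lambda>x. ereal (pointwise_modulus N \<M> (\<epsilon> / 5) x))))
        \<le> modulus (module_space N p \<M>) \<epsilon>"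
  shows "ess_inf M (\<lambda>x. ereal (zero_ext \<phi> \<epsilon> (modulus (subspace_of (E x)) (\<epsilon> / 5))))
    \<le> ereal (modulus (module_space M p \<Gamma>) \<epsilon>)"
  unfolding ess_inf_def
proof (rule Sup_least, unfold mem_Collect_eq)
  define \<delta> where "\<delta> x = modulus (subspace_of (E x)) (\<epsilon> / 5)" for x
  have \<delta>01: "0 \<le> \<delta> x" "\<delta> x \<le> 1" for x by (simp_all add: \<delta>_def modulus_subspace)
  have \<delta>_meas [measurable]: "\<delta> \<in> borel_measurable M"
    unfolding \<delta>_def using is_bundle \<epsilon> by (intro borel_measurable_modulus) auto
  note ex = AE_imp_ex[OF _ nonnull]
  have \<phi>1: "\<phi> \<epsilon> t \<le> 1" if "0 < t" "t \<le> 1" for t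
    using gauge \<epsilon> that by (auto simp: convexity_gauge_def)
  have \<phi>_cont: "continuous_on {0<..1} (\<phi> \<epsilon>)"
  proof -
    have "continuous_on ({0<..2} \<times> {0<..1}) (\<lambda>(\<epsilon>, t). \<phi> \<epsilon> t)" using gauge by (simp add: convexity_gauge_def)
    then have "continuous_on {0<..1} ((\<lambda>(\<epsilon>, t). \<phi> \<epsilon> t) \<circ> (\<lambda>t. (\<epsilon>, t)))"
      using \<epsilon> by (intro continuous_on_compose continuous_intros) (auto elim: continuous_on_subset)
    then show ?thesis by (simp add: o_def)
  qed
  fix k assume k: "AE x in M. k \<le> ereal (zero_ext \<phi> \<epsilon> (modulus (subspace_of (E x)) (\<epsilon> / 5)))"
  then have k: "AE x in M. k \<le> ereal (zero_ext \<phi> \<epsilon> (\<delta> x))" by (simp add: \<delta>_def)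
  have m0: "0 \<le> modulus (module_space M p \<Gamma>) \<epsilon>" by (rule modulus_\<Gamma>)
  show "k \<le> ereal (modulus (module_space M p \<Gamma>) \<epsilon>)"
  proof (cases "k \<le> 0")
    case True
    then show ?thesis using m0 by (auto simp: zero_ereal_def intro: order_trans)
  next
    case False
    then have k0: "0 < k" by simp
    obtain x where "k \<le> ereal (zero_ext \<phi> \<epsilon> (\<delta> x))" using ex[OF k] by blast
    then obtain c where c: "k = ereal c" using k0 by (cases k) auto
    have c0: "0 < c" using k0 c by simp
    have good: "AE x in M. 0 < \<delta> x \<and> c \<le> \<phi> \<epsilon> (\<delta> x)"
      using k
    proof eventually_elim
      case (elim x)
      then show ?case using c c0 \<delta>01(1)[of x] by (auto simp: zero_ext_def less_le split: if_splits)
    qed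
    then obtain x where "0 < \<delta> x" "c \<le> \<phi> \<epsilon> (\<delta> x)" using ex by blast
    then have c1: "c \<le> 1" using \<phi>1[of "\<delta> x"] \<delta>01(2)[of x] by simp
    define X where "X n = {x \<in> space M. 1 / real (Suc n) \<le> \<delta> x}" for n
    have X: "X n \<in> sets M" for n unfolding X_def by measurable
    have X_inc: "incseq X"
    proof (rule incseq_SucI)
      fix n
      have "1 / real (Suc (Suc n)) \<le> 1 / real (Suc n)" by (intro divide_left_mono) auto
      then show "X n \<subseteq> X (Suc n)" by (auto simp: X_def)
    qed
    have X_all: "AE x in M. \<exists>n. x \<in> X n"
      using good AE_space
    proof eventually_elim
      case (elim x)
      then obtain n where "1 / real (Suc n) < \<delta> x" using nat_approx_posE by blast
      then show ?case using elim by (intro exI[of _ n]) (simp add: X_def)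
    qed
    have "\<exists>n. emeasure M (X n) \<noteq> 0"
    proof (rule ccontr)
      assume "\<not> ?thesis"
      then have "AE x in M. x \<notin> X n" for n using X by (intro AE_not_in) (auto simp: null_sets_def)
      then have "AE x in M. \<forall>n. x \<notin> X n" unfolding AE_all_countable by blast
      with X_all have "AE x in M. False" by eventually_elim blast
      then show False using ex by blast
    qed
    then obtain n0 where n0: "emeasure M (X n0) \<noteq> 0" by blast
    have "c \<le> modulus (module_space (restrict_mass M (X n)) p (Gamma_module (restrict_mass M (X n)) E p)) \<epsilon>"
      if "n0 \<le> n" for n
    proof -
      define N where "N = restrict_mass M (X n)"
      have N: "Lp_bundle N E p" using is_bundle p by (simp add: N_def Lp_bundle_def Banach_bundle_restrict_mass)
      have sf: "sigma_finite_measure N" unfolding N_def using assms(1) X by (rule sigma_finite_restrict_mass)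
      have AE_N: "(AE x in N. P x) \<longleftrightarrow> (AE x in M. x \<in> X n \<longrightarrow> P x)" for P
        unfolding N_def using X by (rule AE_restrict_mass)
      have "emeasure M (X n0) \<le> emeasure M (X n)" using that X X_inc by (intro emeasure_mono) (auto simp: incseq_def)
      then have "emeasure M (X n) \<noteq> 0" using n0 by auto
      then have nn: "emeasure N (space N) \<noteq> 0"
      proof (rule contrapos_nn)
        assume "emeasure N (space N) = 0"
        then have "AE x in N. x \<notin> space N" by (intro AE_not_in) (auto simp: null_sets_def)
        then have "AE x in M. x \<notin> X n" unfolding AE_N using AE_space by eventually_elim (simp add: N_def)
        then show "emeasure M (X n) = 0" using X by (simp add: AE_iff_null_sets null_setsD1)
      qed
      have pw: "AE x in N. ereal (pointwise_modulus N (Gamma_module N E p) (\<epsilon> / 5) x) = ereal (\<delta> x)"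
        using Lp_bundle.pointwise_modulus_eq[OF N sf, of "\<epsilon> / 5"] \<epsilon> by (auto simp: \<delta>_def elim: eventually_mono)
      have "AE x in N. c \<le> \<phi> \<epsilon> (\<delta> x)" unfolding AE_N using good by eventually_elim simp
      moreover have "AE x in N. 1 / real (Suc n) \<le> \<delta> x \<and> \<delta> x \<le> 1"
        unfolding AE_N using \<delta>01 by (simp add: X_def)
      ultimately obtain t s where t: "ess_inf N (\<lambda>x. ereal (\<delta> x)) = ereal t" "1 / real (Suc n) \<le> t" "t \<le> 1"
        and s: "\<And>j::nat. c \<le> \<phi> \<epsilon> (\<delta> (s j))" "\<And>j. t \<le> \<delta> (s j)" "\<And>j. \<delta> (s j) \<le> 1" "(\<lambda>j. \<delta> (s j)) \<longlonglongrightarrow> t"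
        by (rule ess_inf_approximated[OF _ _ nn]) blast
      have t0: "0 < t" by (rule less_le_trans[OF _ t(2)]) simp
      have "(\<lambda>j. \<phi> \<epsilon> (\<delta> (s j))) \<longlonglongrightarrow> \<phi> \<epsilon> t"
        using t0 t(3) s(2,3) by (intro continuous_on_tendsto_compose[OF \<phi>_cont s(4)])
          (auto intro!: always_eventually intro: less_le_trans)
      then have "c \<le> \<phi> \<epsilon> t" using s(1) by (intro LIMSEQ_le_const) auto
      also have "\<phi> \<epsilon> t = zero_ext \<phi> \<epsilon> (real_of_ereal (ess_inf N (\<lambda>x. ereal (pointwise_modulus N (Gamma_module N E p) (\<epsilon> / 5) x))))"
        unfolding ess_inf_cong_AE[OF pw] t(1) using t0 by (simp add: zero_ext_def)
      also have "\<dots> \<le> modulus (module_space N p (Gamma_module N E p)) \<epsilon>"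
        by (rule \<phi>[OF sf nn Lp_bundle.Lp_Banach_module_\<Gamma>[OF N]])
      finally show ?thesis by (simp add: N_def)
    qed
    then have "\<forall>\<^sub>F n in sequentially. c \<le> modulus (module_space (restrict_mass M (X n)) p (Gamma_module (restrict_mass M (X n)) E p)) \<epsilon>"
      unfolding eventually_sequentially by blast
    then have "c \<le> modulus (module_space M p \<Gamma>) \<epsilon>"
      by (rule modulus_\<Gamma>_exhaustion[OF X X_inc X_all \<epsilon> c1])
    then show ?thesis by (simp add: c)
  qed
qed

end

section \<open>Fibres and the space of sections compared\<close>

text \<open>
  The first part is Day's theorem. In the second one a single null set has to serve all
  distances; as moduli are monotone, the countably many distances \<open>1 / (n + 1)\<close> suffice for
  this.
\<close>

lemma uniformly_convex_fibres_iff: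
  fixes E :: "'x \<Rightarrow> 'b::{banach, second_countable_topology} set"
  assumes "sigma_finite_measure M" "Banach_bundle M E"
  defines "condition_i \<equiv> uniformly_convex_bundle M E \<and>
             (\<forall>\<epsilon>\<in>{0<..2}. ess_inf M (\<lambda>x. ereal (modulus (subspace_of (E x)) \<epsilon>)) > 0)"
  shows "\<lbrakk>condition_i; 1 < p\<rbrakk> \<Longrightarrow> uniformly_convex (module_space M p (Gamma_module M E p))"
    and "\<lbrakk>1 < p; uniformly_convex (module_space M p (Gamma_module M E p))\<rbrakk> \<Longrightarrow> condition_i"
proof -
  assume i: condition_i and "1 < p"
  then interpret Lp_bundle M E p using assms by unfold_locales
  show "uniformly_convex (module_space M p (Gamma_module M E p))"
  proof (rule uniformly_convex_\<Gamma>)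
    fix \<epsilon> :: real assume "0 < \<epsilon>" "\<epsilon> \<le> 2"
    then have "0 < ess_inf M (\<lambda>x. ereal (modulus (subspace_of (E x)) \<epsilon>))" using i by (simp add: condition_i_def)
    then show "\<exists>d>0. AE x in M. d \<le> modulus (subspace_of (E x)) \<epsilon>" by (rule ess_inf_posD) blast
  qed
next
  assume "1 < p" and uc: "uniformly_convex (module_space M p (Gamma_module M E p))"
  then interpret Lp_bundle M E p using assms by unfold_locales
  define m where "m \<epsilon> = modulus (module_space M p (Gamma_module M E p)) \<epsilon>" for \<epsilon>
  have m: "0 < m \<epsilon>" "AE x in M. m \<epsilon> \<le> modulus (subspace_of (E x)) \<epsilon>" if "\<epsilon> \<in> {0<..2}" for \<epsilon>
    using uc that modulus_\<Gamma>_le_fibre[OF assms(1), of \<epsilon>] by (auto simp: m_def uniformly_convex_def)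
  have "AE x in M. \<forall>n::nat. m (1 / real (Suc n)) \<le> modulus (subspace_of (E x)) (1 / real (Suc n))"
    unfolding AE_all_countable by (intro allI m) (auto simp: field_simps)
  then have "uniformly_convex_bundle M E"
    unfolding uniformly_convex_bundle_def
  proof eventually_elim
    case (elim x)
    show ?case unfolding uniformly_convex_def
    proof
      fix \<epsilon> :: real assume "\<epsilon> \<in> {0<..2}"
      then obtain n where n: "1 / real (Suc n) < \<epsilon>" using nat_approx_posE by auto
      have "0 < m (1 / real (Suc n))" by (rule m) (auto simp: field_simps)
      also have "\<dots> \<le> modulus (subspace_of (E x)) (1 / real (Suc n))" using elim by blast
      also have "\<dots> \<le> modulus (subspace_of (E x)) \<epsilon>" using n by (intro modulus_subspace_mono) auto
      finally show "0 < modulus (subspace_of (E x)) \<epsilon>" .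
    qed
  qed
  moreover have "ess_inf M (\<lambda>x. ereal (modulus (subspace_of (E x)) \<epsilon>)) > 0" if "\<epsilon> \<in> {0<..2}" for \<epsilon>
  proof -
    have "0 < ereal (m \<epsilon>)" using m(1)[OF that] by simp
    also have "\<dots> \<le> ess_inf M (\<lambda>x. ereal (modulus (subspace_of (E x)) \<epsilon>))"
      using m(2)[OF that] by (intro ess_inf_geI) simp
    finally show ?thesis .
  qed
  ultimately show condition_i by (simp add: condition_i_def)
qed

theorem theorem3p6:
  fixes M :: "'x measure"
    and E :: "'x \<Rightarrow> 'b::{banach, second_countable_topology} set"
  assumes "sigma_finite_measure M"
    and "Banach_bundle M E"
  shows
    "(\<forall>p::real. 1 < p \<longrightarrow> (\<forall>\<epsilon>\<in>{0<..2}. AE x in M.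
        (\<epsilon> = 2 \<longrightarrow> strictly_convex (subspace_of (E x))) \<longrightarrow>
        modulus (subspace_of (E x)) \<epsilon> = pointwise_modulus M (Gamma_module M E p) \<epsilon> x))
     \<and>
     (let condition_i =
            (uniformly_convex_bundle M E \<and>
             (\<forall>\<epsilon>\<in>{0<..2}. ess_inf M (\<lambda>x. ereal (modulus (subspace_of (E x)) \<epsilon>)) > 0))
      in (condition_i \<longleftrightarrow>
            (\<forall>p::real. 1 < p \<longrightarrow> uniformly_convex (module_space M p (Gamma_module M E p)))) \<and>
         (condition_i \<longleftrightarrow>
            (\<exists>p::real. 1 < p \<and> uniformly_convex (module_space M p (Gamma_module M E p)))))
     \<and>
     (\<forall>p::real. 1 < p \<longrightarrow> (\<forall>\<phi>. convexity_gauge \<phi> \<and>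
        (\<forall>(N :: 'x measure) (\<M> :: ('x, ('x \<Rightarrow> 'b) set) normed_module).
           sigma_finite_measure N \<and> emeasure N (space N) \<noteq> 0 \<and> Lp_Banach_module N p \<M> \<longrightarrow>
           (\<forall>\<epsilon>\<in>{0<..2}.
              zero_ext \<phi> \<epsilon>
                (real_of_ereal (ess_inf N (\<lambda>x. ereal (pointwise_modulus N \<M> (\<epsilon> / 5) x))))
              \<le> modulus (module_space N p \<M>) \<epsilon>)) \<longrightarrow>
        emeasure M (space M) \<noteq> 0 \<longrightarrow>
        (\<forall>\<epsilon>\<in>{0<..2}.
           ess_inf M (\<lambda>x. ereal (zero_ext \<phi> \<epsilon> (modulus (subspace_of (E x)) (\<epsilon> / 5))))
           \<le> ereal (modulus (module_space M p (Gamma_module M E p)) \<epsilon>))))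
     \<and>
     (\<forall>p::real. 1 < p \<longrightarrow> (\<forall>\<epsilon>\<in>{0<..2}.
        ereal (modulus (module_space M p (Gamma_module M E p)) \<epsilon>)
        \<le> ess_inf M (\<lambda>x. ereal (modulus (subspace_of (E x)) \<epsilon>))))"
proof (intro conjI allI impI ballI)
  have loc: "Lp_bundle M E p" if "1 < p" for p using assms(2) that by unfold_locales
  fix p \<epsilon> :: real assume p: "1 < p" and \<epsilon>: "\<epsilon> \<in> {0<..2}"
  interpret Lp_bundle M E p using p by (rule loc)
  show "AE x in M. (\<epsilon> = 2 \<longrightarrow> strictly_convex (subspace_of (E x))) \<longrightarrow>
        modulus (subspace_of (E x)) \<epsilon> = pointwise_modulus M (Gamma_module M E p) \<epsilon> x"
  proof (cases "\<epsilon> = 2")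
    case True
    show ?thesis using pointwise_modulus_2 AE_space
    proof eventually_elim
      case (elim x)
      then show ?case using True strictly_convex_modulus_2[of "E x"] subspace_E by simp
    qed
  next
    case False
    then have "AE x in M. pointwise_modulus M (Gamma_module M E p) \<epsilon> x = modulus (subspace_of (E x)) \<epsilon>"
      using \<epsilon> by (intro pointwise_modulus_eq assms(1)) auto
    then show ?thesis by eventually_elim simp
  qed
  show "ereal (modulus (module_space M p (Gamma_module M E p)) \<epsilon>)
        \<le> ess_inf M (\<lambda>x. ereal (modulus (subspace_of (E x)) \<epsilon>))"
    using modulus_\<Gamma>_le_fibre[OF assms(1), of \<epsilon>] \<epsilon> by (intro ess_inf_geI) simp
next
  show "let condition_i =
            (uniformly_convex_bundle M E \<and>
             (\<forall>\<epsilon>\<in>{0<..2}. ess_inf M (\<lambda>x. ereal (modulus (subspace_of (E x)) \<epsilon>)) > 0))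
      in (condition_i \<longleftrightarrow>
            (\<forall>p::real. 1 < p \<longrightarrow> uniformly_convex (module_space M p (Gamma_module M E p)))) \<and>
         (condition_i \<longleftrightarrow>
            (\<exists>p::real. 1 < p \<and> uniformly_convex (module_space M p (Gamma_module M E p))))"
    (is "let c = ?i in (c \<longleftrightarrow> ?all) \<and> (c \<longleftrightarrow> ?some)")
  proof -
    note uc = uniformly_convex_fibres_iff[OF assms]
    have "?i \<Longrightarrow> ?all" using uc(1) by blast
    moreover have "?all \<Longrightarrow> ?some" by (intro exI[of _ 2]) simp
    moreover have "?some \<Longrightarrow> ?i" using uc(2) by blast
    ultimately show ?thesis unfolding Let_def by blast
  qed
next
  fix p \<epsilon> :: real and \<phi>
  assume p: "1 < p" and \<epsilon>: "\<epsilon> \<in> {0<..2}" and nn: "emeasure M (space M) \<noteq> 0"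
    and \<phi>: "convexity_gauge \<phi> \<and>
        (\<forall>(N :: 'x measure) (\<M> :: ('x, ('x \<Rightarrow> 'b) set) normed_module).
           sigma_finite_measure N \<and> emeasure N (space N) \<noteq> 0 \<and> Lp_Banach_module N p \<M> \<longrightarrow>
           (\<forall>\<epsilon>\<in>{0<..2}.
              zero_ext \<phi> \<epsilon>
                (real_of_ereal (ess_inf N (\<lambda>x. ereal (pointwise_modulus N \<M> (\<epsilon> / 5) x))))
              \<le> modulus (module_space N p \<M>) \<epsilon>))"
  interpret Lp_bundle M E p using assms(2) p by unfold_locales
  show "ess_inf M (\<lambda>x. ereal (zero_ext \<phi> \<epsilon> (modulus (subspace_of (E x)) (\<epsilon> / 5))))
           \<le> ereal (modulus (module_space M p (Gamma_module M E p)) \<epsilon>)"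
    using \<phi> \<epsilon> by (intro gauge_le_modulus_\<Gamma>[OF assms(1) nn]) auto
qed

end
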